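(* Let $d\ge 3$. For $d$-dimensional polytopes $P,Q\subset\mathbb{R}^d$ containing the origin in their interiors consider the properties (A) $P\simeq Q$ inducing $\widetilde{\mathcal H}(P)=\widetilde{\mathcal H}(Q)$; (B) $P\simeq Q$ inducing $\mathrm{OM}(\widetilde{\mathcal H}(P))=\mathrm{OM}(\widetilde{\mathcal H}(Q))$; (C) $P,Q$ are pointwise central-slice-equivalent; (D) $P\simeq Q$; (E) $P,Q$ are setwise central-slice-equivalent; (F) $\mathcal H(P)=\mathcal H(Q)$. Then for every $d\ge 3$ and all such $P,Q$ the following implications hold: (A) $\Rightarrow$ (B), (A) $\Rightarrow$ (C), (B) $\Rightarrow$ (D), (B) $\Rightarrow$ (E), (C) $\Rightarrow$ (E), (C) $\Rightarrow$ (F). None of the reverse implications holds in dimension $d=3$: (B) $\not\Rightarrow$ (A), (C) $\not\Rightarrow$ (A), (D) $\not\Rightarrow$ (B), (E) $\not\Rightarrow$ (B), (E) $\not\Rightarrow$ (C), (F) $\not\Rightarrow$ (C). Moreover, for $d=3$, for each of the pairs of properties not related by (a chain of) the implications (A) $\Rightarrow$ (B), (A) $\Rightarrow$ (C), (B) $\Rightarrow$ (D), (B) $\Rightarrow$ (E), (C) $\Rightarrow$ (E), (C) $\Rightarrow$ (F), namely $\{B,C\}$, $\{B,F\}$, $\{C,D\}$, $\{D,E\}$, $\{D,F\}$, $\{E,F\}$, neither property implies the other. (Here "$X\not\Rightarrow Y$" means that there exist $3$-dimensional polytopes $P,Q\subset\mathbb{R}^3$ with the origin in their interiors that satisfy $X$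 but not $Y$.)
   Context: $P\simeq Q$ means that the face lattices $\mathcal L(P)$ and $\mathcal L(Q)$ are isomorphic (combinatorial equivalence). For $u\in\mathbb{S}^{d-1}$, $u^\perp$ is the hyperplane through the origin orthogonal to $u$; $P\cap u^\perp$ is a central slice. $P,Q$ are pointwise central-slice-equivalent if $P\cap u^\perp\simeq Q\cap u^\perp$ for every $u\in\mathbb{S}^{d-1}$; they are setwise central-slice-equivalent if the set of combinatorial types of central slices of $P$ agrees with that of $Q$. $\mathcal H(P)=\{v^\perp\mid v \text{ a vertex of } P\}$ is the (unsigned) central hyperplane arrangement, a set of hyperplanes. The signed arrangement $\widetilde{\mathcal H}(P)$ consists of the signed hyperplanes $H_v=v^\perp$, one for each vertex $v$ of $P$, with positive side $\{x\mid\langle v,x\rangle>0\}$ and negative side $\{x\mid\langle v,x\rangle<0\}$ (so vertices $v$ and $\alpha v$ with $\alpha<0$ give distinct signed hyperplanes). After ordering the vertices $v_1,\dots,v_n$ of $P$, $\mathrm{OM}(\widetilde{\mathcal H}(P))$ is identified with the set of signed covectors $(\operatorname{sgn}\langle u,v_i\rangle)_{i\in[n]}\in\{-,0,+\}^n$, $u\in\mathbb{R}^d$. If $P\simeq Q$ via an isomorphism $i:\mathcal L(P)\to\mathcal L(Q)$, then $i$ induces a bijection $i^*:\widetilde{\mathcal H}(P)\to\widetilde{\mathcal H}(Q)$, $v^\perp\mapsto i(v)^\perp$. "$P\simeq Q$ inducing $\widetilde{\mathcal H}(P)=\widetilde{\mathcal H}(Q)$" means that there is an isomorphism $i$ such that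 for every vertex $v$ of $P$, $v^\perp$ and $i(v)^\perp$ agree as signed hyperplanes. "$P\simeq Q$ inducing $\mathrm{OM}(\widetilde{\mathcal H}(P))=\mathrm{OM}(\widetilde{\mathcal H}(Q))$" means that there is an isomorphism $i$ such that the oriented matroids (sets of signed covectors) agree under the bijection $i^*$. *)

theory Defs
  imports "HOL-Analysis.Analysis"
begin

definition origin_polytope :: "'a::euclidean_space set \<Rightarrow> bool" where
  "origin_polytope P \<longleftrightarrow> polytope P \<and> aff_dim P = int DIM('a) \<and> 0 \<in> interior P"

definition vertices :: "'a::euclidean_space set \<Rightarrow> 'a set" where
  "vertices P = {v. v extreme_point_of P}"

definition perp :: "'a::euclidean_space \<Rightarrow> 'a set" where
  "perp u = {x. u \<bullet> x = 0}"

text \<open>Ordered by inclusion; the empty set and \<open>P\<close> itself are faces.\<close>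

definition face_lattice :: "'a::euclidean_space set \<Rightarrow> 'a set set" where
  "face_lattice P = {F. F face_of P}"

definition face_lattice_iso ::
  "('a::euclidean_space set \<Rightarrow> 'a set) \<Rightarrow> 'a set \<Rightarrow> 'a set \<Rightarrow> bool" where
  "face_lattice_iso i P Q \<longleftrightarrow>
     bij_betw i (face_lattice P) (face_lattice Q) \<and>
     (\<forall>F\<in>face_lattice P. \<forall>G\<in>face_lattice P. F \<subseteq> G \<longleftrightarrow> i F \<subseteq> i G)"

definition comb_equiv :: "'a::euclidean_space set \<Rightarrow> 'a set \<Rightarrow> bool"  (infix "\<simeq>" 50) where
  "P \<simeq> Q \<longleftrightarrow> (\<exists>i. face_lattice_iso i P Q)"

text \<open>
  For polytopes, an isomorphism \<open>i\<close> of face lattices sends the vertex face \<open>{v}\<close> to a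
  vertex face \<open>{w}\<close>, and \<open>vertex_map i v\<close> is this \<open>w\<close>.
\<close>

definition vertex_map :: "('a::euclidean_space set \<Rightarrow> 'a set) \<Rightarrow> 'a \<Rightarrow> 'a" where
  "vertex_map i v = the_elem (i {v})"

definition pointwise_slice_equiv :: "'a::euclidean_space set \<Rightarrow> 'a set \<Rightarrow> bool" where
  "pointwise_slice_equiv P Q \<longleftrightarrow> (\<forall>u\<in>sphere 0 1. P \<inter> perp u \<simeq> Q \<inter> perp u)"

definition comb_type :: "'a::euclidean_space set \<Rightarrow> 'a set set" where
  "comb_type P = {R. polytope R \<and> P \<simeq> R}"

definition slice_types :: "'a::euclidean_space set \<Rightarrow> 'a set set set" where
  "slice_types P = {comb_type (P \<inter> perp u) | u. u \<in> sphere 0 1}"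

definition setwise_slice_equiv :: "'a::euclidean_space set \<Rightarrow> 'a set \<Rightarrow> bool" where
  "setwise_slice_equiv P Q \<longleftrightarrow> slice_types P = slice_types Q"

definition arrangement :: "'a::euclidean_space set \<Rightarrow> 'a set set" where
  "arrangement P = {perp v | v. v \<in> vertices P}"

text \<open>A signed hyperplane is a hyperplane together with its positive and its negative side.\<close>

definition signed_hyperplane :: "'a::euclidean_space \<Rightarrow> 'a set \<times> 'a set \<times> 'a set" where
  "signed_hyperplane v = (perp v, {x. v \<bullet> x > 0}, {x. v \<bullet> x < 0})"

definition equiv_inducing_signed_arrangement ::
  "'a::euclidean_space set \<Rightarrow> 'a set \<Rightarrow> bool" where
  "equiv_inducing_signed_arrangement P Q \<longleftrightarrow>
     (\<exists>i. face_lattice_iso i P Q \<and>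
          (\<forall>v\<in>vertices P. signed_hyperplane v = signed_hyperplane (vertex_map i v)))"

text \<open>
  The oriented matroid of the signed hyperplanes of \<open>v\<^sub>1, \<dots>, v\<^sub>n\<close>, as its set of signed
  covectors; the signs are the real numbers \<open>-1, 0, 1\<close>.
\<close>

definition signed_covectors :: "'a::euclidean_space list \<Rightarrow> real list set" where
  "signed_covectors vs = {map (\<lambda>v. sgn (u \<bullet> v)) vs | u. True}"

text \<open>
  The order chosen on the vertices of \<open>P\<close> is carried over to those of \<open>Q\<close> by \<open>i\<close>;
  the condition does not depend on this choice.
\<close>

definition equiv_inducing_OM :: "'a::euclidean_space set \<Rightarrow> 'a set \<Rightarrow> bool" where
  "equiv_inducing_OM P Q \<longleftrightarrow>
     (\<exists>i. face_lattice_iso i P Q \<and>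
          (\<exists>vs. distinct vs \<and> set vs = vertices P \<and>
                signed_covectors vs = signed_covectors (map (vertex_map i) vs)))"

definition same_arrangement :: "'a::euclidean_space set \<Rightarrow> 'a set \<Rightarrow> bool" where
  "same_arrangement P Q \<longleftrightarrow> arrangement P = arrangement Q"

definition not_implies_3d ::
  "((real^3) set \<Rightarrow> (real^3) set \<Rightarrow> bool) \<Rightarrow> ((real^3) set \<Rightarrow> (real^3) set \<Rightarrow> bool) \<Rightarrow> bool" where
  "not_implies_3d X Y \<longleftrightarrow>
     (\<exists>P Q. origin_polytope P \<and> origin_polytope Q \<and> X P Q \<and> \<not> Y P Q)"

end

theory Submission imports Defs
begin

text \<open>
  A nonempty face of \<open>P \<inter> u\<^sup>\<perp>\<close> is cut out by the unique face of \<open>P\<close> whose relative interior it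
  meets, and whether the relative interior of \<open>F\<close> meets \<open>u\<^sup>\<perp>\<close> depends only on the signs of \<open>u\<close> on
  the vertices of \<open>F\<close>. So the face lattice of a slice can be read off the face lattice of \<open>P\<close> and
  one signed covector, which gives (A) \<open>\<Rightarrow>\<close> (C) and (B) \<open>\<Rightarrow>\<close> (E). For (C) \<open>\<Rightarrow>\<close> (F), if
  \<open>v\<^sup>\<perp>\<close> is not in the arrangement of \<open>Q\<close>, then a generic \<open>w \<in> v\<^sup>\<perp>\<close> is not orthogonal to any vertex of
  \<open>Q\<close>, so tilting \<open>w\<^sup>\<perp>\<close> slightly does not change the slice of \<open>Q\<close>; but \<open>w\<close> can be chosen such that
  one such tilt increases the number of faces of the slice of \<open>P\<close>.

  Four pairs refute all other implications. A tetrahedron and a stretched copy satisfy (B) but not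
  (F). The cubes \<open>[-1,1]\<^sup>3\<close> and \<open>[-1,2]\<^sup>3\<close> satisfy (D) but not (E), and a cube and an inscribed
  tetrahedron satisfy (F) but not (E): in both cases only one of them has a triangular central slice,
  since a centrally symmetric polygon is not a triangle. Finally, stack a pyramid on each of two
  facets of an octahedron and move one pyramid to the antipodal facet. Every central plane meets
  antipodal pyramids in the same way, so corresponding slices are polygons with equally many vertices,
  whence (C); but for suitable facets the combinatorial type changes, so that (D) fails.
\<close>

subsection \<open>Isomorphisms of face lattices\<close>

text \<open>Four pairs suffice because failures propagate: a pair with X but not Y also refutes X'
  ==> Y' whenever X implies X' and Y' implies Y. The obstacle in (C) ==> (F) is that tilting a plane
  off \<open>v\<close> also destroys faces of the slice: a second vertex may lie on the line of
  \<open>v\<close>, on the other side of the origin, so the gain must exceed the loss of two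
  vertices. A facet through \<open>v\<close> together with two of its own facets gives three new
  faces, and these exist because d \<ge> 3. The obstacle for the capped octahedra is that no
  isomorphism of the two face lattices is at hand, so slices cannot be compared face by face. They
  are compared as polygons, which requires a proof that the number of vertices determines the face
  lattice of a polygon. The caps are low enough to keep all edges of the octahedron and to create no
  edge between the two caps, so the edge graph is known exactly and tells the two polytopes
  apart.\<close>

lemma face_lattice_iso_inv:
  assumes "face_lattice_iso i P Q"
  shows "face_lattice_iso (inv_into (face_lattice P) i) Q P"
proof -
  let ?j = "inv_into (face_lattice P) i"
  have b: "bij_betw i (face_lattice P) (face_lattice Q)"
    and o: "\<And>F G. F \<in> face_lattice P \<Longrightarrow> G \<in> face_lattice P \<Longrightarrow> F \<subseteq> G \<longleftrightarrow> i F \<subseteq> i G"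
    using assms unfolding face_lattice_iso_def by auto
  have m: "?j F \<in> face_lattice P" "i (?j F) = F" if "F \<in> face_lattice Q" for F
    using b that by (auto simp: bij_betw_def inv_into_into f_inv_into_f)
  show ?thesis
    unfolding face_lattice_iso_def using bij_betw_inv_into[OF b] m o by simp
qed

lemma comb_equiv_refl: "P \<simeq> P"
  unfolding comb_equiv_def face_lattice_iso_def by (rule exI[of _ id]) simp

lemma comb_equiv_sym: "P \<simeq> Q \<Longrightarrow> Q \<simeq> P"
  unfolding comb_equiv_def using face_lattice_iso_inv by blast

lemma comb_equiv_trans:
  assumes "P \<simeq> Q" "Q \<simeq> R"
  shows "P \<simeq> R"
proof -
  obtain i j where ij: "face_lattice_iso i P Q" "face_lattice_iso j Q R"
    using assms unfolding comb_equiv_def by auto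
  then have "\<And>F. F \<in> face_lattice P \<Longrightarrow> i F \<in> face_lattice Q"
    unfolding face_lattice_iso_def bij_betw_def by auto
  with ij have "face_lattice_iso (j \<circ> i) P R"
    unfolding face_lattice_iso_def using bij_betw_trans by (auto simp: o_def)
  then show ?thesis unfolding comb_equiv_def by blast
qed

lemma comb_type_eqI: "P \<simeq> Q \<Longrightarrow> comb_type P = comb_type Q"
  unfolding comb_type_def using comb_equiv_sym comb_equiv_trans by blast

text \<open>A type has only polytopes as members, so being a polytope is what puts \<open>Q\<close>
  into its own type and hence into that of \<open>P\<close>.\<close>

lemma comb_type_eqD: "comb_type P = comb_type Q \<Longrightarrow> polytope Q \<Longrightarrow> P \<simeq> Q"
  unfolding comb_type_def using comb_equiv_refl by blast

lemma card_face_lattice_cong: "P \<simeq> Q \<Longrightarrow> card (face_lattice P) = card (face_lattice Q)"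
  unfolding comb_equiv_def face_lattice_iso_def using bij_betw_same_card by blast

lemma finite_face_lattice: "polytope P \<Longrightarrow> finite (face_lattice P)"
  unfolding face_lattice_def by (rule finite_polytope_faces)

section \<open>Vertices as one-point faces\<close>

lemma vertex_face: "v \<in> vertices P \<longleftrightarrow> {v} face_of P"
  by (simp add: vertices_def face_of_singleton)

lemma finite_vertices:
  assumes "polytope P"
  shows "finite (vertices P)"
proof -
  have "(\<lambda>v. {v}) ` vertices P \<subseteq> face_lattice P"
    by (auto simp: vertex_face face_lattice_def)
  then show ?thesis
    using finite_face_lattice[OF assms] finite_subset finite_imageD[of "\<lambda>v. {v}"] by (metis inj_singleton)
qed

lemma vertices_in: "v \<in> vertices P \<Longrightarrow> v \<in> P"
  by (simp add: vertices_def extreme_point_of_def)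

lemma polytope_hull_vertices: "polytope P \<Longrightarrow> P = convex hull (vertices P)"
  unfolding vertices_def using Krein_Milman_Minkowski polytope_imp_compact polytope_imp_convex by blast

lemma vertices_of_face: "F face_of P \<Longrightarrow> vertices F = F \<inter> vertices P"
  by (auto simp: vertices_def extreme_point_of_face)

lemma face_hull_vertices:
  assumes "polytope P" "F face_of P"
  shows "F = convex hull (F \<inter> vertices P)"
  using polytope_hull_vertices[OF face_of_polytope_polytope[OF assms]] vertices_of_face[OF assms(2)] by simp

lemma vertices_convex_hull_subset: "vertices (convex hull S) \<subseteq> S"
  using extreme_point_of_convex_hull by (auto simp: vertices_def)

section \<open>Action of a lattice isomorphism on faces and vertices\<close>

lemma iso_face:
  "face_lattice_iso i P Q \<Longrightarrow> F face_of P \<Longrightarrow> i F face_of Q"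
  unfolding face_lattice_iso_def face_lattice_def bij_betw_def by blast

lemma iso_mono:
  "face_lattice_iso i P Q \<Longrightarrow> F face_of P \<Longrightarrow> G face_of P \<Longrightarrow> F \<subseteq> G \<longleftrightarrow> i F \<subseteq> i G"
  unfolding face_lattice_iso_def face_lattice_def by blast

lemma iso_surj:
  assumes "face_lattice_iso i P Q" "G face_of Q"
  obtains F where "F face_of P" "i F = G"
proof -
  have "G \<in> i ` face_lattice P"
    using assms by (simp add: face_lattice_iso_def bij_betw_def face_lattice_def)
  then show ?thesis using that by (auto simp: face_lattice_def)
qed

lemma iso_empty:
  assumes "face_lattice_iso i P Q"
  shows "i {} = {}"
proof -
  obtain F where "F face_of P" "i F = {}"
    using iso_surj[OF assms empty_face_of] by blast
  then show ?thesis using iso_mono[OF assms empty_face_of, of F] by auto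
qed

lemma iso_empty_iff:
  assumes "face_lattice_iso i P Q" "F face_of P"
  shows "i F = {} \<longleftrightarrow> F = {}"
  using iso_empty[OF assms(1)] iso_mono[OF assms(1,2) empty_face_of] by auto

text \<open>Vertex faces are the atoms of the lattice: a vertex \<open>w\<close> of the nonempty
  face \<open>i {v}\<close> has a nonempty preimage face inside \<open>{v}\<close>, which is
  \<open>{v}\<close> itself. So on vertices of \<open>P\<close> the \<open>the_elem\<close> in
  \<open>vertex_map\<close> meets a genuine singleton.\<close>

lemma vertex_map:
  assumes i: "face_lattice_iso i P Q" and Q: "polytope Q" and v: "v \<in> vertices P"
  shows "i {v} = {vertex_map i v}" "vertex_map i v \<in> vertices Q"
proof -
  have fv: "{v} face_of P" using v by (simp add: vertex_face)
  have iv: "i {v} face_of Q" by (rule iso_face[OF i fv])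
  have "i {v} \<noteq> {}" using iso_empty_iff[OF i fv] by simp
  then have "i {v} \<inter> vertices Q \<noteq> {}"
    using face_hull_vertices[OF Q iv] by (metis convex_hull_empty)
  then obtain w where w: "w \<in> i {v}" "w \<in> vertices Q" by blast
  then obtain F where F: "F face_of P" "i F = {w}"
    using iso_surj[OF i] vertex_face by metis
  then have "F \<subseteq> {v}" using iso_mono[OF i F(1) fv] w by simp
  moreover have "F \<noteq> {}" using iso_empty_iff[OF i F(1)] F(2) by simp
  ultimately have "i {v} = {w}" using F by (metis subset_singletonD)
  then show "i {v} = {vertex_map i v}" "vertex_map i v \<in> vertices Q"
    using w by (simp_all add: vertex_map_def)
qed

lemma vertex_map_mem:
  assumes "face_lattice_iso i P Q" "polytope Q" "v \<in> vertices P" "F face_of P"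
  shows "vertex_map i v \<in> i F \<longleftrightarrow> v \<in> F"
  using iso_mono[OF assms(1) _ assms(4), of "{v}"] vertex_map[OF assms(1-3)] assms(3) by (simp add: vertex_face)

lemma bij_vertex_map:
  assumes i: "face_lattice_iso i P Q" and P: "polytope P" and Q: "polytope Q"
  shows "bij_betw (vertex_map i) (vertices P) (vertices Q)"
  unfolding bij_betw_def
proof
  show "inj_on (vertex_map i) (vertices P)"
  proof (rule inj_onI)
    fix x y assume xy: "x \<in> vertices P" "y \<in> vertices P" "vertex_map i x = vertex_map i y"
    then have "i {x} = i {y}" using vertex_map(1)[OF i Q] by simp
    then show "x = y" using iso_mono[OF i, of "{x}" "{y}"] xy by (simp add: vertex_face)
  qed
  show "vertex_map i ` vertices P = vertices Q"
  proof
    show "vertex_map i ` vertices P \<subseteq> vertices Q" using vertex_map(2)[OF i Q] by blast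
    show "vertices Q \<subseteq> vertex_map i ` vertices P"
    proof
      fix w assume w: "w \<in> vertices Q"
      then obtain F where F: "F face_of P" "i F = {w}" using iso_surj[OF i] vertex_face by metis
      have "F \<noteq> {}" using iso_empty_iff[OF i F(1)] F(2) by simp
      then have "F \<inter> vertices P \<noteq> {}" using face_hull_vertices[OF P F(1)] by (metis convex_hull_empty)
      then obtain v where "v \<in> F" "v \<in> vertices P" by blast
      then show "w \<in> vertex_map i ` vertices P"
        using vertex_map_mem[OF i Q _ F(1)] F(2) by (metis image_eqI singletonD)
    qed
  qed
qed

text \<open>This carries sign conditions on the vertices of a face over from \<open>P\<close> to
  \<open>Q\<close>.\<close>

lemma vertices_iso_face:
  assumes i: "face_lattice_iso i P Q" and P: "polytope P" and Q: "polytope Q" and F: "F face_of P"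
  shows "i F \<inter> vertices Q = vertex_map i ` (F \<inter> vertices P)"
proof -
  have "vertices Q = vertex_map i ` vertices P" using bij_vertex_map[OF i P Q] by (simp add: bij_betw_def)
  then show ?thesis using vertex_map_mem[OF i Q _ F] by auto
qed

subsection \<open>Faces of central slices\<close>

lemma affine_perp: "affine (perp u)"
  unfolding perp_def by (rule affine_hyperplane)

lemma polytope_slice: "polytope P \<Longrightarrow> polytope (P \<inter> perp u)"
  unfolding perp_def by (simp add: polytope_Int_polyhedron polyhedron_hyperplane)

text \<open>Index set for the faces of a slice. The empty face has no relative interior point and is
  added by hand, as the partner of the empty face of the slice.\<close>

definition sliced_faces :: "'a::euclidean_space \<Rightarrow> 'a set \<Rightarrow> 'a set set" where
  "sliced_faces u P = {F. F face_of P \<and> (F = {} \<or> rel_interior F \<inter> perp u \<noteq> {})}"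

lemma rel_interior_slice:
  assumes "convex F" "rel_interior F \<inter> perp u \<noteq> {}"
  shows "rel_interior (F \<inter> perp u) = rel_interior F \<inter> perp u"
  using rel_interior_convex_Int_affine[OF assms(1) affine_perp] convex_affine_rel_interior_Int assms affine_perp by blast

text \<open>Take a minimal face containing \<open>x\<close>: if \<open>x\<close> were on its
  relative frontier, a facet of it through \<open>x\<close> would be a smaller choice.\<close>

lemma face_with_rel_interior_point:
  fixes P :: "'a::euclidean_space set"
  assumes P: "polytope P" and x: "x \<in> P"
  obtains F where "F face_of P" "x \<in> rel_interior F"
proof -
  let ?S = "{F. F face_of P \<and> x \<in> F}"
  have "finite ?S" using finite_polytope_faces[OF P] by simp
  moreover have "P \<in> ?S" using x P by (simp add: face_of_refl polytope_imp_convex)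
  ultimately obtain F where F: "F \<in> ?S" "\<forall>G\<in>?S. \<not> G \<subset> F"
    using finite_has_minimal[of ?S] by (metis empty_iff psubset_eq)
  have pF: "polyhedron F" using face_of_polytope_polytope[OF P] F polytope_imp_polyhedron by blast
  have "x \<in> rel_interior F"
  proof (rule ccontr)
    assume "x \<notin> rel_interior F"
    then have "x \<in> rel_frontier F"
      using F(1) closure_subset[of F] by (auto simp: rel_frontier_def)
    then obtain G where "G facet_of F" "x \<in> G"
      unfolding rel_frontier_of_polyhedron[OF pF] by blast
    then have "G face_of P" "G \<subset> F" "x \<in> G"
      using F(1) face_of_trans by (auto simp: facet_of_def facet_of_irrefl dest: face_of_imp_subset)
    then show False using F(2) by blast
  qed
  then show ?thesis using F that by blast
qed

text \<open>If the trace of \<open>F\<close> lies in \<open>G\<close>, then \<open>G\<close>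
  contains a relative interior point of \<open>F\<close>, and a face with such a point contains all
  of \<open>F\<close>.\<close>

lemma sliced_faces_subset_iff:
  assumes "F \<in> sliced_faces u P" "G face_of P"
  shows "F \<inter> perp u \<subseteq> G \<inter> perp u \<longleftrightarrow> F \<subseteq> G"
proof
  assume l: "F \<inter> perp u \<subseteq> G \<inter> perp u"
  show "F \<subseteq> G"
  proof (cases "F = {}")
    case False
    then have "G \<inter> rel_interior F \<noteq> {}"
      using assms l rel_interior_subset[of F] unfolding sliced_faces_def by blast
    then show ?thesis
      using subset_of_face_of[OF assms(2)] assms(1) unfolding sliced_faces_def by (blast dest: face_of_imp_subset)
  qed simp
qed blast

lemma bij_sliced_faces:
  assumes P: "polytope P"
  shows "bij_betw (\<lambda>F. F \<inter> perp u) (sliced_faces u P) (face_lattice (P \<inter> perp u))"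
  unfolding bij_betw_def
proof
  show "inj_on (\<lambda>F. F \<inter> perp u) (sliced_faces u P)"
    by (rule inj_onI) (use sliced_faces_subset_iff in \<open>unfold sliced_faces_def, blast\<close>)
  show "(\<lambda>F. F \<inter> perp u) ` sliced_faces u P = face_lattice (P \<inter> perp u)"
  proof
    show "(\<lambda>F. F \<inter> perp u) ` sliced_faces u P \<subseteq> face_lattice (P \<inter> perp u)"
      unfolding sliced_faces_def face_lattice_def
      using face_of_slice affine_imp_convex[OF affine_perp] by blast
    show "face_lattice (P \<inter> perp u) \<subseteq> (\<lambda>F. F \<inter> perp u) ` sliced_faces u P"
    proof
      fix G assume "G \<in> face_lattice (P \<inter> perp u)"
      then have G: "G face_of P \<inter> perp u" by (simp add: face_lattice_def)
      show "G \<in> (\<lambda>F. F \<inter> perp u) ` sliced_faces u P"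
      proof (cases "G = {}")
        case True then show ?thesis by (auto simp: sliced_faces_def intro: image_eqI[of _ _ "{}"])
      next
        case False
        then obtain x where x: "x \<in> rel_interior G"
          using G face_of_imp_convex rel_interior_eq_empty by blast
        then have xP: "x \<in> P" "x \<in> perp u"
          using G face_of_imp_subset rel_interior_subset by blast+
        \<comment> \<open>The trace of this \<open>F\<close> and \<open>G\<close> are faces of the
          slice whose relative interiors share \<open>x\<close>, hence they are equal.\<close>
        obtain F where F: "F face_of P" "x \<in> rel_interior F"
          using face_with_rel_interior_point[OF P xP(1)] .
        have "x \<in> rel_interior (F \<inter> perp u)"
          using rel_interior_slice[OF face_of_imp_convex[OF F(1)]] F xP by blast
        moreover have "F \<inter> perp u face_of P \<inter> perp u"
          using face_of_slice F(1) affine_imp_convex[OF affine_perp] by blast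
        ultimately have "G = F \<inter> perp u" using face_of_eq[OF G] x by blast
        then show ?thesis using F xP by (auto simp: sliced_faces_def)
      qed
    qed
  qed
qed

text \<open>A linear functional that is nonnegative on \<open>F\<close> and zero at a relative
  interior point vanishes on \<open>F\<close>. Conversely, if both signs occur, a relative interior
  point can be moved towards a vertex of the opposite sign until it reaches the plane.\<close>

lemma rel_interior_meets_perp_iff:
  assumes P: "polytope P" and F: "F face_of P" "F \<noteq> {}"
  shows "rel_interior F \<inter> perp u \<noteq> {} \<longleftrightarrow>
    (\<forall>v\<in>F \<inter> vertices P. u \<bullet> v = 0) \<or>
    (\<exists>v\<in>F \<inter> vertices P. u \<bullet> v < 0) \<and> (\<exists>v\<in>F \<inter> vertices P. 0 < u \<bullet> v)" (is "?L \<longleftrightarrow> ?R")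
proof -
  have cF: "convex F" by (rule face_of_imp_convex[OF F(1)])
  have hF: "F = convex hull (F \<inter> vertices P)" by (rule face_hull_vertices[OF P F(1)])
  have zero: "F \<subseteq> perp u" if "\<forall>v\<in>F \<inter> vertices P. u \<bullet> v = 0"
    by (subst hF, rule hull_minimal) (use that affine_imp_convex[OF affine_perp] in \<open>auto simp: perp_def\<close>)
  have ri: "rel_interior F \<noteq> {}" using F(2) cF rel_interior_eq_empty by blast
  \<comment> \<open>Stated for arbitrary \<open>u'\<close> since it is applied to both
    \<open>u\<close> and \<open>- u\<close>.\<close>
  have *: "\<forall>v\<in>F \<inter> vertices P. u' \<bullet> v = 0"
    if m: "rel_interior F \<inter> perp u' \<noteq> {}" and p: "\<forall>v\<in>F \<inter> vertices P. u' \<bullet> v \<ge> 0" for u'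
  proof -
    have ge: "F \<subseteq> {x. u' \<bullet> x \<ge> 0}"
      by (subst hF, rule hull_minimal) (use p in \<open>auto simp: convex_halfspace_ge\<close>)
    then have "F \<inter> {x. u' \<bullet> x = 0} face_of F"
      by (intro face_of_Int_supporting_hyperplane_ge cF) auto
    then have "F \<subseteq> F \<inter> {x. u' \<bullet> x = 0}"
      using subset_of_face_of[of "F \<inter> {x. u' \<bullet> x = 0}" F F] m rel_interior_subset[of F] by (auto simp: perp_def)
    then show ?thesis by blast
  qed
  show ?thesis
  proof
    assume L: ?L
    have L': "rel_interior F \<inter> perp (-u) \<noteq> {}" using L by (simp add: perp_def)
    have p: "\<forall>v\<in>F \<inter> vertices P. u \<bullet> v = 0" if "\<forall>v\<in>F \<inter> vertices P. 0 \<le> u \<bullet> v"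
      by (rule *[OF L that])
    have n: "\<forall>v\<in>F \<inter> vertices P. u \<bullet> v = 0" if a: "\<forall>v\<in>F \<inter> vertices P. u \<bullet> v \<le> 0"
    proof -
      have "\<forall>v\<in>F \<inter> vertices P. - u \<bullet> v \<ge> 0" using a by (metis inner_minus_left neg_0_le_iff_le)
      from *[OF L' this] show ?thesis by (metis inner_minus_left neg_equal_0_iff_equal)
    qed
    show ?R
    proof (rule disjCI)
      assume "\<not> ((\<exists>v\<in>F \<inter> vertices P. u \<bullet> v < 0) \<and> (\<exists>v\<in>F \<inter> vertices P. 0 < u \<bullet> v))"
      then consider "\<forall>v\<in>F \<inter> vertices P. 0 \<le> u \<bullet> v" | "\<forall>v\<in>F \<inter> vertices P. u \<bullet> v \<le> 0"
        by (meson not_le)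
      then show "\<forall>v\<in>F \<inter> vertices P. u \<bullet> v = 0" using p n by cases
    qed
  next
    assume ?R
    then show ?L
    proof
      assume "\<forall>v\<in>F \<inter> vertices P. u \<bullet> v = 0"
      then show ?L using zero ri rel_interior_subset[of F] by blast
    next
      assume "(\<exists>v\<in>F \<inter> vertices P. u \<bullet> v < 0) \<and> (\<exists>v\<in>F \<inter> vertices P. 0 < u \<bullet> v)"
      then obtain v w where vw: "v \<in> F" "u \<bullet> v < 0" "w \<in> F" "0 < u \<bullet> w" by blast
      obtain x where x: "x \<in> rel_interior F" using ri by blast
      have key: "rel_interior F \<inter> perp u \<noteq> {}" if y: "y \<in> F" "(u \<bullet> y) * (u \<bullet> x) < 0" for y
      proof -
        \<comment> \<open>The parameter at which the segment from \<open>x\<close> to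
          \<open>y\<close> hits the plane; \<open>t < 1\<close> keeps the point in the relative
          interior.\<close>
        define t where "t = (u \<bullet> x) / (u \<bullet> x - u \<bullet> y)"
        have t: "0 \<le> t" "t < 1" "(1 - t) * (u \<bullet> x) + t * (u \<bullet> y) = 0"
          using y(2) by (auto simp: t_def field_simps mult_less_0_iff)
        have "x - t *\<^sub>R (x - y) \<in> rel_interior F"
        proof -
          have "y \<in> F" using y(1) .
          then have "y - (1 - t) *\<^sub>R (y - x) \<in> rel_interior F"
            using rel_interior_convex_shrink[OF cF x, of y "1 - t"] t by simp
          then show ?thesis by (simp add: algebra_simps)
        qed
        moreover have "u \<bullet> (x - t *\<^sub>R (x - y)) = 0" using t(3) by (simp add: inner_diff_right algebra_simps)
        ultimately show ?thesis by (auto simp: perp_def)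
      qed
      consider "u \<bullet> x = 0" | "u \<bullet> x > 0" | "u \<bullet> x < 0" by linarith
      then show ?L
        using key[of v] key[of w] vw x by cases (auto simp: perp_def mult_neg_pos mult_pos_neg)
    qed
  qed
qed

lemma sliced_faces_image:
  assumes i: "face_lattice_iso i P Q" and P: "polytope P" and Q: "polytope Q"
    and s: "\<And>v. v \<in> vertices P \<Longrightarrow> sgn (u \<bullet> v) = sgn (w \<bullet> vertex_map i v)"
    and F: "F face_of P"
  shows "i F \<in> sliced_faces w Q \<longleftrightarrow> F \<in> sliced_faces u P"
proof -
  have sg: "u \<bullet> v = 0 \<longleftrightarrow> w \<bullet> vertex_map i v = 0" "u \<bullet> v < 0 \<longleftrightarrow> w \<bullet> vertex_map i v < 0"
    "0 < u \<bullet> v \<longleftrightarrow> 0 < w \<bullet> vertex_map i v" if "v \<in> vertices P" for v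
    using s[OF that] by (metis sgn_0_0 sgn_less sgn_greater)+
  show ?thesis
  proof (cases "F = {}")
    case True then show ?thesis using iso_empty[OF i] by (simp add: sliced_faces_def)
  next
    case False
    then have "i F \<noteq> {}" using iso_empty_iff[OF i F] by simp
    then show ?thesis
      unfolding sliced_faces_def mem_Collect_eq
      using rel_interior_meets_perp_iff[OF P F False, of u] rel_interior_meets_perp_iff[OF Q iso_face[OF i F], of w]
        vertices_iso_face[OF i P Q F] sg F iso_face[OF i F] False by simp
  qed
qed

text \<open>The normals \<open>u\<close> and \<open>w\<close> may differ because in (B) the covector
  of \<open>u\<close> on \<open>P\<close> is realized on \<open>Q\<close> by some other vector. The
  isomorphism goes from a face of the slice to the face of \<open>P\<close> that cuts it out,
  through \<open>i\<close>, and back to a trace.\<close>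

lemma slice_equiv:
  assumes i: "face_lattice_iso i P Q" and P: "polytope P" and Q: "polytope Q"
    and s: "\<And>v. v \<in> vertices P \<Longrightarrow> sgn (u \<bullet> v) = sgn (w \<bullet> vertex_map i v)"
  shows "P \<inter> perp u \<simeq> Q \<inter> perp w"
proof -
  let ?f = "\<lambda>F. F \<inter> perp u" and ?g = "\<lambda>F. F \<inter> perp w"
  let ?A = "sliced_faces u P" and ?B = "sliced_faces w Q"
  let ?fi = "inv_into ?A ?f"
  have f: "bij_betw ?f ?A (face_lattice (P \<inter> perp u))" and g: "bij_betw ?g ?B (face_lattice (Q \<inter> perp w))"
    using bij_sliced_faces P Q by auto
  have fi: "bij_betw ?fi (face_lattice (P \<inter> perp u)) ?A" by (rule bij_betw_inv_into[OF f])
  have im: "bij_betw i ?A ?B"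
    unfolding bij_betw_def
  proof
    have "?A \<subseteq> face_lattice P" by (auto simp: sliced_faces_def face_lattice_def)
    moreover have "inj_on i (face_lattice P)" using i by (simp add: face_lattice_iso_def bij_betw_def)
    ultimately show "inj_on i ?A" using inj_on_subset by blast
    show "i ` ?A = ?B"
    proof
      show "i ` ?A \<subseteq> ?B" using sliced_faces_image[OF i P Q s] by (auto simp: sliced_faces_def)
      show "?B \<subseteq> i ` ?A"
      proof
        fix G assume G: "G \<in> ?B"
        then obtain F where "F face_of P" "i F = G" using iso_surj[OF i, of G] by (auto simp: sliced_faces_def)
        then show "G \<in> i ` ?A" using sliced_faces_image[OF i P Q s, of F] G by blast
      qed
    qed
  qed
  have "face_lattice_iso (?g \<circ> (i \<circ> ?fi)) (P \<inter> perp u) (Q \<inter> perp w)"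
    unfolding face_lattice_iso_def
  proof (intro conjI ballI)
    show "bij_betw (?g \<circ> (i \<circ> ?fi)) (face_lattice (P \<inter> perp u)) (face_lattice (Q \<inter> perp w))"
      by (intro bij_betw_trans[OF bij_betw_trans[OF fi im] g])
  next
    fix F G assume FG: "F \<in> face_lattice (P \<inter> perp u)" "G \<in> face_lattice (P \<inter> perp u)"
    let ?F = "?fi F" and ?G = "?fi G"
    have m: "?F \<in> ?A" "?G \<in> ?A" using fi FG by (auto simp: bij_betw_def)
    have e: "?F \<inter> perp u = F" "?G \<inter> perp u = G"
      using FG f by (auto simp: bij_betw_def f_inv_into_f[of _ ?f])
    have m': "?F face_of P" "?G face_of P" using m by (auto simp: sliced_faces_def)
    have iB: "i ?F \<in> ?B" "i ?G \<in> ?B" using im m by (auto simp: bij_betw_def)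
    have iq: "i ?G face_of Q" using iB by (simp add: sliced_faces_def)
    show "F \<subseteq> G \<longleftrightarrow> (?g \<circ> (i \<circ> ?fi)) F \<subseteq> (?g \<circ> (i \<circ> ?fi)) G"
      using sliced_faces_subset_iff[OF m(1) m'(2)] sliced_faces_subset_iff[OF iB(1) iq] iso_mono[OF i m'] e
      by simp
  qed
  then show ?thesis unfolding comb_equiv_def by blast
qed

lemma card_slice_faces: "polytope P \<Longrightarrow> card (face_lattice (P \<inter> perp u)) = card (sliced_faces u P)"
  using bij_betw_same_card[OF bij_sliced_faces] by metis

subsection \<open>The implications from (A) and (B)\<close>

lemma origin_polytopeD:
  assumes "origin_polytope P"
  shows "polytope P" "0 \<in> interior P" "convex P" "finite (vertices P)"
  using assms finite_vertices polytope_imp_convex unfolding origin_polytope_def by blast+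

lemma exists_vertex_inner_neg:
  assumes P: "origin_polytope P" and u: "u \<noteq> 0"
  shows "\<exists>v\<in>vertices P. u \<bullet> v < 0"
proof (rule ccontr)
  assume "\<not> ?thesis"
  then have "vertices P \<subseteq> {x. 0 \<le> u \<bullet> x}" by (auto simp: not_less)
  then have "convex hull (vertices P) \<subseteq> {x. 0 \<le> u \<bullet> x}"
    by (rule hull_minimal) (rule convex_halfspace_ge)
  then have le: "P \<subseteq> {x. 0 \<le> u \<bullet> x}"
    using polytope_hull_vertices[OF origin_polytopeD(1)[OF P]] by simp
  obtain e where e: "e > 0" "ball 0 e \<subseteq> P"
    using origin_polytopeD(2)[OF P] mem_interior by blast
  define x where "x = (- (e / 2) / norm u) *\<^sub>R u"
  have "norm x < e" using e u by (simp add: x_def)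
  then have "0 \<le> u \<bullet> x" using e le by (auto simp: dist_norm)
  moreover have "u \<bullet> x < 0" using e u by (simp add: x_def divide_neg_pos mult_neg_pos)
  ultimately show False by simp
qed

lemma sgn_real_eqI: "(x = 0 \<longleftrightarrow> y = 0) \<Longrightarrow> (0 < x \<longleftrightarrow> 0 < y) \<Longrightarrow> sgn x = sgn (y::real)"
  by (auto simp: sgn_if)

lemma signed_hyperplane_sgn:
  assumes "signed_hyperplane v = signed_hyperplane w"
  shows "sgn (u \<bullet> v) = sgn (u \<bullet> w)"
proof (rule sgn_real_eqI)
  have "u \<in> perp v \<longleftrightarrow> u \<in> perp w" "u \<in> {x. v \<bullet> x > 0} \<longleftrightarrow> u \<in> {x. w \<bullet> x > 0}"
    using assms unfolding signed_hyperplane_def by blast+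
  then show "u \<bullet> v = 0 \<longleftrightarrow> u \<bullet> w = 0" "0 < u \<bullet> v \<longleftrightarrow> 0 < u \<bullet> w"
    by (simp_all add: perp_def inner_commute)
qed

lemma signed_arrangement_imp_OM:
  assumes P: "polytope P" and A: "equiv_inducing_signed_arrangement P Q"
  shows "equiv_inducing_OM P Q"
proof -
  obtain i where i: "face_lattice_iso i P Q"
    and s: "\<And>v. v \<in> vertices P \<Longrightarrow> signed_hyperplane v = signed_hyperplane (vertex_map i v)"
    using A unfolding equiv_inducing_signed_arrangement_def by blast
  obtain vs where vs: "set vs = vertices P" "distinct vs"
    using finite_distinct_list[OF finite_vertices[OF P]] by blast
  have "map (\<lambda>v. sgn (u \<bullet> v)) vs = map (\<lambda>v. sgn (u \<bullet> v)) (map (vertex_map i) vs)" for u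
    using signed_hyperplane_sgn[OF s] vs by simp
  then have "signed_covectors vs = signed_covectors (map (vertex_map i) vs)"
    unfolding signed_covectors_def by presburger
  with i vs show ?thesis unfolding equiv_inducing_OM_def by blast
qed

lemma signed_arrangement_imp_pointwise:
  assumes PQ: "polytope P" "polytope Q" and A: "equiv_inducing_signed_arrangement P Q"
  shows "pointwise_slice_equiv P Q"
proof -
  obtain i where i: "face_lattice_iso i P Q"
    and s: "\<And>v. v \<in> vertices P \<Longrightarrow> signed_hyperplane v = signed_hyperplane (vertex_map i v)"
    using A unfolding equiv_inducing_signed_arrangement_def by blast
  show ?thesis
    unfolding pointwise_slice_equiv_def
    using slice_equiv[OF i PQ signed_hyperplane_sgn[OF s]] by blast
qed

lemma OM_imp_comb_equiv: "equiv_inducing_OM P Q \<Longrightarrow> P \<simeq> Q"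
  unfolding equiv_inducing_OM_def comb_equiv_def by blast

lemma slice_type_in_slice_types:
  assumes "w \<noteq> 0"
  shows "comb_type (Q \<inter> perp w) \<in> slice_types Q"
proof -
  have "perp w = perp (w /\<^sub>R norm w)" "w /\<^sub>R norm w \<in> sphere 0 1"
    using assms by (auto simp: perp_def)
  then show ?thesis unfolding slice_types_def mem_Collect_eq by metis
qed

lemma slice_typesE:
  assumes "T \<in> slice_types P"
  obtains u where "u \<noteq> 0" "T = comb_type (P \<inter> perp u)"
proof -
  obtain u where "u \<in> sphere 0 1" "T = comb_type (P \<inter> perp u)"
    using assms unfolding slice_types_def mem_Collect_eq by metis
  moreover from this have "u \<noteq> 0" by auto
  ultimately show ?thesis using that[of u] by simp
qed

lemma OM_imp_setwise:
  assumes P: "origin_polytope P" and Q: "origin_polytope Q" and B: "equiv_inducing_OM P Q"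
  shows "setwise_slice_equiv P Q"
proof -
  obtain i vs where i: "face_lattice_iso i P Q" and vs: "set vs = vertices P"
    and sc: "signed_covectors vs = signed_covectors (map (vertex_map i) vs)"
    using B unfolding equiv_inducing_OM_def by blast
  note pP = origin_polytopeD(1)[OF P] and pQ = origin_polytopeD(1)[OF Q]
  have bij: "vertices Q = vertex_map i ` vertices P"
    using bij_vertex_map[OF i pP pQ] by (simp add: bij_betw_def)
  have eq: "comb_type (P \<inter> perp u) = comb_type (Q \<inter> perp w)"
    if "map (\<lambda>v. sgn (u \<bullet> v)) vs = map (\<lambda>v. sgn (w \<bullet> v)) (map (vertex_map i) vs)" for u w
    by (rule comb_type_eqI, rule slice_equiv[OF i pP pQ]) (use that vs in auto)
  \<comment> \<open>Covectors are also taken at the zero vector, which is not the normal of any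
    slice. Zero vectors are recognized by their covector, as every nonzero vector is negative on
    some vertex.\<close>
  have nz: "u \<noteq> 0 \<longleftrightarrow> w \<noteq> 0"
    if e: "map (\<lambda>v. sgn (u \<bullet> v)) vs = map (\<lambda>v. sgn (w \<bullet> v)) (map (vertex_map i) vs)" for u w
  proof -
    have e': "sgn (u \<bullet> v) = sgn (w \<bullet> vertex_map i v)" if "v \<in> vertices P" for v
      using e vs that by auto
    have "u \<noteq> 0 \<longleftrightarrow> (\<exists>v\<in>vertices P. u \<bullet> v \<noteq> 0)"
      using exists_vertex_inner_neg[OF P, of u] by (metis inner_zero_left less_irrefl)
    also have "\<dots> \<longleftrightarrow> (\<exists>v\<in>vertices P. w \<bullet> vertex_map i v \<noteq> 0)"
      using e' by (metis sgn_0_0)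
    also have "\<dots> \<longleftrightarrow> w \<noteq> 0"
      using exists_vertex_inner_neg[OF Q, of w] unfolding bij by (metis image_iff inner_zero_left less_irrefl)
    finally show ?thesis .
  qed
  have "slice_types P \<subseteq> slice_types Q"
  proof
    fix T assume "T \<in> slice_types P"
    then obtain u where u: "u \<noteq> 0" "T = comb_type (P \<inter> perp u)" by (rule slice_typesE)
    have "map (\<lambda>v. sgn (u \<bullet> v)) vs \<in> signed_covectors vs" unfolding signed_covectors_def by blast
    then have "map (\<lambda>v. sgn (u \<bullet> v)) vs \<in> signed_covectors (map (vertex_map i) vs)" by (simp only: sc)
    then obtain w where w: "map (\<lambda>v. sgn (u \<bullet> v)) vs = map (\<lambda>v. sgn (w \<bullet> v)) (map (vertex_map i) vs)"
      unfolding signed_covectors_def mem_Collect_eq by metis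
    then show "T \<in> slice_types Q" using eq[OF w] nz[OF w] u slice_type_in_slice_types by simp
  qed
  moreover have "slice_types Q \<subseteq> slice_types P"
  proof
    fix T assume "T \<in> slice_types Q"
    then obtain w where w: "w \<noteq> 0" "T = comb_type (Q \<inter> perp w)" by (rule slice_typesE)
    have "map (\<lambda>v. sgn (w \<bullet> v)) (map (vertex_map i) vs) \<in> signed_covectors (map (vertex_map i) vs)"
      unfolding signed_covectors_def by blast
    then have "map (\<lambda>v. sgn (w \<bullet> v)) (map (vertex_map i) vs) \<in> signed_covectors vs" by (simp only: sc)
    then obtain u where u: "map (\<lambda>v. sgn (u \<bullet> v)) vs = map (\<lambda>v. sgn (w \<bullet> v)) (map (vertex_map i) vs)"
      unfolding signed_covectors_def mem_Collect_eq by metis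
    then show "T \<in> slice_types P" using eq[OF u] nz[OF u] w slice_type_in_slice_types by metis
  qed
  ultimately show ?thesis unfolding setwise_slice_equiv_def by blast
qed

lemma pointwise_imp_setwise:
  "pointwise_slice_equiv P Q \<Longrightarrow> setwise_slice_equiv P Q"
  unfolding pointwise_slice_equiv_def setwise_slice_equiv_def slice_types_def
  using comb_type_eqI by (metis (lifting))

subsection \<open>Pointwise slice equivalence determines the arrangement\<close>

lemma pointwise_slice_equiv_nonzero:
  assumes "pointwise_slice_equiv P Q" "u \<noteq> 0"
  shows "P \<inter> perp u \<simeq> Q \<inter> perp u"
proof -
  have "perp u = perp (u /\<^sub>R norm u)" "u /\<^sub>R norm u \<in> sphere 0 1"
    using assms(2) by (auto simp: perp_def)
  then show ?thesis using assms(1) unfolding pointwise_slice_equiv_def by metis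
qed

text \<open>A vector \<open>s\<close> off the line of \<open>v\<close> has a nonzero projection
  \<open>z\<close> to the hyperplane orthogonal to \<open>v\<close>. A small step along
  \<open>z\<close> makes the product with \<open>s\<close> nonzero, while the finitely many earlier
  conditions are open and survive.\<close>

lemma perturb_in_perp:
  fixes v u :: "'a::euclidean_space"
  assumes "finite S" "v \<noteq> 0" "\<And>s. s \<in> S \<Longrightarrow> s \<notin> range (\<lambda>c. c *\<^sub>R v)" "v \<bullet> u = 0" "e > 0"
  shows "\<exists>w. dist w u < e \<and> v \<bullet> w = 0 \<and> (\<forall>s\<in>S. w \<bullet> s \<noteq> 0)"
  using assms
proof (induction S arbitrary: e rule: finite_induct)
  case empty
  then show ?case by (intro exI[of _ u]) simp
next
  case (insert s S)
  obtain w where w: "dist w u < e / 2" "v \<bullet> w = 0" "\<forall>s\<in>S. w \<bullet> s \<noteq> 0"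
    using insert.IH[of "e/2"] insert.prems by auto
  define z where "z = s - ((s \<bullet> v) / (v \<bullet> v)) *\<^sub>R v"
  have "z \<noteq> 0" using insert.prems(2)[of s] by (auto simp: z_def)
  have zv: "v \<bullet> z = 0" using insert.prems(1) by (simp add: z_def inner_diff_right inner_commute)
  have zs: "z \<bullet> s > 0"
  proof -
    have "z \<bullet> s = z \<bullet> z" using zv by (simp add: z_def inner_diff_right inner_commute)
    then show ?thesis using \<open>z \<noteq> 0\<close> by simp
  qed
  have "open (\<Inter>s\<in>S. {t. (w + t *\<^sub>R z) \<bullet> s \<noteq> 0})"
    using insert.hyps(1) by (intro open_INT ballI open_Collect_neq continuous_intros)
  moreover have "0 \<in> (\<Inter>s\<in>S. {t. (w + t *\<^sub>R z) \<bullet> s \<noteq> 0})" using w(3) by simp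
  ultimately obtain d where d: "d > 0" "ball 0 d \<subseteq> (\<Inter>s\<in>S. {t. (w + t *\<^sub>R z) \<bullet> s \<noteq> 0})"
    using open_contains_ball by blast
  \<comment> \<open>Steps up to \<open>m\<close> stay below \<open>d\<close>, which keeps the
    earlier conditions, and move by at most \<open>e / 4\<close>, which fits into the remaining
    \<open>e / 2\<close>.\<close>
  define m where "m = min (d / 2) (e / (4 * norm z))"
  have m: "0 < m" "m < d" "m * norm z \<le> e / 4"
    using d insert.prems(4) \<open>z \<noteq> 0\<close> by (auto simp: m_def min_def field_simps)
  \<comment> \<open>The product with \<open>s\<close> is a nonconstant affine function of
    \<open>t\<close>, so it cannot vanish at both \<open>m\<close> and \<open>m / 2\<close>.\<close>
  obtain t where t: "0 < t" "t \<le> m" "(w + t *\<^sub>R z) \<bullet> s \<noteq> 0"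
  proof (cases "(w + m *\<^sub>R z) \<bullet> s = 0")
    case True
    moreover have "(w + m *\<^sub>R z) \<bullet> s - (w + (m/2) *\<^sub>R z) \<bullet> s = (m / 2) * (z \<bullet> s)"
      by (simp add: inner_add_left field_simps)
    ultimately have "(w + (m/2) *\<^sub>R z) \<bullet> s \<noteq> 0" using zs m(1) by auto
    then show ?thesis using that[of "m/2"] m by simp
  qed (use m that[of m] in simp)
  have "dist (w + t *\<^sub>R z) u \<le> dist w u + t * norm z"
    using t norm_triangle_ineq[of "w - u" "t *\<^sub>R z"] by (simp add: dist_norm algebra_simps)
  also have "\<dots> < e" using w(1) m(3) t mult_right_mono[of t m "norm z"] insert.prems(4) by simp
  finally have "dist (w + t *\<^sub>R z) u < e" .
  moreover have "v \<bullet> (w + t *\<^sub>R z) = 0" using w zv by (simp add: inner_add_right)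
  moreover have "t \<in> ball 0 d" using t m by (simp add: dist_norm)
  then have "\<forall>s\<in>S. (w + t *\<^sub>R z) \<bullet> s \<noteq> 0" using d(2) by blast
  ultimately show ?case using t(3) by (intro exI[of _ "w + t *\<^sub>R z"]) simp
qed

text \<open>A vertex is the intersection of the facets through it. If there were only one, it would
  be the vertex itself, but facets of \<open>F\<close> have dimension at least one.\<close>

lemma two_facets_at_vertex:
  fixes F :: "'a::euclidean_space set"
  assumes F: "polytope F" "aff_dim F \<ge> 2" and v: "{v} face_of F"
  shows "\<exists>G1 G2. G1 face_of F \<and> G2 face_of F \<and> v \<in> G1 \<and> v \<in> G2 \<and> G1 \<noteq> {v} \<and> G2 \<noteq> {v} \<and>
    G1 \<noteq> F \<and> G2 \<noteq> F \<and> G1 \<noteq> G2"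
proof -
  have "{v} \<noteq> F" using F(2) by auto
  then have i: "{v} = \<Inter>{G. G facet_of F \<and> {v} \<subseteq> G}"
    using face_of_polyhedron[OF polytope_imp_polyhedron[OF F(1)] v insert_not_empty] by metis
  have f: "G face_of F" "G \<noteq> {v}" "G \<noteq> F" if "G facet_of F" for G
    using that F(2) by (auto simp: facet_of_def)
  let ?S = "{G. G facet_of F \<and> {v} \<subseteq> G}"
  have "?S \<noteq> {}"
  proof
    assume "?S = {}"
    then have "UNIV = {v}" using i by (metis Inter_empty)
    then have "F \<subseteq> {v}" by blast
    then have "aff_dim F \<le> aff_dim {v}" by (rule aff_dim_subset)
    then show False using F(2) by simp
  qed
  then obtain G1 where G1: "G1 facet_of F" "v \<in> G1" by auto
  have "?S \<noteq> {G1}" using i f(2)[OF G1(1)] by (metis cInf_singleton)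
  then obtain G2 where "G2 facet_of F" "v \<in> G2" "G2 \<noteq> G1" using G1 by auto
  then show ?thesis using f G1 by metis
qed

text \<open>Some affine functional exposes \<open>v\<close> in \<open>F\<close>. The facet equation
  has a nonzero right-hand side, because the origin is interior, and is used to absorb the constant
  term, so that a central hyperplane does the exposing.\<close>

lemma facet_exposing_vertex:
  fixes P :: "'a::euclidean_space set"
  assumes P: "origin_polytope P" and v: "v \<in> vertices P" and d: "DIM('a) \<ge> 2"
  obtains F u where "F facet_of P" "v \<in> F" "u \<bullet> v = 0" "\<And>x. x \<in> F \<Longrightarrow> x \<noteq> v \<Longrightarrow> 0 < u \<bullet> x"
proof -
  note pP = origin_polytopeD(1)[OF P]
  have vP: "{v} face_of P" using v vertex_face by blast
  have ad: "aff_dim P = int DIM('a)" using P by (simp add: origin_polytope_def)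
  have "{v} \<noteq> P" using ad d by auto
  obtain F where F: "F facet_of P" "v \<in> F"
    using face_of_polyhedron_subset_facet[OF polytope_imp_polyhedron[OF pP] vP] \<open>{v} \<noteq> P\<close> by auto
  have fF: "F face_of P" using F facet_of_imp_face_of by blast
  have FP: "F \<noteq> P" using F(1) facet_of_irrefl by blast
  have pF: "polytope F" by (rule face_of_polytope_polytope[OF pP fF])
  obtain a b where ab: "P \<subseteq> {x. a \<bullet> x \<le> b}" "F = P \<inter> {x. a \<bullet> x = b}"
    using fF exposed_face_of_polyhedron[OF polytope_imp_polyhedron[OF pP]] unfolding exposed_face_of_def by blast
  have b: "b \<noteq> 0"
  proof
    assume "b = 0"
    then have "0 \<in> F" using ab(2) origin_polytopeD(2)[OF P] interior_subset[of P] by auto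
    then show False using face_of_disjoint_interior[OF fF FP] origin_polytopeD(2)[OF P] by blast
  qed
  have "{v} face_of F" using vP F(2) fF face_of_face by blast
  then have "{v} exposed_face_of F" using exposed_face_of_polyhedron[OF polytope_imp_polyhedron[OF pF]] by blast
  then obtain c m where cm: "F \<subseteq> {x. c \<bullet> x \<le> m}" "{v} = F \<inter> {x. c \<bullet> x = m}"
    unfolding exposed_face_of_def by blast
  have cv: "c \<bullet> v = m" using cm(2) by blast
  \<comment> \<open>On \<open>F\<close> the product with \<open>a\<close> is constantly
    \<open>b\<close>, so the first summand contributes the constant \<open>m\<close>.\<close>
  define u where "u = (m / b) *\<^sub>R a - c"
  have ua: "u \<bullet> x = m - c \<bullet> x" if "x \<in> F" for x
    using that ab(2) b by (simp add: u_def inner_diff_left)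
  show ?thesis
  proof
    show "F facet_of P" "v \<in> F" by fact+
    show "u \<bullet> v = 0" using ua[OF F(2)] cv by simp
    fix x assume x: "x \<in> F" "x \<noteq> v"
    then have "c \<bullet> x \<noteq> m" "c \<bullet> x \<le> m" using cm by blast+
    then show "0 < u \<bullet> x" using ua[OF x(1)] by simp
  qed
qed
lemma slice_equiv_same_signs:
  assumes Q: "polytope Q" and s: "\<And>v. v \<in> vertices Q \<Longrightarrow> sgn (u \<bullet> v) = sgn (w \<bullet> v)"
  shows "Q \<inter> perp u \<simeq> Q \<inter> perp w"
proof -
  have i: "face_lattice_iso id Q Q" by (simp add: face_lattice_iso_def)
  have "vertex_map id v = v" for v :: 'a by (simp add: vertex_map_def)
  then show ?thesis using slice_equiv[OF i Q Q] s by simp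
qed

lemma eventually_same_sign:
  fixes g :: "'b::t2_space \<Rightarrow> real"
  assumes "isCont g a" "g a \<noteq> 0"
  shows "eventually (\<lambda>t. sgn (g t) = sgn (g a)) (at a)"
proof (cases "g a > 0")
  case True
  then have "eventually (\<lambda>t. g t > 0) (at a)" using assms(1) order_tendstoD(1) unfolding isCont_def by blast
  then show ?thesis by eventually_elim (use True in simp)
next
  case False
  then have n: "g a < 0" using assms(2) by simp
  then have "eventually (\<lambda>t. g t < 0) (at a)" using assms(1) order_tendstoD(2) unfolding isCont_def by blast
  then show ?thesis by eventually_elim (use n in simp)
qed

lemma vertex_nonzero:
  assumes "0 \<in> interior P" "x \<in> vertices P"
  shows "x \<noteq> 0"
  using assms extreme_point_not_in_interior unfolding vertices_def by blast

text \<open>Of two different points on a ray from the origin, the nearer one lies in the open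
  segment between the origin and the other, so it is not extreme.\<close>

lemma vertex_on_ray:
  fixes x :: "'a::euclidean_space"
  assumes P: "0 \<in> interior P" and x: "x \<in> vertices P" and cx: "c *\<^sub>R x \<in> vertices P" and c: "0 < c"
  shows "c = 1"
proof (rule ccontr)
  assume "c \<noteq> 1"
  have x0: "x \<noteq> 0" by (rule vertex_nonzero[OF P x])
  have z0: "0 \<in> P" using P interior_subset by blast
  note i = vertices_in[OF x] vertices_in[OF cx]
  show False
  proof (cases "c < 1")
    case True
    then have "c *\<^sub>R x \<in> open_segment 0 x" using c x0 by (auto simp: in_segment intro!: exI[of _ c])
    then show False using cx z0 i unfolding vertices_def extreme_point_of_def by blast
  next
    case False
    then have "1 < c" using \<open>c \<noteq> 1\<close> by simp
    then have "x \<in> open_segment 0 (c *\<^sub>R x)" using c x0 by (auto simp: in_segment intro!: exI[of _ "1/c"])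
    then show False using x z0 i unfolding vertices_def extreme_point_of_def by blast
  qed
qed

text \<open>Along a generic direction \<open>w \<perp> v\<close> for which the facet \<open>F\<close> meets \<open>w\<^sup>\<perp>\<close> in \<open>v\<close> only, tilting
  \<open>w\<^sup>\<perp>\<close> off \<open>v\<close> into \<open>F\<close> destroys at most the slice vertices on the line through \<open>v\<close>, but creates
  slices of \<open>F\<close> and of two of its facets.\<close>

lemma card_sliced_faces_less:
  fixes P :: "'a::euclidean_space set"
  assumes P: "origin_polytope P" and v: "v \<in> vertices P" and w: "w \<bullet> v = 0" "w \<noteq> 0"
    and gen: "\<And>x. x \<in> vertices P \<Longrightarrow> x \<notin> range (\<lambda>c. c *\<^sub>R v) \<Longrightarrow> w \<bullet> x \<noteq> 0 \<and> sgn (z \<bullet> x) = sgn (w \<bullet> x)"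
    and zv: "z \<bullet> v < 0"
    and F: "F face_of P" "v \<in> F" "aff_dim F \<ge> 2" and Fpos: "\<And>x. x \<in> F \<inter> vertices P \<Longrightarrow> x \<noteq> v \<Longrightarrow> 0 < w \<bullet> x"
  shows "card (sliced_faces w P) < card (sliced_faces z P)"
proof -
  note pP = origin_polytopeD(1)[OF P]
  \<comment> \<open>The faces with vertices strictly on both sides of \<open>w\<close>. The tilt
    does not change their signs, so \<open>M\<close> is common to both counts.\<close>
  define M where "M = {G. G face_of P \<and> G \<noteq> {} \<and> (\<exists>x\<in>G \<inter> vertices P. w \<bullet> x < 0) \<and> (\<exists>x\<in>G \<inter> vertices P. 0 < w \<bullet> x)}"
  have fin: "finite (sliced_faces z P)" "finite M"
    using finite_polytope_faces[OF pP] unfolding sliced_faces_def M_def by auto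
  have vF: "{v} face_of F" using v F(1,2) face_of_face vertex_face by blast
  have pF: "polytope F" by (rule face_of_polytope_polytope[OF pP F(1)])
  obtain G1 G2 where G: "G1 face_of F" "G2 face_of F" "v \<in> G1" "v \<in> G2" "G1 \<noteq> {v}" "G2 \<noteq> {v}" "G1 \<noteq> F" "G2 \<noteq> F" "G1 \<noteq> G2"
    using two_facets_at_vertex[OF pF F(3) vF] by blast
  have "F \<noteq> {v}" using F(3) by auto
  have line: "\<exists>c. x = c *\<^sub>R v" if "x \<in> vertices P" "w \<bullet> x = 0" for x
    using gen[OF that(1)] that(2) by auto
  note ray = vertex_on_ray[OF origin_polytopeD(2)[OF P]] vertex_nonzero[OF origin_polytopeD(2)[OF P]]
  have line_neg: "\<exists>c<0. x = c *\<^sub>R v" if x: "x \<in> vertices P" "w \<bullet> x = 0" "x \<noteq> v" for x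
  proof -
    obtain c where c: "x = c *\<^sub>R v" using line x by blast
    have "c \<noteq> 0" using ray(2)[OF x(1)] c by auto
    moreover have "\<not> 0 < c" using ray(1)[OF v, of c] x c by auto
    ultimately show ?thesis using c by (metis linorder_neqE_linordered_idom)
  qed
  have unique_neg: "x = y" if x: "x \<in> vertices P" "w \<bullet> x = 0" "x \<noteq> v" and y: "y \<in> vertices P" "w \<bullet> y = 0" "y \<noteq> v" for x y
  proof -
    obtain c d where cd: "c < 0" "x = c *\<^sub>R v" "d < 0" "y = d *\<^sub>R v"
      using line_neg[OF x] line_neg[OF y] by blast
    then have "(d / c) *\<^sub>R x = y" "0 < d / c" by (auto simp: divide_neg_neg)
    then have "d / c = 1" using ray(1)[OF x(1), of "d / c"] y(1) by simp
    then show ?thesis using cd by auto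
  qed
  have zero_faces: "G = {} \<or> (\<exists>x\<in>vertices P. w \<bullet> x = 0 \<and> G = {x})"
    if G: "G face_of P" and z: "\<forall>x\<in>G \<inter> vertices P. w \<bullet> x = 0" for G
  proof (cases "G = {}")
    case False
    have hG: "G = convex hull (G \<inter> vertices P)" by (rule face_hull_vertices[OF pP G])
    have notP: "G \<noteq> P" using z exists_vertex_inner_neg[OF P w(2)] vertices_in by force
    have same: "x = y" if xy: "x \<in> G \<inter> vertices P" "y \<in> G \<inter> vertices P" for x y
    proof (rule ccontr)
      assume "x \<noteq> y"
      \<comment> \<open>The origin lies between \<open>v\<close> and any negative multiple of it,
        and as an interior point it is in no proper face. Hence a face with only zero signs has a
        single vertex.\<close>
      have *: False if ab: "c < 0" "c *\<^sub>R v \<in> G" "v \<in> G" for c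
      proof -
        have "(1 / (1 - c)) *\<^sub>R (c *\<^sub>R v) + (- c / (1 - c)) *\<^sub>R v \<in> G"
          by (rule convexD[OF face_of_imp_convex[OF G] ab(2,3)]) (use ab in \<open>auto simp: field_simps\<close>)
        then have "0 \<in> G" by (simp add: scaleR_left_distrib[symmetric])
        then show False
          using face_of_disjoint_interior[OF G notP] origin_polytopeD(2)[OF P] by blast
      qed
      have **: False if "x = v" "y \<noteq> v" "x \<in> G \<inter> vertices P" "y \<in> G \<inter> vertices P" for x y
        using line_neg[of y] * that z by auto
      show False
      proof (cases "x = v \<or> y = v")
        case True then show False using **[of x y] **[of y x] xy \<open>x \<noteq> y\<close> by auto
      next
        case False
        then show False using unique_neg[of x y] xy z \<open>x \<noteq> y\<close> by blast
      qed
    qed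
    have "G \<inter> vertices P \<noteq> {}" using hG False by (metis convex_hull_empty)
    then obtain x where x: "x \<in> G \<inter> vertices P" by blast
    then have "G \<inter> vertices P = {x}" using same by blast
    then have "G = {x}" using hG by simp
    then show ?thesis using x z by blast
  qed simp
  define Z where "Z = {x\<in>vertices P. w \<bullet> x = 0}"
  have Z2: "\<exists>y. Z \<subseteq> {v, y}"
  proof (cases "Z \<subseteq> {v}")
    case False
    then obtain y where y: "y \<in> Z" "y \<noteq> v" by blast
    have "x = y" if "x \<in> Z" "x \<noteq> v" for x
      using unique_neg[of x y] that y by (auto simp: Z_def)
    then show ?thesis by blast
  qed blast
  have sub: "sliced_faces w P \<subseteq> M \<union> insert {} ((\<lambda>x. {x}) ` Z)"
  proof
    fix G assume G: "G \<in> sliced_faces w P"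
    then have f: "G face_of P" by (simp add: sliced_faces_def)
    show "G \<in> M \<union> insert {} ((\<lambda>x. {x}) ` Z)"
    proof (cases "G = {}")
      case False
      then show ?thesis
        using rel_interior_meets_perp_iff[OF pP f False, of w] G zero_faces[OF f]
        by (auto simp: sliced_faces_def M_def Z_def)
    qed simp
  qed
  \<comment> \<open>The empty face, \<open>{v}\<close> and at most one vertex opposite to
    \<open>v\<close>: three at most, against the four faces added to \<open>M\<close> below.\<close>
  have "card (insert {} ((\<lambda>x. {x}) ` Z)) \<le> 3"
  proof -
    obtain y where "Z \<subseteq> {v, y}" using Z2 by blast
    then have "insert {} ((\<lambda>x. {x}) ` Z) \<subseteq> {{}, {v}, {y}}" by blast
    then have "card (insert {} ((\<lambda>x. {x}) ` Z)) \<le> card {{}, {v}, {y}}" by (rule card_mono[rotated]) simp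
    also have "\<dots> \<le> 3" by (simp add: card_insert_if)
    finally show ?thesis .
  qed
  moreover have "finite ((\<lambda>x. {x}) ` Z)" using origin_polytopeD(4)[OF P] by (simp add: Z_def)
  ultimately have le: "card (sliced_faces w P) \<le> card M + 3"
    using card_mono[OF _ sub] fin(2) card_Un_le[of M "insert {} ((\<lambda>x. {x}) ` Z)"] by simp
  have sg: "sgn (z \<bullet> x) = sgn (w \<bullet> x)" if "x \<in> vertices P" "w \<bullet> x \<noteq> 0" for x
  proof -
    have "x \<notin> range (\<lambda>c. c *\<^sub>R v)" using that(2) w(1) by auto
    then show ?thesis using gen that by blast
  qed
  have sgl: "z \<bullet> x < 0" if "x \<in> vertices P" "w \<bullet> x < 0" for x using sg[OF that(1)] that(2) by (simp add: sgn_if split: if_splits)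
  have sgg: "z \<bullet> x > 0" if "x \<in> vertices P" "w \<bullet> x > 0" for x using sg[OF that(1)] that(2) by (simp add: sgn_if split: if_splits)
  \<comment> \<open>Such a face has \<open>v\<close> on the negative side of \<open>z\<close> and
    another vertex on the positive side, but no vertex on the negative side of
    \<open>w\<close>.\<close>
  have new: "G \<in> sliced_faces z P \<and> G \<notin> M" if G: "G face_of F" "v \<in> G" "G \<noteq> {v}" for G
  proof -
    have GP: "G face_of P" using G(1) F(1) face_of_trans by blast
    have GF: "G \<subseteq> F" using G(1) face_of_imp_subset by blast
    have "G \<inter> vertices P \<noteq> {v}" using face_hull_vertices[OF pP GP] G(3) by (metis convex_hull_singleton)
    then obtain x where x: "x \<in> G" "x \<in> vertices P" "x \<noteq> v" using G(2) v by blast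
    then have "0 < z \<bullet> x" using sgg Fpos GF by blast
    then have "G \<in> sliced_faces z P"
      using rel_interior_meets_perp_iff[OF pP GP, of z] GP x v zv G(2) by (auto simp: sliced_faces_def)
    moreover have "G \<notin> M"
    proof
      assume "G \<in> M"
      then obtain y where "y \<in> G" "y \<in> vertices P" "w \<bullet> y < 0" by (auto simp: M_def)
      then show False using Fpos[of y] GF w(1) by (cases "y = v") auto
    qed
    ultimately show ?thesis ..
  qed
  have "M \<subseteq> sliced_faces z P"
  proof
    fix G assume G: "G \<in> M"
    then have f: "G face_of P" "G \<noteq> {}" by (auto simp: M_def)
    obtain x y where "x \<in> G \<inter> vertices P" "y \<in> G \<inter> vertices P" "z \<bullet> x < 0" "z \<bullet> y > 0"
      using G sgl sgg unfolding M_def by blast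
    then show "G \<in> sliced_faces z P"
      using rel_interior_meets_perp_iff[OF pP f, of z] f by (auto simp: sliced_faces_def)
  qed
  then have "M \<union> {{}, F, G1, G2} \<subseteq> sliced_faces z P"
    using new[OF face_of_refl[OF polytope_imp_convex[OF pF]] F(2) \<open>F \<noteq> {v}\<close>] new[OF G(1,3,5)] new[OF G(2,4,6)]
    by (auto simp: sliced_faces_def)
  moreover have "M \<inter> {{}, F, G1, G2} = {}"
    using new[OF face_of_refl[OF polytope_imp_convex[OF pF]] F(2) \<open>F \<noteq> {v}\<close>] new[OF G(1,3,5)] new[OF G(2,4,6)]
    by (auto simp: M_def)
  moreover have "{} \<noteq> F" "{} \<noteq> G1" "{} \<noteq> G2" using F(2) G(3,4) by auto
  then have "card {{}, F, G1, G2} = 4" using G(7,8,9) by (simp add: card_insert_if)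
  ultimately have "card M + 4 \<le> card (sliced_faces z P)"
    using card_mono[OF fin(1)] card_Un_disjoint[OF fin(2)] by (metis finite.emptyI finite_insert)
  with le show ?thesis by simp
qed

lemma perp_scaleR: "c \<noteq> 0 \<Longrightarrow> perp (c *\<^sub>R v) = perp v"
  by (simp add: perp_def)

lemma pointwise_imp_arrangement_subset:
  fixes P Q :: "'a::euclidean_space set"
  assumes P: "origin_polytope P" and Q: "origin_polytope Q" and d: "DIM('a) \<ge> 3"
    and C: "pointwise_slice_equiv P Q"
  shows "arrangement P \<subseteq> arrangement Q"
proof
  fix H assume "H \<in> arrangement P"
  then obtain v where v: "v \<in> vertices P" and H: "H = perp v" unfolding arrangement_def by blast
  have v0: "v \<noteq> 0" by (rule vertex_nonzero[OF origin_polytopeD(2)[OF P] v])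
  show "H \<in> arrangement Q"
  proof (rule ccontr)
    assume nH: "H \<notin> arrangement Q"
    have Qv: "x \<notin> range (\<lambda>c. c *\<^sub>R v)" if x: "x \<in> vertices Q" for x
    proof
      assume "x \<in> range (\<lambda>c. c *\<^sub>R v)"
      then obtain c where c: "x = c *\<^sub>R v" by blast
      moreover have "x \<noteq> 0" by (rule vertex_nonzero[OF origin_polytopeD(2)[OF Q] x])
      ultimately have "perp x = H" using H perp_scaleR by auto
      then show False using nH x unfolding arrangement_def by blast
    qed
    have d2: "DIM('a) \<ge> 2" using d by simp
    obtain F u where F: "F facet_of P" "v \<in> F" and u: "u \<bullet> v = 0" "\<And>x. x \<in> F \<Longrightarrow> x \<noteq> v \<Longrightarrow> 0 < u \<bullet> x"
      using facet_exposing_vertex[OF P v d2] by metis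
    have fF: "F face_of P" using F facet_of_imp_face_of by blast
    have "aff_dim P = int DIM('a)" using P by (simp add: origin_polytope_def)
    \<comment> \<open>In dimension at least three a facet is at least two-dimensional and thus has
      two facets of its own through \<open>v\<close>.\<close>
    then have aF: "aff_dim F \<ge> 2" using F(1) d by (simp add: facet_of_def)
    have finV: "finite (vertices P)" "finite (vertices Q)" using origin_polytopeD P Q by blast+
    \<comment> \<open>Vertices on the line of \<open>v\<close> are left out because every vector
      orthogonal to \<open>v\<close> is orthogonal to them; by \<open>Qv\<close> none of them
      belongs to \<open>Q\<close>.\<close>
    define S where "S = {x \<in> vertices P \<union> vertices Q. x \<notin> range (\<lambda>c. c *\<^sub>R v)}"
    have finS: "finite S" using finV by (simp add: S_def)
    \<comment> \<open>Positivity on the remaining vertices of \<open>F\<close> is an open condition,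
      so it survives the passage from \<open>u\<close> to a generic \<open>w\<close>.\<close>
    have "open (\<Inter>x\<in>F \<inter> vertices P - {v}. {w. 0 < w \<bullet> x})"
      using finV by (intro open_INT ballI open_Collect_less continuous_intros) auto
    moreover have "u \<in> (\<Inter>x\<in>F \<inter> vertices P - {v}. {w. 0 < w \<bullet> x})" using u by blast
    ultimately obtain e where e: "e > 0" "ball u e \<subseteq> (\<Inter>x\<in>F \<inter> vertices P - {v}. {w. 0 < w \<bullet> x})"
      using open_contains_ball by blast
    have "\<exists>w. dist w u < e \<and> v \<bullet> w = 0 \<and> (\<forall>s\<in>S. w \<bullet> s \<noteq> 0)"
      by (rule perturb_in_perp[OF finS v0]) (use u e in \<open>auto simp: S_def inner_commute\<close>)
    then obtain w where w: "dist w u < e" "v \<bullet> w = 0" "\<And>s. s \<in> S \<Longrightarrow> w \<bullet> s \<noteq> 0" by blast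
    have wv: "w \<bullet> v = 0" using w(2) by (simp add: inner_commute)
    have wF: "0 < w \<bullet> x" if "x \<in> F \<inter> vertices P" "x \<noteq> v" for x
      using e(2) w(1) that by (auto simp: dist_commute)
    have w0: "w \<noteq> 0"
    proof
      assume "w = 0"
      moreover obtain x where "x \<in> vertices Q" using exists_vertex_inner_neg[OF Q v0] by blast
      ultimately show False using w(3)[of x] Qv by (auto simp: S_def)
    qed
    have "\<forall>\<^sub>F t in at 0. sgn ((w - t *\<^sub>R v) \<bullet> s) = sgn (w \<bullet> s)" if "s \<in> S" for s
      using eventually_same_sign[where g = "\<lambda>t. (w - t *\<^sub>R v) \<bullet> s" and a = 0] w(3)[OF that] by (simp add: continuous_intros)
    then have "\<forall>\<^sub>F t in at 0. \<forall>s\<in>S. sgn ((w - t *\<^sub>R v) \<bullet> s) = sgn (w \<bullet> s)"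
      using finS by (simp add: eventually_ball_finite)
    then have "\<forall>\<^sub>F t in at_right 0. \<forall>s\<in>S. sgn ((w - t *\<^sub>R v) \<bullet> s) = sgn (w \<bullet> s)"
      by (rule eventually_at_split[THEN iffD1, THEN conjunct2])
    moreover have "\<forall>\<^sub>F t::real in at_right 0. t > 0" by (simp add: eventually_at_right_less)
    ultimately have "\<forall>\<^sub>F t in at_right 0. t > 0 \<and> (\<forall>s\<in>S. sgn ((w - t *\<^sub>R v) \<bullet> s) = sgn (w \<bullet> s))"
      by eventually_elim simp
    then obtain t :: real where t: "t > 0" "\<And>s. s \<in> S \<Longrightarrow> sgn ((w - t *\<^sub>R v) \<bullet> s) = sgn (w \<bullet> s)"
      using eventually_happens'[OF trivial_limit_at_right_real] by blast
    \<comment> \<open>The tilt makes \<open>v\<close> negative while the other vertices of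
      \<open>F\<close> stay positive, and no vertex of \<open>Q\<close> changes its sign.\<close>
    define z where "z = w - t *\<^sub>R v"
    have zv: "z \<bullet> v < 0" using wv t(1) v0 by (simp add: z_def inner_diff_left)
    have z0: "z \<noteq> 0" using zv by auto
    have less: "card (sliced_faces w P) < card (sliced_faces z P)"
      by (rule card_sliced_faces_less[OF P v wv w0 _ zv fF F(2) aF wF]) (use w(3) t(2) in \<open>auto simp: S_def z_def\<close>)
    have "Q \<inter> perp w \<simeq> Q \<inter> perp z"
      by (rule slice_equiv_same_signs[OF origin_polytopeD(1)[OF Q]]) (use t(2) Qv in \<open>auto simp: S_def z_def\<close>)
    then have "P \<inter> perp w \<simeq> P \<inter> perp z"
      using pointwise_slice_equiv_nonzero[OF C] w0 z0 comb_equiv_trans comb_equiv_sym by metis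
    then show False
      using card_face_lattice_cong card_slice_faces[OF origin_polytopeD(1)[OF P]] less by fastforce
  qed
qed

lemma pointwise_imp_same_arrangement:
  fixes P Q :: "'a::euclidean_space set"
  assumes "origin_polytope P" "origin_polytope Q" "DIM('a) \<ge> 3" "pointwise_slice_equiv P Q"
  shows "same_arrangement P Q"
proof -
  have "pointwise_slice_equiv Q P"
    using assms(4) comb_equiv_sym unfolding pointwise_slice_equiv_def by blast
  then show ?thesis
    using pointwise_imp_arrangement_subset assms unfolding same_arrangement_def by blast
qed

subsection \<open>Exposed faces and images of polytopes\<close>

text \<open>The vertices of the face where \<open>c\<close> is maximal are generators, and among the
  generators only those in \<open>T\<close> attain the maximum.\<close>

lemma exposed_hull_face:
  fixes S :: "'a::euclidean_space set"
  assumes S: "finite S" "T \<subseteq> S" and c: "\<And>t. t \<in> T \<Longrightarrow> c \<bullet> t = m" "\<And>s. s \<in> S - T \<Longrightarrow> c \<bullet> s < m"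
  shows "convex hull T face_of convex hull S"
proof -
  let ?P = "convex hull S" and ?F = "convex hull S \<inter> {x. c \<bullet> x = m}"
  have "convex hull S \<subseteq> {x. c \<bullet> x \<le> m}"
    by (rule hull_minimal) (use c S in \<open>force simp: convex_halfspace_le\<close>)+
  then have F: "?F face_of ?P" by (intro face_of_Int_supporting_hyperplane_le convex_convex_hull) blast
  have "?F \<inter> vertices ?P \<subseteq> T"
    using vertices_convex_hull_subset[of S] c(2) by fastforce
  then have "?F \<subseteq> convex hull T"
    using face_hull_vertices[OF polytope_convex_hull[OF S(1)] F] hull_mono by metis
  moreover have "convex hull T \<subseteq> ?F"
  proof (rule Int_greatest)
    show "convex hull T \<subseteq> ?P" by (rule hull_mono[OF S(2)])
    show "convex hull T \<subseteq> {x. c \<bullet> x = m}"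
      by (rule hull_minimal) (use c in \<open>auto simp: convex_hyperplane\<close>)
  qed
  ultimately show ?thesis using F by simp
qed

lemma vertices_hull_eq:
  fixes S :: "'a::euclidean_space set"
  assumes "finite S" "\<And>v. v \<in> S \<Longrightarrow> \<exists>c. \<forall>w\<in>S. w \<noteq> v \<longrightarrow> c \<bullet> w < c \<bullet> v"
  shows "vertices (convex hull S) = S"
proof
  show "S \<subseteq> vertices (convex hull S)"
  proof
    fix v assume v: "v \<in> S"
    then obtain c where "\<forall>w\<in>S. w \<noteq> v \<longrightarrow> c \<bullet> w < c \<bullet> v" using assms(2) by blast
    then have "convex hull {v} face_of convex hull S"
      by (intro exposed_hull_face[where c = c and m = "c \<bullet> v"]) (use v assms(1) in auto)
    then show "v \<in> vertices (convex hull S)" by (simp add: vertex_face)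
  qed
qed (rule vertices_convex_hull_subset)

lemma image_face_lattice_iso:
  assumes f: "inj f" and face: "\<And>F. f ` F face_of f ` P \<longleftrightarrow> F face_of P"
  shows "face_lattice_iso ((`) f) P (f ` P)"
  unfolding face_lattice_iso_def bij_betw_def
proof (intro conjI)
  show "inj_on ((`) f) (face_lattice P)" using f by (auto intro!: inj_onI simp: inj_image_eq_iff)
  show "(`) f ` face_lattice P = face_lattice (f ` P)"
  proof
    show "(`) f ` face_lattice P \<subseteq> face_lattice (f ` P)" using face by (auto simp: face_lattice_def)
    show "face_lattice (f ` P) \<subseteq> (`) f ` face_lattice P"
    proof
      fix G assume "G \<in> face_lattice (f ` P)"
      then have G: "G face_of f ` P" by (simp add: face_lattice_def)
      then obtain F where "F \<subseteq> P" "G = f ` F" using face_of_imp_subset subset_imageE by metis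
      then show "G \<in> (`) f ` face_lattice P" using G face by (auto simp: face_lattice_def)
    qed
  qed
  show "\<forall>F\<in>face_lattice P. \<forall>G\<in>face_lattice P. (F \<subseteq> G) = (f ` F \<subseteq> f ` G)"
    using f by (simp add: inj_image_subset_iff)
qed

lemma linear_image_iso:
  fixes f :: "'a::euclidean_space \<Rightarrow> 'a"
  assumes "linear f" "inj f"
  shows "face_lattice_iso ((`) f) P (f ` P)"
  using assms by (intro image_face_lattice_iso face_of_linear_image) auto

lemma translation_iso:
  fixes a :: "'a::euclidean_space"
  shows "face_lattice_iso ((`) ((+) a)) P ((+) a ` P)"
  by (intro image_face_lattice_iso) auto

lemma origin_polytopeI:
  fixes P :: "'a::euclidean_space set"
  assumes "polytope P" "0 \<in> interior P"
  shows "origin_polytope P"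
  using assms aff_dim_nonempty_interior[of P] unfolding origin_polytope_def by auto

section \<open>Central symmetry and triangular slices\<close>

lemma card_vertices_cong:
  assumes "P \<simeq> Q" "polytope P" "polytope Q"
  shows "card (vertices P) = card (vertices Q)"
  using assms bij_vertex_map bij_betw_same_card unfolding comb_equiv_def by blast

lemma neg_eq_self_iff: "- x = x \<longleftrightarrow> x = 0" for x :: "'a::real_vector"
proof
  assume "- x = x"
  then have "x + x = 0" by (metis add.right_inverse)
  then show "x = 0" by (metis scaleR_2 scaleR_eq_0_iff zero_neq_numeral)
qed simp

text \<open>Negation acts on the vertices of the slice as an involution. It has no fixed point,
  since the origin is the midpoint of a vertex and its negative and so is no vertex; three elements
  admit no such involution.\<close>

lemma symmetric_slice_not_triangle:
  fixes P :: "'a::euclidean_space set"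
  assumes P: "polytope P" and sym: "\<And>x. x \<in> P \<Longrightarrow> - x \<in> P"
  shows "card (vertices (P \<inter> perp u)) \<noteq> 3"
proof
  let ?K = "P \<inter> perp u"
  assume "card (vertices ?K) = 3"
  then obtain a b c where abc: "vertices ?K = {a,b,c}" "a \<noteq> b" "b \<noteq> c" "a \<noteq> c"
    by (metis card_3_iff)
  have symK: "- x \<in> ?K" if "x \<in> ?K" for x using sym that by (auto simp: perp_def)
  have K: "uminus ` ?K = ?K"
  proof
    show "uminus ` ?K \<subseteq> ?K" using symK by blast
    show "?K \<subseteq> uminus ` ?K"
    proof
      fix x assume "x \<in> ?K"
      then have "- x \<in> ?K" by (rule symK)
      then show "x \<in> uminus ` ?K" by (metis image_eqI minus_minus)
    qed
  qed
  have neg: "- x \<in> vertices ?K" if "x \<in> vertices ?K" for x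
  proof -
    have "{x} face_of ?K" using that by (simp add: vertex_face)
    then have "uminus ` {x} face_of uminus ` ?K"
      by (subst face_of_linear_image) (auto simp: linear_uminus)
    then show ?thesis unfolding K by (simp add: vertex_face)
  qed
  have "x \<noteq> 0" if x: "x \<in> vertices ?K" for x
  proof
    assume "x = 0"
    obtain y where y: "y \<in> vertices ?K" "y \<noteq> 0" using abc by (metis insertCI)
    then have "- y \<noteq> y" using neg_eq_self_iff by blast
    then have "0 \<in> open_segment (- y) y" by (auto simp: in_segment intro!: exI[of _ "1/2"])
    moreover have "y \<in> ?K" "- y \<in> ?K" using y(1) neg vertices_in by blast+
    ultimately show False using x \<open>x = 0\<close> unfolding vertices_def extreme_point_of_def by blast
  qed
  then have ne: "- x \<noteq> x" if "x \<in> vertices ?K" for x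
    using that neg_eq_self_iff by blast
  have n: "- a \<in> {a,b,c}" "- b \<in> {a,b,c}" "- c \<in> {a,b,c}" "- a \<noteq> a" "- b \<noteq> b" "- c \<noteq> c"
    using neg ne abc(1) by blast+
  then show False using abc(2-4) by (metis insert_iff minus_minus singletonD)
qed

lemma not_setwise_if_triangle:
  fixes P Q :: "'a::euclidean_space set"
  assumes P: "polytope P" "\<And>x. x \<in> P \<Longrightarrow> - x \<in> P" and Q: "polytope Q" and w: "w \<noteq> 0"
    and tri: "card (vertices (Q \<inter> perp w)) = 3"
  shows "\<not> setwise_slice_equiv P Q" "\<not> setwise_slice_equiv Q P"
proof -
  have "slice_types P \<noteq> slice_types Q"
  proof
    assume "slice_types P = slice_types Q"
    then have "comb_type (Q \<inter> perp w) \<in> slice_types P" using slice_type_in_slice_types[OF w] by metis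
    then obtain u where "comb_type (Q \<inter> perp w) = comb_type (P \<inter> perp u)" by (rule slice_typesE)
    then have "Q \<inter> perp w \<simeq> P \<inter> perp u" using comb_type_eqD polytope_slice P(1) by blast
    then show False
      using card_vertices_cong polytope_slice P(1) Q tri symmetric_slice_not_triangle[OF P] by metis
  qed
  then show "\<not> setwise_slice_equiv P Q" "\<not> setwise_slice_equiv Q P"
    by (auto simp: setwise_slice_equiv_def)
qed

subsection \<open>A tetrahedron and a cube\<close>

lemma vec3_eq: "(x :: real^3) = y \<longleftrightarrow> x$1 = y$1 \<and> x$2 = y$2 \<and> x$3 = y$3"
  by (simp add: vec_eq_iff forall_3)

lemma inner3: "(x :: real^3) \<bullet> y = x$1 * y$1 + x$2 * y$2 + x$3 * y$3"
  by (simp add: inner_vec_def sum_3)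

definition tetrahedron_vertices :: "(real^3) set" where
  "tetrahedron_vertices = {vector [1,1,1], vector [1,-1,-1], vector [-1,1,-1], vector [-1,-1,1]}"

definition tetrahedron :: "(real^3) set" where
  "tetrahedron = convex hull tetrahedron_vertices"

definition cube :: "(real^3) set" where
  "cube = cbox (vec (-1)) (vec 1)"

lemma vertices_tetrahedron: "vertices tetrahedron = tetrahedron_vertices"
  unfolding tetrahedron_def
proof (rule vertices_hull_eq)
  fix v assume "v \<in> tetrahedron_vertices"
  then show "\<exists>c. \<forall>w\<in>tetrahedron_vertices. w \<noteq> v \<longrightarrow> c \<bullet> w < c \<bullet> v"
    by (intro exI[of _ v]) (auto simp: tetrahedron_vertices_def inner3 vec3_eq)
qed (simp add: tetrahedron_vertices_def)

text \<open>The facet opposite to a vertex \<open>v\<close> lies in the plane where the product with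
  \<open>v\<close> is -1. The coefficients \<open>?c v\<close> are the barycentric coordinates of
  \<open>x\<close>: the four vertices sum to zero and their rank-one matrices v v^T sum to four
  times the identity.\<close>

lemma mem_tetrahedron:
  "x \<in> tetrahedron \<longleftrightarrow> 0 \<le> 1 + x$1 + x$2 + x$3 \<and> 0 \<le> 1 + x$1 - x$2 - x$3 \<and>
    0 \<le> 1 - x$1 + x$2 - x$3 \<and> 0 \<le> 1 - x$1 - x$2 + x$3" (is "_ \<longleftrightarrow> ?R x")
proof
  assume "x \<in> tetrahedron"
  let ?H = "{x. (- vector [1,1,1]) \<bullet> x \<le> 1} \<inter> {x. (- vector [1,-1,-1]) \<bullet> x \<le> 1} \<inter>
      {x. (- vector [-1,1,-1]) \<bullet> x \<le> 1} \<inter> {x. (- vector [-1,-1,1] :: real^3) \<bullet> x \<le> 1}"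
  have "convex ?H" by (intro convex_Int convex_halfspace_le)
  then have "tetrahedron \<subseteq> ?H"
    unfolding tetrahedron_def
    by (intro hull_minimal) (auto simp: tetrahedron_vertices_def inner3)
  with \<open>x \<in> tetrahedron\<close> show "?R x" by (auto simp: inner3)
next
  assume R: "?R x"
  let ?c = "\<lambda>v. (1 + v \<bullet> x) / 4"
  have ne: "vector [1,1,1] \<noteq> (vector [1,-1,-1] :: real^3)" "vector [1,1,1] \<noteq> (vector [-1,1,-1] :: real^3)"
    "vector [1,1,1] \<noteq> (vector [-1,-1,1] :: real^3)" "vector [1,-1,-1] \<noteq> (vector [-1,1,-1] :: real^3)"
    "vector [1,-1,-1] \<noteq> (vector [-1,-1,1] :: real^3)" "vector [-1,1,-1] \<noteq> (vector [-1,-1,1] :: real^3)"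
    by (simp_all add: vec3_eq)
  have "x = (\<Sum>v\<in>tetrahedron_vertices. ?c v *\<^sub>R v)"
    unfolding tetrahedron_vertices_def using ne by (simp add: inner3) (simp add: vec3_eq field_simps)
  moreover have "(\<Sum>v\<in>tetrahedron_vertices. ?c v *\<^sub>R v) \<in> tetrahedron"
    unfolding tetrahedron_def
  proof (rule convex_sum)
    show "sum ?c tetrahedron_vertices = 1"
      unfolding tetrahedron_vertices_def using ne by (simp add: inner3 field_simps)
    show "\<And>v. v \<in> tetrahedron_vertices \<Longrightarrow> 0 \<le> ?c v"
      using R by (auto simp: tetrahedron_vertices_def inner3)
  qed (auto simp: tetrahedron_vertices_def hull_inc)
  ultimately show "x \<in> tetrahedron" by simp
qed

lemma origin_polytope_tetrahedron: "origin_polytope tetrahedron"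
proof (rule origin_polytopeI)
  show "polytope tetrahedron"
    by (simp add: tetrahedron_def polytope_convex_hull tetrahedron_vertices_def)
  have "open {x :: real^3. 0 < 1 + x$1 + x$2 + x$3 \<and> 0 < 1 + x$1 - x$2 - x$3 \<and>
      0 < 1 - x$1 + x$2 - x$3 \<and> 0 < 1 - x$1 - x$2 + x$3}"
    by (intro open_Collect_conj open_Collect_less continuous_intros)
  then show "0 \<in> interior tetrahedron"
    by (rule interiorI) (auto simp: mem_tetrahedron)
qed

lemma origin_polytope_cbox_vec:
  assumes "a < 0" "0 < b"
  shows "origin_polytope (cbox (vec a) (vec b) :: (real^'n) set)"
proof (rule origin_polytopeI)
  show "0 \<in> interior (cbox (vec a) (vec b) :: (real^'n) set)"
    using assms by (simp add: interior_cbox mem_box_cart)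
qed (rule polytope_interval)

lemma mem_cube: "x \<in> cube \<longleftrightarrow> (\<forall>i. \<bar>x$i\<bar> \<le> 1)"
  by (auto simp: cube_def mem_box_cart abs_le_iff minus_le_iff)

lemma origin_polytope_cube: "origin_polytope cube"
  unfolding cube_def by (rule origin_polytope_cbox_vec) auto

lemma vertices_cube: "vertices cube = {x. \<forall>i. \<bar>x$i\<bar> = 1}"
proof (intro set_eqI iffI)
  fix x assume x: "x \<in> vertices cube"
  have "\<bar>x$i\<bar> = 1" for i
  proof (rule ccontr)
    assume ne: "\<bar>x$i\<bar> \<noteq> 1"
    have xc: "x \<in> cube" using x by (rule vertices_in)
    \<comment> \<open>The slack in coordinate \<open>i\<close>: moving by \<open>e\<close> in either
      direction stays in the cube, which makes \<open>x\<close> a midpoint.\<close>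
    define e where "e = 1 - \<bar>x$i\<bar>"
    have e: "e > 0" using ne xc by (auto simp: e_def mem_cube order_less_le)
    have bi: "x$i - \<bar>x$i\<bar> \<ge> - 2" "x$i + \<bar>x$i\<bar> \<le> 2" using xc by (auto simp: mem_cube abs_if dest: spec[of _ i])
    have b: "x$j \<le> 1" "- 1 \<le> x$j" for j using xc by (auto simp: mem_cube abs_le_iff minus_le_iff)
    have "x + e *\<^sub>R axis i 1 \<in> cube" "x - e *\<^sub>R axis i 1 \<in> cube"
      unfolding mem_cube using bi b
      by (auto simp: axis_def e_def abs_le_iff minus_le_iff)
    moreover have "x = midpoint (x + e *\<^sub>R axis i 1) (x - e *\<^sub>R axis i 1)"
      by (simp add: midpoint_def scaleR_2[symmetric])
    moreover have "x + e *\<^sub>R axis i 1 \<noteq> x - e *\<^sub>R axis i 1"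
    proof
      assume "x + e *\<^sub>R axis i 1 = x - e *\<^sub>R axis i 1"
      then have "(x + e *\<^sub>R axis i 1)$i = (x - e *\<^sub>R axis i 1)$i" by (rule arg_cong)
      then show False using e by (simp add: axis_def)
    qed
    ultimately obtain a b where ab: "a \<in> cube" "b \<in> cube" "a \<noteq> b" "x = midpoint a b" by blast
    then have "x \<in> open_segment a b" by simp
    then show False
      using x ab(1,2) unfolding vertices_def extreme_point_of_def by blast
  qed
  then show "x \<in> {x. \<forall>i. \<bar>x$i\<bar> = 1}" by blast
next
  fix x :: "real^3" assume "x \<in> {x. \<forall>i. \<bar>x$i\<bar> = 1}"
  then have x: "\<bar>x$1\<bar> = 1" "\<bar>x$2\<bar> = 1" "\<bar>x$3\<bar> = 1" by auto
  have le: "x$i * y$i \<le> 1" if "y \<in> cube" "\<bar>x$i\<bar> = 1" for y i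
  proof -
    have "\<bar>y$i\<bar> \<le> 1" using that(1) by (simp add: mem_cube)
    then show ?thesis using that(2) by (auto simp: abs_if split: if_splits)
  qed
  have le3: "x \<bullet> y \<le> 3" if "y \<in> cube" for y
    using le[OF that x(1)] le[OF that x(2)] le[OF that x(3)] by (simp add: inner3)
  have xx: "x$1 * x$1 = 1" "x$2 * x$2 = 1" "x$3 * x$3 = 1" using x by (auto simp: abs_if split: if_splits)
  have "cube \<inter> {y. x \<bullet> y = 3} = {x}"
  proof
    show "cube \<inter> {y. x \<bullet> y = 3} \<subseteq> {x}"
    proof
      fix y assume y: "y \<in> cube \<inter> {y. x \<bullet> y = 3}"
      then have yc: "y \<in> cube" by blast
      have "x$1 * y$1 = 1 \<and> x$2 * y$2 = 1 \<and> x$3 * y$3 = 1"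
        using y le[OF yc x(1)] le[OF yc x(2)] le[OF yc x(3)] by (simp add: inner3)
      moreover have "b = a" if "a * b = 1" "\<bar>a\<bar> = 1" for a b :: real
        using that by (auto simp: abs_if split: if_splits)
      ultimately have "y$1 = x$1 \<and> y$2 = x$2 \<and> y$3 = x$3" using x by simp
      then show "y \<in> {x}" by (simp add: vec3_eq)
    qed
    show "{x} \<subseteq> cube \<inter> {y. x \<bullet> y = 3}" using x xx by (auto simp: mem_cube inner3 forall_3)
  qed
  then show "x \<in> vertices cube"
    unfolding vertices_def using extreme_point_of_Int_supporting_hyperplane_le[of cube x 3 x] le3 by blast
qed

text \<open>Each point is exposed by one of the three coordinates.\<close>

lemma triangle_card:
  fixes a b c :: "real^3"
  assumes "a$2 < a$1" "a$3 < a$1" "b$1 < a$1" "c$1 < a$1" "a$2 < b$2" "c$2 < b$2" "a$3 < c$3" "b$3 < c$3"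
  shows "card (vertices (convex hull {a,b,c})) = 3"
proof -
  have "vertices (convex hull {a,b,c}) = {a,b,c}"
  proof (rule vertices_hull_eq)
    fix v assume "v \<in> {a,b,c}"
    moreover have "\<forall>w\<in>{a,b,c}. w \<noteq> a \<longrightarrow> axis 1 1 \<bullet> w < axis 1 1 \<bullet> a"
      "\<forall>w\<in>{a,b,c}. w \<noteq> b \<longrightarrow> axis 2 1 \<bullet> w < axis 2 1 \<bullet> b"
      "\<forall>w\<in>{a,b,c}. w \<noteq> c \<longrightarrow> axis 3 1 \<bullet> w < axis 3 1 \<bullet> c"
      using assms by (auto simp: inner_axis')
    ultimately show "\<exists>d. \<forall>w\<in>{a,b,c}. w \<noteq> v \<longrightarrow> d \<bullet> w < d \<bullet> v" by blast
  qed simp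
  moreover have "a \<noteq> b" "b \<noteq> c" "a \<noteq> c" using assms by auto
  ultimately show ?thesis by simp
qed

lemma perp_111: "x \<in> perp (1 :: real^3) \<longleftrightarrow> x$1 + x$2 + x$3 = 0"
  by (simp add: perp_def inner3)

text \<open>The plane separates the vertex (1,1,1), with coordinate sum 3, from the other three,
  with sum -1. So it cuts just the three edges at (1,1,1), each at weight 1/4 on that
  vertex.\<close>

lemma tetrahedron_triangle: "card (vertices (tetrahedron \<inter> perp 1)) = 3"
proof -
  let ?a = "vector [1,-1/2,-1/2] :: real^3" and ?b = "vector [-1/2,1,-1/2] :: real^3"
    and ?c = "vector [-1/2,-1/2,1] :: real^3"
  have "tetrahedron \<inter> perp 1 = convex hull {?a, ?b, ?c}"
  proof
    show "convex hull {?a, ?b, ?c} \<subseteq> tetrahedron \<inter> perp 1"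
      by (rule hull_minimal)
        (auto simp: mem_tetrahedron perp_111 intro!: convex_Int affine_imp_convex[OF affine_perp]
          origin_polytopeD(3)[OF origin_polytope_tetrahedron])
    show "tetrahedron \<inter> perp 1 \<subseteq> convex hull {?a, ?b, ?c}"
    proof
      fix x assume x: "x \<in> tetrahedron \<inter> perp 1"
      \<comment> \<open>Barycentric coordinates: a point with weights p, q, r has first coordinate p
        - (q + r)/2 = (3 p - 1)/2, and likewise for the others.\<close>
      let ?p = "(1 + 2 * x$1) / 3" and ?q = "(1 + 2 * x$2) / 3" and ?r = "(1 + 2 * x$3) / 3"
      have s: "x$3 = - x$1 - x$2" using x by (simp add: perp_111)
      have "0 \<le> ?p" "0 \<le> ?q" "0 \<le> ?r" "?p + ?q + ?r = 1"
        using x s by (auto simp: mem_tetrahedron field_simps)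
      moreover have "x = ?p *\<^sub>R ?a + ?q *\<^sub>R ?b + ?r *\<^sub>R ?c" using s by (simp add: vec3_eq field_simps)
      ultimately show "x \<in> convex hull {?a, ?b, ?c}" unfolding convex_hull_3 by blast
    qed
  qed
  then show ?thesis using triangle_card[of ?a ?b ?c] by simp
qed

text \<open>On this plane the three lower bounds -1 already imply the upper bounds 2, so only three
  of the six facet inequalities cut the slice.\<close>

lemma box_triangle: "card (vertices (cbox (vec (-1)) (vec 2) \<inter> perp (1 :: real^3))) = 3"
proof -
  let ?a = "vector [2,-1,-1] :: real^3" and ?b = "vector [-1,2,-1] :: real^3"
    and ?c = "vector [-1,-1,2] :: real^3"
  have "cbox (vec (-1)) (vec 2) \<inter> perp (1 :: real^3) = convex hull {?a, ?b, ?c}"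
  proof
    show "convex hull {?a, ?b, ?c} \<subseteq> cbox (vec (-1)) (vec 2) \<inter> perp (1 :: real^3)"
      by (rule hull_minimal)
        (auto simp: mem_box_cart forall_3 perp_111 intro!: convex_Int affine_imp_convex[OF affine_perp])
    show "cbox (vec (-1)) (vec 2) \<inter> perp (1 :: real^3) \<subseteq> convex hull {?a, ?b, ?c}"
    proof
      fix x assume x: "x \<in> cbox (vec (-1)) (vec 2) \<inter> perp (1 :: real^3)"
      let ?p = "(1 + x$1) / 3" and ?q = "(1 + x$2) / 3" and ?r = "(1 + x$3) / 3"
      have s: "x$3 = - x$1 - x$2" using x by (simp add: perp_111)
      have "0 \<le> ?p" "0 \<le> ?q" "0 \<le> ?r" "?p + ?q + ?r = 1"
        using x s by (auto simp: mem_box_cart forall_3 field_simps)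
      moreover have "x = ?p *\<^sub>R ?a + ?q *\<^sub>R ?b + ?r *\<^sub>R ?c" using s by (simp add: vec3_eq field_simps)
      ultimately show "x \<in> convex hull {?a, ?b, ?c}" unfolding convex_hull_3 by blast
    qed
  qed
  then show ?thesis using triangle_card[of ?a ?b ?c] by simp
qed

lemma one_vec_nonzero: "(1 :: real^3) \<noteq> 0"
  by (simp add: vec3_eq)

lemma cube_symmetric: "x \<in> cube \<Longrightarrow> - x \<in> cube"
  by (simp add: mem_cube)

text \<open>The tetrahedron takes one vertex from each antipodal pair of vertices of the cube, and
  unsigned hyperplanes do not see the difference.\<close>

lemma same_arrangement_cube_tetrahedron: "same_arrangement cube tetrahedron"
  unfolding same_arrangement_def arrangement_def vertices_tetrahedron
proof
  have "v \<in> tetrahedron_vertices \<or> - v \<in> tetrahedron_vertices" if "v \<in> vertices cube" for v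
    using that unfolding vertices_cube tetrahedron_vertices_def by (auto simp: vec3_eq forall_3 abs_if split: if_splits)
  moreover have "perp (- v) = perp v" for v :: "real^3" by (simp add: perp_def)
  ultimately show "{perp v |v. v \<in> vertices cube} \<subseteq> {perp v |v. v \<in> tetrahedron_vertices}"
    by (smt (verit) mem_Collect_eq subsetI)
  have "tetrahedron_vertices \<subseteq> vertices cube"
    by (auto simp: tetrahedron_vertices_def vertices_cube forall_3)
  then show "{perp v |v. v \<in> tetrahedron_vertices} \<subseteq> {perp v |v. v \<in> vertices cube}" by blast
qed

lemma example_arrangement_not_setwise:
  "\<exists>P Q :: (real^3) set. origin_polytope P \<and> origin_polytope Q \<and> same_arrangement P Q \<and> \<not> setwise_slice_equiv P Q"
  using not_setwise_if_triangle(1)[OF origin_polytopeD(1)[OF origin_polytope_cube] cube_symmetric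
      origin_polytopeD(1)[OF origin_polytope_tetrahedron] one_vec_nonzero tetrahedron_triangle]
    origin_polytope_cube origin_polytope_tetrahedron same_arrangement_cube_tetrahedron by blast

lemma cube_equiv_box: "cube \<simeq> cbox (vec (-1)) (vec 2)"
proof -
  have "(+) (vec (1/2)) ` (\<lambda>x. (3/2) *\<^sub>R x) ` cube = cbox (vec (-1)) (vec 2)"
  proof
    show "(+) (vec (1/2)) ` (\<lambda>x. (3/2) *\<^sub>R x) ` cube \<subseteq> cbox (vec (-1)) (vec 2)"
      by (auto simp: cube_def mem_box_cart forall_3)
    show "cbox (vec (-1)) (vec 2) \<subseteq> (+) (vec (1/2)) ` (\<lambda>x. (3/2) *\<^sub>R x) ` cube"
    proof
      fix x :: "real^3" assume "x \<in> cbox (vec (-1)) (vec 2)"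
      then have "(2/3) *\<^sub>R (x - vec (1/2)) \<in> cube" by (simp add: cube_def mem_box_cart forall_3)
      then show "x \<in> (+) (vec (1/2)) ` (\<lambda>x. (3/2) *\<^sub>R x) ` cube"
        by (intro image_eqI[of _ _ "x - vec (1/2)"] image_eqI[of _ _ "(2/3) *\<^sub>R (x - vec (1/2))"]) simp_all
    qed
  qed
  moreover have "cube \<simeq> (\<lambda>x. (3/2) *\<^sub>R x) ` cube"
    unfolding comb_equiv_def by (rule exI, rule linear_image_iso) (auto intro!: injI linear_scaleR)
  moreover have "(\<lambda>x. (3/2) *\<^sub>R x) ` cube \<simeq> (+) (vec (1/2)) ` (\<lambda>x. (3/2) *\<^sub>R x) ` cube"
    unfolding comb_equiv_def using translation_iso by blast
  ultimately show ?thesis using comb_equiv_trans by metis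
qed

lemma example_equiv_not_setwise:
  "\<exists>P Q :: (real^3) set. origin_polytope P \<and> origin_polytope Q \<and> P \<simeq> Q \<and> \<not> setwise_slice_equiv P Q"
proof -
  have "origin_polytope (cbox (vec (-1)) (vec 2) :: (real^3) set)" by (rule origin_polytope_cbox_vec) auto
  then show ?thesis
    using not_setwise_if_triangle(1)[OF origin_polytopeD(1)[OF origin_polytope_cube] cube_symmetric
        polytope_interval one_vec_nonzero box_triangle] origin_polytope_cube cube_equiv_box by blast
qed

lemma example_OM_not_arrangement:
  "\<exists>P Q :: (real^3) set. origin_polytope P \<and> origin_polytope Q \<and> equiv_inducing_OM P Q \<and> \<not> same_arrangement P Q"
proof -
  define f :: "real^3 \<Rightarrow> real^3" where "f x = vector [2 * x$1, x$2, x$3]" for x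
  define g :: "real^3 \<Rightarrow> real^3" where "g x = vector [x$1 / 2, x$2, x$3]" for x
  have fg: "f (g x) = x" "g (f x) = x" for x by (simp_all add: f_def g_def vec3_eq)
  have lin: "linear f" by (rule linearI) (simp_all add: f_def vec3_eq algebra_simps)
  have inj: "inj f" using fg(2) by (metis injI)
  \<comment> \<open>\<open>f\<close> is self-adjoint, so the covector of \<open>u\<close> on the
    image is the covector of \<open>f u\<close> on the tetrahedron. As \<open>f\<close> is onto,
    both sets of covectors coincide.\<close>
  have adj: "u \<bullet> f v = f u \<bullet> v" for u v by (simp add: f_def inner3)
  let ?Q = "f ` tetrahedron"
  have iso: "face_lattice_iso ((`) f) tetrahedron ?Q" by (rule linear_image_iso[OF lin inj])
  have pQ: "polytope ?Q" by (rule polytope_linear_image[OF lin origin_polytopeD(1)[OF origin_polytope_tetrahedron]])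
  have "interior ?Q = f ` interior tetrahedron" by (rule interior_injective_linear_image[OF lin inj])
  then have Q: "origin_polytope ?Q"
    using pQ origin_polytopeD(2)[OF origin_polytope_tetrahedron] linear_0[OF lin]
    by (intro origin_polytopeI) (auto intro: image_eqI[of _ _ 0])
  have vm: "vertex_map ((`) f) v = f v" for v by (simp add: vertex_map_def)
  obtain vs where vs: "set vs = vertices tetrahedron" "distinct vs"
    using finite_distinct_list origin_polytopeD(4)[OF origin_polytope_tetrahedron] by metis
  define h where "h u = map (\<lambda>v. sgn (u \<bullet> v)) vs" for u :: "real^3"
  have "surj f" using fg(1) by (metis surjI)
  then have "range h = h ` range f" by simp
  also have "\<dots> = range (\<lambda>u. h (f u))" by (rule image_image)
  finally have rh: "range h = range (\<lambda>u. h (f u))" .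
  have "signed_covectors vs = range h" "signed_covectors (map f vs) = range (\<lambda>u. h (f u))"
    by (auto simp: signed_covectors_def h_def adj o_def)
  then have sc: "signed_covectors vs = signed_covectors (map f vs)" using rh by simp
  have "vertex_map ((`) f) = f" using vm by blast
  then have "equiv_inducing_OM tetrahedron ?Q"
    unfolding equiv_inducing_OM_def using iso vs sc by metis
  moreover have "\<not> same_arrangement tetrahedron ?Q"
  proof
    let ?v = "vector [1,1,1] :: real^3"
    assume "same_arrangement tetrahedron ?Q"
    moreover have "f ?v \<in> vertices ?Q"
      using vertex_map(2)[OF iso pQ, of ?v] vm by (simp add: vertices_tetrahedron tetrahedron_vertices_def)
    ultimately obtain v where v: "v \<in> tetrahedron_vertices" "perp (f ?v) = perp v"
      unfolding same_arrangement_def arrangement_def vertices_tetrahedron by blast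
    \<comment> \<open>Orthogonal to the stretched vertex (2,1,1); its products with the vertices of
      the tetrahedron are -1, 3, -3 and 1.\<close>
    have "vector [1,-2,0] \<in> perp (f ?v)" by (simp add: perp_def inner3 f_def)
    then have "vector [1,-2,0] \<in> perp v" using v(2) by simp
    then show False using v(1) by (auto simp: perp_def inner3 tetrahedron_vertices_def)
  qed
  ultimately show ?thesis using Q origin_polytope_tetrahedron by blast
qed

subsection \<open>Polygons\<close>

text \<open>For points in the plane orthogonal to \<open>u\<close> this is twice the signed area of
  the triangle, scaled by the norm of \<open>u\<close>.\<close>

definition orient :: "real^3 \<Rightarrow> real^3 \<Rightarrow> real^3 \<Rightarrow> real^3 \<Rightarrow> real" where
  "orient u a b c = u \<bullet> cross3 (b - a) (c - a)"

lemma orient_rotate: "orient u b c a = orient u a b c"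
  by (simp add: orient_def cross3_simps)

lemma orient_swap: "orient u a c b = - orient u a b c"
  by (simp add: orient_def cross3_simps)

lemma orient_affine: "orient u a b x = cross3 u (b - a) \<bullet> x - cross3 u (b - a) \<bullet> a"
  by (simp add: orient_def cross3_simps)

lemma orient_degenerate: "orient u a b a = 0" "orient u a b b = 0"
  by (simp_all add: orient_def cross3_simps)

text \<open>The two triangulations of a quadrilateral have the same total signed area.\<close>

lemma orient_sum: "orient u b c d + orient u a b d = orient u a c d + orient u a b c"
  by (simp add: orient_def cross3_simps)

text \<open>The affine dependence of four coplanar points, with signed areas as coefficients; by
  \<open>orient_sum\<close> both sides have the same total weight. When all areas are positive it
  says that the diagonals \<open>a c\<close> and \<open>b d\<close> cross.\<close>

lemma orient_plane_relation:
  assumes u: "u \<noteq> 0" and m: "a \<in> perp u" "b \<in> perp u" "c \<in> perp u" "d \<in> perp u"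
  shows "orient u b c d *\<^sub>R a + orient u a b d *\<^sub>R c = orient u a c d *\<^sub>R b + orient u a b c *\<^sub>R d"
proof -
  \<comment> \<open>Cramer's rule in space. For three vectors orthogonal to \<open>u\<close>, taking
    the product with \<open>u\<close> first shows that their triple product is zero, and the
    right-hand side is then the wanted dependence.\<close>
  have *: "(x \<bullet> cross3 y z) *\<^sub>R u = (u \<bullet> cross3 y z) *\<^sub>R x + (u \<bullet> cross3 z x) *\<^sub>R y + (u \<bullet> cross3 x y) *\<^sub>R z"
    for x y z :: "real^3"
    by (simp add: vec3_eq cross3_def inner3 algebra_simps)
  define x y z where "x = b - a" and "y = c - a" and "z = d - a"
  have p: "u \<bullet> x = 0" "u \<bullet> y = 0" "u \<bullet> z = 0"
    using m by (auto simp: x_def y_def z_def perp_def inner_diff_right)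
  have "(x \<bullet> cross3 y z) * (u \<bullet> u) = u \<bullet> ((x \<bullet> cross3 y z) *\<^sub>R u)" by simp
  also have "\<dots> = 0" by (subst *) (simp add: inner_add_right p)
  finally have "x \<bullet> cross3 y z = 0" using u by simp
  then have 0: "(u \<bullet> cross3 y z) *\<^sub>R x + (u \<bullet> cross3 z x) *\<^sub>R y + (u \<bullet> cross3 x y) *\<^sub>R z = 0"
    using *[of x y z] by simp
  have o: "orient u a c d = u \<bullet> cross3 y z" "orient u a b d = - (u \<bullet> cross3 z x)" "orient u a b c = u \<bullet> cross3 x y"
    by (simp_all add: orient_def x_def y_def z_def cross_skew[of "d - a" "b - a"])
  have bcd: "orient u b c d = orient u a c d - orient u a b d + orient u a b c"
    using orient_sum[of u b c d a] by simp
  have "orient u a c d *\<^sub>R x - orient u a b d *\<^sub>R y + orient u a b c *\<^sub>R z = 0" using 0 o by simp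
  then show ?thesis unfolding bcd x_def y_def z_def by (simp add: algebra_simps)
qed

text \<open>The cross product \<open>?w\<close> of two vectors orthogonal to \<open>u\<close> is
  parallel to \<open>u\<close>; by hypothesis it is also orthogonal to \<open>u\<close>, hence
  zero.\<close>

lemma orient_zero_collinear:
  assumes u: "u \<noteq> 0" and m: "a \<in> perp u" "b \<in> perp u" "c \<in> perp u" and 0: "orient u a b c = 0"
  shows "collinear {a, b, c}"
proof -
  let ?x = "b - a" and ?y = "c - a"
  let ?w = "cross3 ?x ?y"
  have p: "u \<bullet> ?x = 0" "u \<bullet> ?y = 0" using m by (auto simp: perp_def inner_diff_right)
  have "cross3 u ?w = (u \<bullet> ?y) *\<^sub>R ?x - (u \<bullet> ?x) *\<^sub>R ?y"
    by (simp add: vec3_eq cross3_def inner3 algebra_simps)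
  then have "cross3 u ?w = 0" using p by simp
  then have "(norm u * norm ?w)\<^sup>2 = 0"
    using norm_cross_dot[of u ?w] 0 by (simp add: orient_def)
  then have "cross3 ?x ?y = 0" using u by simp
  then have "collinear {0, b - a, c - a}" by (simp add: cross_eq_0)
  then have "collinear {b, a, c}" by (subst collinear_3) (simp add: insert_commute)
  then show ?thesis by (simp add: insert_commute)
qed

text \<open>Removing the vertex \<open>y\<close> leaves a convex set, which then contains the hull
  of the other three points. The weights are not normalized so that area relations can be inserted
  directly.\<close>

lemma vertex_not_in_triangle:
  fixes K :: "'a::euclidean_space set"
  assumes K: "convex K" and y: "y \<in> vertices K" and m: "x \<in> K" "z \<in> K" "p \<in> K" "x \<noteq> y" "z \<noteq> y" "p \<noteq> y"
    and c: "\<alpha> *\<^sub>R y = \<beta> *\<^sub>R x + \<gamma> *\<^sub>R z + \<delta> *\<^sub>R p" "\<alpha> = \<beta> + \<gamma> + \<delta>" "0 \<le> \<beta>" "0 \<le> \<gamma>" "0 \<le> \<delta>" "0 < \<alpha>"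
  shows False
proof -
  have cv: "convex (K - {y})"
    using y extreme_point_of_stillconvex[OF K] unfolding vertices_def by blast
  have "y = (1 / \<alpha>) *\<^sub>R (\<alpha> *\<^sub>R y)" using c(6) by simp
  also have "\<dots> = (\<beta> / \<alpha>) *\<^sub>R x + (\<gamma> / \<alpha>) *\<^sub>R z + (\<delta> / \<alpha>) *\<^sub>R p"
    unfolding c(1) by (simp add: scaleR_add_right)
  finally have e: "y = (\<beta> / \<alpha>) *\<^sub>R x + (\<gamma> / \<alpha>) *\<^sub>R z + (\<delta> / \<alpha>) *\<^sub>R p" .
  have s: "\<beta> / \<alpha> + \<gamma> / \<alpha> + \<delta> / \<alpha> = 1"
    using c(2,6) by (metis add_divide_distrib divide_self less_irrefl)
  have "y \<in> convex hull {x, z, p}"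
    unfolding convex_hull_3 using e s c(3-6) by (intro CollectI exI conjI) (auto intro: divide_nonneg_pos)
  moreover have "convex hull {x, z, p} \<subseteq> K - {y}"
    by (rule hull_minimal) (use m cv in auto)
  ultimately show False by blast
qed

section \<open>Cyclic order of the vertices of a polygon\<close>

lemma orient_vertices_nonzero:
  assumes u: "u \<noteq> 0" and K: "K \<subseteq> perp u" and m: "a \<in> vertices K" "b \<in> vertices K" "c \<in> vertices K"
    and ne: "a \<noteq> b" "b \<noteq> c" "a \<noteq> c"
  shows "orient u a b c \<noteq> 0"
proof
  assume "orient u a b c = 0"
  moreover have i: "a \<in> K" "b \<in> K" "c \<in> K" using m vertices_in by blast+
  ultimately have "collinear {a, b, c}" using orient_zero_collinear[OF u] K by blast
  then have "a \<in> open_segment b c \<or> b \<in> open_segment c a \<or> c \<in> open_segment a b"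
    using ne by (auto simp: collinear_between_cases between_mem_segment open_segment_def)
  then show False using m i unfolding vertices_def extreme_point_of_def by blast
qed

text \<open>Counting predecessors is strictly monotone, hence a bijection onto an initial segment;
  \<open>v\<close> is its inverse.\<close>

lemma strict_order_enumeration:
  assumes W: "finite W" and tr: "\<And>x y z. x \<in> W \<Longrightarrow> y \<in> W \<Longrightarrow> z \<in> W \<Longrightarrow> R x y \<Longrightarrow> R y z \<Longrightarrow> R x z"
    and irr: "\<And>x. x \<in> W \<Longrightarrow> \<not> R x x" and tot: "\<And>x y. x \<in> W \<Longrightarrow> y \<in> W \<Longrightarrow> x \<noteq> y \<Longrightarrow> R x y \<or> R y x"
  shows "\<exists>v. bij_betw v {..<card W} W \<and> (\<forall>i j. i < j \<longrightarrow> j < card W \<longrightarrow> R (v i) (v j))"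
proof -
  define r where "r x = card {y\<in>W. R y x}" for x
  have mono: "r x < r y" if "x \<in> W" "y \<in> W" "R x y" for x y
    unfolding r_def
  proof (rule psubset_card_mono)
    have "x \<in> {z\<in>W. R z y}" "x \<notin> {z\<in>W. R z x}" using that irr by auto
    moreover have "{z\<in>W. R z x} \<subseteq> {z\<in>W. R z y}" using tr that by blast
    ultimately show "{z\<in>W. R z x} \<subset> {z\<in>W. R z y}" by blast
  qed (use W in simp)
  have inj: "inj_on r W"
  proof (rule inj_onI)
    fix x y assume "x \<in> W" "y \<in> W" "r x = r y"
    then show "x = y" using tot[of x y] mono[of x y] mono[of y x] by fastforce
  qed
  have "r x < card W" if "x \<in> W" for x
    unfolding r_def by (rule psubset_card_mono[OF W]) (use that irr in blast)
  then have "r ` W \<subseteq> {..<card W}" by blast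
  then have "r ` W = {..<card W}"
    by (rule card_subset_eq[rotated]) (simp_all add: card_image[OF inj])
  with inj have b: "bij_betw r W {..<card W}" by (simp add: bij_betw_def)
  let ?v = "inv_into W r"
  have bv: "bij_betw ?v {..<card W} W" by (rule bij_betw_inv_into[OF b])
  have "R (?v i) (?v j)" if "i < j" "j < card W" for i j
  proof -
    have m: "?v i \<in> W" "?v j \<in> W" using bv that by (auto simp: bij_betw_def)
    have e: "r (?v i) = i" "r (?v j) = j" using b that by (auto simp: bij_betw_def f_inv_into_f)
    have "?v i \<noteq> ?v j"
    proof
      assume "?v i = ?v j"
      then have "r (?v i) = r (?v j)" by (rule arg_cong)
      then show False using e that by simp
    qed
    then show ?thesis using tot[OF m] mono[OF m(2,1)] e that by auto
  qed
  with bv show ?thesis by blast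
qed

text \<open>The vertices other than a fixed vertex \<open>p\<close> are sorted by angle as seen from
  \<open>p\<close>. This is a linear order because \<open>p\<close> is a vertex; \<open>p\<close>
  itself receives index 0.\<close>

lemma polygon_enumeration:
  assumes u: "u \<noteq> 0" and K: "K \<subseteq> perp u" "polytope K" and n: "card (vertices K) = n" "3 \<le> n"
  shows "\<exists>v. bij_betw v {..<n} (vertices K) \<and>
    (\<forall>i j k. i < j \<longrightarrow> j < k \<longrightarrow> k < n \<longrightarrow> 0 < orient u (v i) (v j) (v k))"
proof -
  let ?V = "vertices K"
  have fin: "finite ?V" by (rule finite_vertices[OF K(2)])
  have cK: "convex K" using K(2) by (rule polytope_imp_convex)
  have inK: "x \<in> K" "x \<in> perp u" if "x \<in> ?V" for x using that vertices_in K(1) by blast+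
  obtain p where p: "p \<in> ?V" using n by fastforce
  let ?W = "?V - {p}"
  let ?R = "\<lambda>x y. 0 < orient u p x y"
  have nz: "orient u a b c \<noteq> 0" if "a \<in> ?V" "b \<in> ?V" "c \<in> ?V" "a \<noteq> b" "b \<noteq> c" "a \<noteq> c" for a b c
    by (rule orient_vertices_nonzero[OF u K(1) that])
  have tr: "?R x z" if x: "x \<in> ?W" and y: "y \<in> ?W" and z: "z \<in> ?W" and xy: "?R x y" and yz: "?R y z" for x y z
  proof (rule ccontr)
    assume neg: "\<not> ?R x z"
    have "orient u x y z *\<^sub>R p + orient u p x z *\<^sub>R y = orient u p y z *\<^sub>R x + orient u p x y *\<^sub>R z"
      by (rule orient_plane_relation[OF u]) (use inK p x y z in auto)
    \<comment> \<open>If transitivity failed, all weights on the right would be nonnegative and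
      \<open>p\<close> would lie in the triangle of \<open>x\<close>, \<open>y\<close> and
      \<open>z\<close>.\<close>
    then have e: "orient u x y z *\<^sub>R p = orient u p y z *\<^sub>R x + (- orient u p x z) *\<^sub>R y + orient u p x y *\<^sub>R z"
      by (simp add: algebra_simps)
    have s: "orient u x y z = orient u p y z + (- orient u p x z) + orient u p x y"
      using orient_sum[of u x y z p] by simp
    show False
      by (rule vertex_not_in_triangle[OF cK p _ _ _ _ _ _ e s]) (use inK x y z xy yz neg s in auto)
  qed
  have irr: "\<not> ?R x x" for x by (simp add: orient_degenerate)
  have tot: "?R x y \<or> ?R y x" if "x \<in> ?W" "y \<in> ?W" "x \<noteq> y" for x y
    using nz[of p x y] that p orient_swap[of u p x y] by force
  have cW: "card ?W = n - 1" using n p fin by simp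
  have "\<exists>w. bij_betw w {..<card ?W} ?W \<and> (\<forall>i j. i < j \<longrightarrow> j < card ?W \<longrightarrow> ?R (w i) (w j))"
  proof (rule strict_order_enumeration)
    show "finite ?W" using fin by simp
    show "\<And>x y z. x \<in> ?W \<Longrightarrow> y \<in> ?W \<Longrightarrow> z \<in> ?W \<Longrightarrow> ?R x y \<Longrightarrow> ?R y z \<Longrightarrow> ?R x z" by (rule tr)
    show "\<And>x. x \<in> ?W \<Longrightarrow> \<not> ?R x x" by (rule irr)
    show "\<And>x y. x \<in> ?W \<Longrightarrow> y \<in> ?W \<Longrightarrow> x \<noteq> y \<Longrightarrow> ?R x y \<or> ?R y x" by (rule tot)
  qed
  then obtain w where w: "bij_betw w {..<n - 1} ?W" "\<And>i j. i < j \<Longrightarrow> j < n - 1 \<Longrightarrow> ?R (w i) (w j)"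
    unfolding cW by blast
  define v where "v i = (case i of 0 \<Rightarrow> p | Suc j \<Rightarrow> w j)" for i
  have v0: "v 0 = p" and vS: "v (Suc j) = w j" for j by (simp_all add: v_def)
  have n1: "n = Suc (n - 1)" using n by simp
  have im: "v ` {..<n} = ?V"
    by (subst n1, subst lessThan_Suc_eq_insert_0) (use w(1) p in \<open>auto simp: bij_betw_def v0 vS image_image\<close>)
  have "inj_on v {..<n}"
    by (rule eq_card_imp_inj_on) (simp_all add: im n)
  with im have bv: "bij_betw v {..<n} ?V" by (simp add: bij_betw_def)
  have vV: "v i \<in> ?V" if "i < n" for i using im that by blast
  have vne: "v i \<noteq> v j" if "i < n" "j < n" "i \<noteq> j" for i j
    using bv that by (auto simp: bij_betw_def inj_on_def)
  have vo: "0 < orient u p (v i) (v j)" if "0 < i" "i < j" "j < n" for i j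
    using that w(2)[of "i - 1" "j - 1"] vS[of "i - 1"] vS[of "j - 1"] by simp
  have "0 < orient u (v i) (v j) (v k)" if ijk: "i < j" "j < k" "k < n" for i j k
  proof (cases "i = 0")
    case True
    then show ?thesis using vo[of j k] ijk v0 by simp
  next
    case False
    show ?thesis
    proof (rule ccontr)
      assume neg: "\<not> ?thesis"
      let ?x = "v i" and ?y = "v j" and ?z = "v k"
      have xV: "?x \<in> ?V" "?y \<in> ?V" "?z \<in> ?V" using vV ijk by auto
      have ne: "?x \<noteq> ?y" "?z \<noteq> ?y" "p \<noteq> ?y" using vne[of i j] vne[of k j] vne[of 0 j] v0 ijk by auto
      have pos: "0 < orient u p ?x ?y" "0 < orient u p ?y ?z" "0 < orient u p ?x ?z"
        using vo[of i j] vo[of j k] vo[of i k] ijk False by auto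
      have "orient u ?x ?y ?z *\<^sub>R p + orient u p ?x ?z *\<^sub>R ?y = orient u p ?y ?z *\<^sub>R ?x + orient u p ?x ?y *\<^sub>R ?z"
        by (rule orient_plane_relation[OF u]) (use inK p xV in auto)
      \<comment> \<open>If the triple were not positively oriented, the middle vertex
        \<open>?y\<close> would lie in the triangle of \<open>?x\<close>, \<open>?z\<close> and
        \<open>p\<close>.\<close>
      then have e: "orient u p ?x ?z *\<^sub>R ?y = orient u p ?y ?z *\<^sub>R ?x + orient u p ?x ?y *\<^sub>R ?z + (- orient u ?x ?y ?z) *\<^sub>R p"
        by (simp add: algebra_simps)
      have s: "orient u p ?x ?z = orient u p ?y ?z + orient u p ?x ?y + (- orient u ?x ?y ?z)"
        using orient_sum[of u ?x ?y ?z p] by simp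
      show False
        by (rule vertex_not_in_triangle[OF cK xV(2) _ _ _ ne e s]) (use inK xV p pos neg in auto)
    qed
  qed
  with bv show ?thesis by blast
qed

text \<open>A coordinate-free model of the face lattice of an n-gon, to which both slices are
  compared. The reduction modulo \<open>n\<close> supplies the side that closes the cycle.\<close>

definition polygon_sides :: "nat \<Rightarrow> nat set set" where
  "polygon_sides n = {{}, {..<n}} \<union> {{i} | i. i < n} \<union> {{i, Suc i mod n} | i. i < n}"

text \<open>\<open>cross\<close> reflects that a face containing both ends of one diagonal contains
  its crossing point with another, hence both ends of that one. A nonadjacent pair in
  \<open>S\<close> therefore forces all indices into \<open>S\<close>; if all pairs are adjacent,
  \<open>S\<close> has at most two elements unless n = 3.\<close>

lemma polygon_sidesI:
  assumes n: "3 \<le> n" and S: "S \<subseteq> {..<n}"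
    and cross: "\<And>a b c d. a < b \<Longrightarrow> b < c \<Longrightarrow> c < d \<Longrightarrow> d < n \<Longrightarrow> (a \<in> S \<and> c \<in> S \<longleftrightarrow> b \<in> S \<and> d \<in> S)"
  shows "S \<in> polygon_sides n"
proof (cases "\<exists>i j. i \<in> S \<and> j \<in> S \<and> i < j \<and> j \<noteq> Suc i \<and> \<not> (i = 0 \<and> j = n - 1)")
  case True
  then obtain i j where ij: "i \<in> S" "j \<in> S" "i < j" "j \<noteq> Suc i" "\<not> (i = 0 \<and> j = n - 1)" by blast
  have jn: "j < n" using ij S by auto
  \<comment> \<open>The chord from \<open>i\<close> to \<open>j\<close> separates \<open>k\<close>
    from \<open>l\<close>, so the two chords cross.\<close>
  have inner: "k \<in> S \<and> l \<in> S" if "i < k" "k < j" "l < i \<or> j < l" "l < n" for k l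
    using that cross[of l i k j] cross[of i k j l] ij jn by auto
  have k: "i < Suc i" "Suc i < j" using ij by auto
  have "\<exists>l<n. l < i \<or> j < l"
  proof (cases "i = 0")
    case True
    then have "j < n - 1" using ij jn by auto
    then show ?thesis by (intro exI[of _ "n - 1"]) auto
  next
    case False
    then show ?thesis using n by (intro exI[of _ 0]) auto
  qed
  then obtain l where l: "l < n" "l < i \<or> j < l" by blast
  have "m \<in> S" if "m < n" for m
  proof -
    consider "m = i" | "m = j" | "i < m" "m < j" | "m < i \<or> j < m" by linarith
    then show ?thesis using ij inner[of m l] inner[of "Suc i" m] k l that by cases auto
  qed
  then have "S = {..<n}" using S by auto
  then show ?thesis by (simp add: polygon_sides_def)
next
  case False
  then have adj: "j = Suc i \<or> (i = 0 \<and> j = n - 1)" if "i \<in> S" "j \<in> S" "i < j" for i j using that by blast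
  show ?thesis
  proof (cases "\<exists>i j. i \<in> S \<and> j \<in> S \<and> i < j")
    case True
    then obtain i j where ij: "i \<in> S" "j \<in> S" "i < j" by blast
    have jn: "j < n" using ij S by auto
    show ?thesis
    proof (cases "S = {i, j}")
      case True
      have "Suc i mod n = j \<or> i = Suc j mod n"
        using adj[OF ij] jn n by auto
      then show ?thesis using True ij(3) jn unfolding polygon_sides_def
        by (smt (verit, best) UnCI insert_commute less_trans mem_Collect_eq)
    next
      case False
      then obtain k where k: "k \<in> S" "k \<noteq> i" "k \<noteq> j" using ij by blast
      have kn: "k < n" using k S by auto
      \<comment> \<open>Three pairwise adjacent indices on a cycle exist only in a triangle.\<close>
      have three: "n = 3" if "a \<in> S" "b \<in> S" "c \<in> S" "a < b" "b < c" for a b c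
        using adj[of a b] adj[of b c] adj[of a c] that S n by auto
      have "n = 3" using three[of i j k] three[of i k j] three[of k i j] ij k by linarith
      then have "{i, j, k} = {..<n}"
        using ij(3) k jn kn by (intro card_subset_eq) auto
      moreover have "{i, j, k} \<subseteq> S" using ij k by simp
      ultimately have "S = {..<n}" using S by (metis subset_antisym)
      then show ?thesis by (simp add: polygon_sides_def)
    qed
  next
    case False
    then have "S = {} \<or> (\<exists>i. S = {i})" by (metis is_singletonI' is_singleton_the_elem linorder_neqE_nat)
    then show ?thesis using S by (auto simp: polygon_sides_def)
  qed
qed

lemma polygon_face_lattice:
  assumes u: "u \<noteq> 0" and K: "K \<subseteq> perp u" "polytope K" and n: "3 \<le> n"
    and v: "bij_betw v {..<n} (vertices K)"
    and o: "\<And>i j k. i < j \<Longrightarrow> j < k \<Longrightarrow> k < n \<Longrightarrow> 0 < orient u (v i) (v j) (v k)"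
  shows "bij_betw (\<lambda>S. convex hull (v ` S)) (polygon_sides n) (face_lattice K)"
    and "\<And>S T. S \<in> polygon_sides n \<Longrightarrow> T \<in> polygon_sides n \<Longrightarrow>
      convex hull (v ` S) \<subseteq> convex hull (v ` T) \<longleftrightarrow> S \<subseteq> T"
proof -
  let ?h = "\<lambda>S. convex hull (v ` S)"
  have im: "v ` {..<n} = vertices K" and inj: "inj_on v {..<n}" using v by (auto simp: bij_betw_def)
  have hK: "K = convex hull (v ` {..<n})" unfolding im by (rule polytope_hull_vertices[OF K(2)])
  have cK: "convex K" using K(2) by (rule polytope_imp_convex)
  have sub: "S \<subseteq> {..<n}" if "S \<in> polygon_sides n" for S
    using that n by (auto simp: polygon_sides_def)
  have vV: "v i \<in> vertices K" if "i < n" for i using im that by blast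
  have mem: "v i \<in> ?h T \<longleftrightarrow> i \<in> T" if i: "i < n" and T: "T \<subseteq> {..<n}" for i T
  proof
    assume l: "v i \<in> ?h T"
    show "i \<in> T"
    proof (rule ccontr)
      assume "i \<notin> T"
      then have "v ` T \<subseteq> K - {v i}"
        using T i inj im vertices_in by (force simp: inj_on_def)
      moreover have "convex (K - {v i})"
        using vV[OF i] extreme_point_of_stillconvex[OF cK] unfolding vertices_def by blast
      ultimately have "?h T \<subseteq> K - {v i}" by (rule hull_minimal)
      then show False using l by blast
    qed
  qed (simp add: hull_inc)
  have ord: "?h S \<subseteq> ?h T \<longleftrightarrow> S \<subseteq> T" if S: "S \<subseteq> {..<n}" and T: "T \<subseteq> {..<n}" for S T
  proof
    assume "?h S \<subseteq> ?h T"
    then show "S \<subseteq> T" using mem[OF _ T] mem[OF _ S] S by blast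
  qed (intro hull_mono image_mono)
  then show "\<And>S T. S \<in> polygon_sides n \<Longrightarrow> T \<in> polygon_sides n \<Longrightarrow> ?h S \<subseteq> ?h T \<longleftrightarrow> S \<subseteq> T"
    using sub by simp
  have side: "?h {i, Suc i mod n} face_of K" if i: "i < n" for i
  proof -
    let ?j = "Suc i mod n"
    let ?c = "cross3 u (v ?j - v i)"
    \<comment> \<open>All other vertices lie to the left of the directed side. Rotating the
      arguments puts the indices into increasing order, also for the side that closes the
      cycle.\<close>
    have pos: "0 < orient u (v i) (v ?j) (v k)" if k: "k < n" "k \<noteq> i" "k \<noteq> ?j" for k
    proof (cases "Suc i < n")
      case True
      then have j: "?j = Suc i" by simp
      show ?thesis
      proof (cases "k < i")
        case True
        then have "0 < orient u (v k) (v i) (v (Suc i))" using o[of k i "Suc i"] \<open>Suc i < n\<close> by simp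
        then show ?thesis unfolding j by (simp only: orient_rotate[of u "v i" "v (Suc i)" "v k"])
      next
        case False
        then show ?thesis using o[of i "Suc i" k] k j by simp
      qed
    next
      case False
      then have "Suc i = n" using i by simp
      then have "?j = 0" by simp
      then have "0 < orient u (v 0) (v k) (v i)" using o[of 0 k i] k i \<open>Suc i = n\<close> by simp
      then show ?thesis
        unfolding \<open>?j = 0\<close> using orient_rotate[of u "v i" "v 0" "v k"] orient_rotate[of u "v k" "v i" "v 0"] by simp
    qed
    have "convex hull (v ` {i, ?j}) face_of convex hull (v ` {..<n})"
    proof (rule exposed_hull_face[where c = "- ?c" and m = "- (?c \<bullet> v i)"])
      show "v ` {i, ?j} \<subseteq> v ` {..<n}" using i n by auto
      show "- ?c \<bullet> t = - (?c \<bullet> v i)" if "t \<in> v ` {i, ?j}" for t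
        using that orient_affine[of u "v i" "v ?j" "v ?j"] by (auto simp: orient_degenerate)
      show "- ?c \<bullet> s < - (?c \<bullet> v i)" if s: "s \<in> v ` {..<n} - v ` {i, ?j}" for s
      proof -
        obtain k where k: "k < n" "s = v k" using s by auto
        moreover have "k \<noteq> i" "k \<noteq> ?j" using s k by auto
        ultimately show ?thesis using pos[of k] orient_affine[of u "v i" "v ?j" s] by simp
      qed
    qed simp
    then show ?thesis using hK by simp
  qed
  \<comment> \<open>After division by the total weight, the relation describes a point of
    \<open>F\<close> inside the open segment from \<open>w1\<close> to \<open>w2\<close>; the
    definition of a face then gives both ends.\<close>
  have crossing: "w1 \<in> F \<and> w2 \<in> F"
    if F: "F face_of K" and m: "x1 \<in> F" "x2 \<in> F" "w1 \<in> K" "w2 \<in> K" "w1 \<noteq> w2"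
      and e: "\<alpha> *\<^sub>R x1 + \<beta> *\<^sub>R x2 = \<gamma> *\<^sub>R w1 + \<delta> *\<^sub>R w2" "\<alpha> + \<beta> = \<gamma> + \<delta>" "0 < \<alpha>" "0 < \<beta>" "0 < \<gamma>" "0 < \<delta>"
    for F x1 x2 w1 w2 \<alpha> \<beta> \<gamma> \<delta>
  proof -
    let ?s = "\<gamma> + \<delta>"
    let ?z = "(1 / ?s) *\<^sub>R (\<alpha> *\<^sub>R x1 + \<beta> *\<^sub>R x2)"
    have s: "?s > 0" using e by simp
    have "?z = (\<alpha> / ?s) *\<^sub>R x1 + (\<beta> / ?s) *\<^sub>R x2" by (simp add: scaleR_add_right)
    moreover have "(\<alpha> / ?s) *\<^sub>R x1 + (\<beta> / ?s) *\<^sub>R x2 \<in> F"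
      by (rule convexD[OF face_of_imp_convex[OF F] m(1,2)]) (use e s in \<open>auto simp: add_divide_distrib[symmetric]\<close>)
    ultimately have zF: "?z \<in> F" by simp
    have "?z = (1 - \<delta> / ?s) *\<^sub>R w1 + (\<delta> / ?s) *\<^sub>R w2"
    proof -
      have "1 - \<delta> / ?s = \<gamma> / ?s" using s by (simp add: field_simps)
      then show ?thesis unfolding e(1) by (simp add: scaleR_add_right)
    qed
    moreover have "0 < \<delta> / ?s" "\<delta> / ?s < 1" using s e by auto
    ultimately have "?z \<in> open_segment w1 w2" using m(5) unfolding in_segment by blast
    then show ?thesis using F zF m(3,4) unfolding face_of_def by blast
  qed
  have faces: "\<exists>S\<in>polygon_sides n. F = ?h S" if F: "F face_of K" for F
  proof -
    define S where "S = {i. i < n \<and> v i \<in> F}"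
    have "F \<inter> vertices K = v ` S" using im by (auto simp: S_def)
    then have hF: "F = ?h S" using face_hull_vertices[OF K(2) F] by simp
    have "S \<in> polygon_sides n"
    proof (rule polygon_sidesI[OF n])
      show "S \<subseteq> {..<n}" by (auto simp: S_def)
      fix a b c d assume abcd: "a < b" "b < c" "c < d" "d < n"
      have rel: "orient u (v b) (v c) (v d) *\<^sub>R v a + orient u (v a) (v b) (v d) *\<^sub>R v c =
          orient u (v a) (v c) (v d) *\<^sub>R v b + orient u (v a) (v b) (v c) *\<^sub>R v d"
        by (rule orient_plane_relation[OF u]) (use vV vertices_in K(1) abcd in \<open>meson less_trans subsetD\<close>)+
      have s: "orient u (v b) (v c) (v d) + orient u (v a) (v b) (v d) =
          orient u (v a) (v c) (v d) + orient u (v a) (v b) (v c)" by (rule orient_sum)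
      have pos: "0 < orient u (v b) (v c) (v d)" "0 < orient u (v a) (v b) (v d)"
          "0 < orient u (v a) (v c) (v d)" "0 < orient u (v a) (v b) (v c)"
        using o abcd by auto
      have inK: "v i \<in> K" if "i < n" for i using vV[OF that] vertices_in by blast
      have ne: "v a \<noteq> v c" "v b \<noteq> v d" using inj_onD[OF inj, of a c] inj_onD[OF inj, of b d] abcd by auto
      show "a \<in> S \<and> c \<in> S \<longleftrightarrow> b \<in> S \<and> d \<in> S"
      proof
        assume "a \<in> S \<and> c \<in> S"
        then have "v b \<in> F \<and> v d \<in> F"
          by (intro crossing[OF F _ _ _ _ ne(2) rel s pos]) (use inK abcd in \<open>auto simp: S_def\<close>)
        then show "b \<in> S \<and> d \<in> S" using abcd by (auto simp: S_def)
      next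
        assume "b \<in> S \<and> d \<in> S"
        then have "v a \<in> F \<and> v c \<in> F"
          by (intro crossing[OF F _ _ _ _ ne(1) rel[symmetric] s[symmetric] pos(3,4,1,2)]) (use inK abcd in \<open>auto simp: S_def\<close>)
        then show "a \<in> S \<and> c \<in> S" using abcd by (auto simp: S_def)
      qed
    qed
    with hF show ?thesis by blast
  qed
  have sides: "?h S face_of K" if S: "S \<in> polygon_sides n" for S
  proof -
    consider "S = {}" | "S = {..<n}" | i where "S = {i}" "i < n" | i where "S = {i, Suc i mod n}" "i < n"
      using S unfolding polygon_sides_def by blast
    then show ?thesis
    proof cases
      case 2
      then show ?thesis using hK cK face_of_refl by metis
    next
      case 3
      then show ?thesis using vV[of i] vertex_face[of "v i" K] by simp
    next
      case 4
      then show ?thesis using side by blast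
    qed simp
  qed
  show "bij_betw ?h (polygon_sides n) (face_lattice K)"
    unfolding bij_betw_def
  proof
    show "inj_on ?h (polygon_sides n)"
      by (rule inj_onI) (metis ord sub order_refl subset_antisym)
    show "?h ` polygon_sides n = face_lattice K"
      using faces sides by (auto simp: face_lattice_def)
  qed
qed

lemma comb_equiv_if_same_model:
  assumes f: "bij_betw f A (face_lattice P)" "\<And>S T. S \<in> A \<Longrightarrow> T \<in> A \<Longrightarrow> f S \<subseteq> f T \<longleftrightarrow> S \<subseteq> T"
    and g: "bij_betw g A (face_lattice Q)" "\<And>S T. S \<in> A \<Longrightarrow> T \<in> A \<Longrightarrow> g S \<subseteq> g T \<longleftrightarrow> S \<subseteq> T"
  shows "P \<simeq> Q"
proof -
  let ?k = "inv_into A f"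
  have k: "bij_betw ?k (face_lattice P) A" by (rule bij_betw_inv_into[OF f(1)])
  have kf: "?k F \<in> A" "f (?k F) = F" if "F \<in> face_lattice P" for F
    using k f(1) that by (auto simp: bij_betw_def f_inv_into_f)
  have "F \<subseteq> G \<longleftrightarrow> g (?k F) \<subseteq> g (?k G)" if "F \<in> face_lattice P" "G \<in> face_lattice P" for F G
    using f(2)[of "?k F" "?k G"] g(2)[of "?k F" "?k G"] kf[OF that(1)] kf[OF that(2)] by simp
  then have "face_lattice_iso (g \<circ> ?k) P Q"
    unfolding face_lattice_iso_def using bij_betw_trans[OF k g(1)] by simp
  then show ?thesis unfolding comb_equiv_def by blast
qed

lemma polygon_equiv:
  fixes u :: "real^3"
  assumes u: "u \<noteq> 0" and K: "K \<subseteq> perp u" "polytope K" and L: "L \<subseteq> perp u" "polytope L"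
    and n: "card (vertices K) = n" "card (vertices L) = n" "3 \<le> n"
  shows "K \<simeq> L"
proof -
  obtain v where v: "bij_betw v {..<n} (vertices K)"
    "\<And>i j k. i < j \<Longrightarrow> j < k \<Longrightarrow> k < n \<Longrightarrow> 0 < orient u (v i) (v j) (v k)"
    using polygon_enumeration[OF u K n(1,3)] by blast
  obtain w where w: "bij_betw w {..<n} (vertices L)"
    "\<And>i j k. i < j \<Longrightarrow> j < k \<Longrightarrow> k < n \<Longrightarrow> 0 < orient u (w i) (w j) (w k)"
    using polygon_enumeration[OF u L n(2,3)] by blast
  show ?thesis
    by (rule comb_equiv_if_same_model[OF polygon_face_lattice[OF u K n(3) v] polygon_face_lattice[OF u L n(3) w]])
qed

subsection \<open>Vertices of slices\<close>

text \<open>Every edge occurs in both directions; \<open>crossing\<close> keeps only the one from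
  the negative to the positive side, so crossed edges are counted once.\<close>

definition edges :: "'a::euclidean_space set \<Rightarrow> ('a \<times> 'a) set" where
  "edges P = {(a, b). a \<in> vertices P \<and> b \<in> vertices P \<and> a \<noteq> b \<and> closed_segment a b face_of P}"

definition crossing :: "'a::euclidean_space \<Rightarrow> 'a \<times> 'a \<Rightarrow> bool" where
  "crossing u e \<longleftrightarrow> u \<bullet> fst e < 0 \<and> 0 < u \<bullet> snd e"

definition crossing_point :: "'a::euclidean_space \<Rightarrow> 'a \<times> 'a \<Rightarrow> 'a" where
  "crossing_point u e = (1 / (u \<bullet> snd e - u \<bullet> fst e)) *\<^sub>R ((u \<bullet> snd e) *\<^sub>R fst e - (u \<bullet> fst e) *\<^sub>R snd e)"

lemma crossing_point:
  assumes "crossing u (a, b)"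
  shows "crossing_point u (a, b) \<in> open_segment a b" "crossing_point u (a, b) \<in> perp u"
    "x \<in> closed_segment a b \<Longrightarrow> x \<in> perp u \<Longrightarrow> x = crossing_point u (a, b)"
proof -
  let ?p = "u \<bullet> a" and ?q = "u \<bullet> b"
  have pq: "?p < 0" "0 < ?q" using assms by (auto simp: crossing_def)
  then have ne: "a \<noteq> b" by auto
  let ?t = "- ?p / (?q - ?p)"
  have t: "0 < ?t" "?t < 1" using pq by (auto simp: field_simps)
  have t1: "1 - ?t = ?q / (?q - ?p)" using pq by (simp add: field_simps)
  have e: "crossing_point u (a, b) = (1 - ?t) *\<^sub>R a + ?t *\<^sub>R b"
    unfolding t1 crossing_point_def by (simp add: scaleR_diff_right)
  show "crossing_point u (a, b) \<in> open_segment a b"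
    unfolding in_segment using e t ne by blast
  show "crossing_point u (a, b) \<in> perp u"
    unfolding perp_def crossing_point_def by (simp add: inner_diff_right algebra_simps)
  assume "x \<in> closed_segment a b" "x \<in> perp u"
  then obtain s where s: "x = (1 - s) *\<^sub>R a + s *\<^sub>R b" "(1 - s) * ?p + s * ?q = 0"
    by (auto simp: in_segment perp_def inner_add_right)
  then have "s * (?q - ?p) = - ?p" by (simp add: algebra_simps)
  then have "s = ?t" using pq by (simp add: field_simps)
  then show "x = crossing_point u (a, b)" using s(1) e by simp
qed

lemma finite_edges: "polytope P \<Longrightarrow> finite (edges P)"
  by (rule finite_subset[of _ "vertices P \<times> vertices P"]) (auto simp: edges_def finite_vertices)

text \<open>A hyperplane lowers the dimension of the affine hull by at most one, so a face of
  dimension two or more would contain further points of the plane near \<open>x\<close>.\<close>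

lemma rel_interior_extreme_slice:
  fixes F :: "'a::euclidean_space set"
  assumes F: "x \<in> rel_interior F" "F \<inter> perp u = {x}"
  shows "aff_dim F \<le> 1"
proof (rule ccontr)
  assume d: "\<not> aff_dim F \<le> 1"
  let ?A = "affine hull F"
  have xA: "x \<in> F" "x \<in> perp u" using F(2) by blast+
  have xA': "x \<in> ?A" using xA(1) by (rule hull_inc)
  have "aff_dim (?A \<inter> {x. u \<bullet> x = 0}) \<ge> aff_dim ?A - 1"
    using aff_dim_affine_Int_hyperplane[OF affine_affine_hull, of F u 0] xA xA' by (auto simp: perp_def)
  then have "aff_dim (?A \<inter> perp u) \<ge> 1" using d by (simp add: perp_def)
  then have "\<not> ?A \<inter> perp u \<subseteq> {x}"
    using aff_dim_subset[of "?A \<inter> perp u" "{x}"] by auto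
  then obtain y where y: "y \<in> ?A" "y \<in> perp u" "y \<noteq> x" by blast
  obtain e where e: "e > 0" "cball x e \<inter> ?A \<subseteq> F" using F(1) by (auto simp: mem_rel_interior_cball)
  \<comment> \<open>This places the new point at distance \<open>e\<close> from
    \<open>x\<close>.\<close>
  define t where "t = e / norm (y - x)"
  have "(1 - t) *\<^sub>R x + t *\<^sub>R y \<in> ?A"
    using mem_affine[OF affine_affine_hull xA' y(1), of "1 - t" t] by simp
  moreover have "dist x ((1 - t) *\<^sub>R x + t *\<^sub>R y) = norm (t *\<^sub>R (y - x))"
    by (simp add: dist_norm algebra_simps norm_minus_commute)
  then have "dist x ((1 - t) *\<^sub>R x + t *\<^sub>R y) \<le> e" using e(1) y(3) by (simp add: t_def)
  ultimately have "(1 - t) *\<^sub>R x + t *\<^sub>R y \<in> F" using e(2) by auto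
  moreover have "(1 - t) *\<^sub>R x + t *\<^sub>R y \<in> perp u" using xA(2) y(2) by (simp add: perp_def inner_add_right)
  ultimately have "(1 - t) *\<^sub>R x + t *\<^sub>R y = x" using F(2) by blast
  then have "t *\<^sub>R (y - x) = 0" by (simp add: algebra_simps)
  then show False using e(1) y(3) by (simp add: t_def)
qed

text \<open>The face of \<open>P\<close> with a slice vertex in its relative interior meets the
  plane in that point only. So it has dimension at most one: it is a vertex, or an edge crossed by
  the plane.\<close>

lemma vertices_slice:
  fixes P :: "'a::euclidean_space set"
  assumes P: "polytope P"
  shows "vertices (P \<inter> perp u) = {v \<in> vertices P. u \<bullet> v = 0} \<union> crossing_point u ` {e \<in> edges P. crossing u e}"
proof
  show "vertices (P \<inter> perp u) \<subseteq> {v \<in> vertices P. u \<bullet> v = 0} \<union> crossing_point u ` {e \<in> edges P. crossing u e}"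
  proof
    fix x assume x: "x \<in> vertices (P \<inter> perp u)"
    then have xP: "x \<in> P" "x \<in> perp u" using vertices_in by blast+
    obtain F where F: "F face_of P" "x \<in> rel_interior F" by (rule face_with_rel_interior_point[OF P xP(1)])
    have "x \<in> rel_interior (F \<inter> perp u)"
      using rel_interior_slice[OF face_of_imp_convex[OF F(1)]] F xP by blast
    moreover have "F \<inter> perp u face_of P \<inter> perp u"
      using face_of_slice F(1) affine_imp_convex[OF affine_perp] by blast
    moreover have "{x} face_of P \<inter> perp u" using x by (simp add: vertex_face)
    ultimately have Fx: "F \<inter> perp u = {x}"
      using face_of_eq[of "{x}" "P \<inter> perp u" "F \<inter> perp u"] by simp
    have "collinear F" using rel_interior_extreme_slice[OF F(2) Fx] by (simp add: collinear_aff_dim)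
    moreover have "F \<noteq> {}" using F(2) rel_interior_subset by blast
    moreover have "compact F" "convex F"
      using face_of_polytope_polytope[OF P F(1)] polytope_imp_compact polytope_imp_convex by blast+
    ultimately obtain a b where ab: "F = closed_segment a b" using compact_convex_collinear_segment by metis
    have V: "a \<in> vertices P" "b \<in> vertices P"
      using F(1) extreme_point_of_segment[of _ a b] vertices_of_face[OF F(1)] unfolding ab vertices_def by auto
    show "x \<in> {v \<in> vertices P. u \<bullet> v = 0} \<union> crossing_point u ` {e \<in> edges P. crossing u e}"
    proof (cases "a = b")
      case True
      then have "x = a" using Fx ab by auto
      then show ?thesis using V xP by (auto simp: perp_def)
    next
      case False
      then have xo: "x \<in> open_segment a b" using F(2) unfolding ab by (simp add: rel_interior_closed_segment)
      then obtain t where t: "0 < t" "t < 1" "x = (1 - t) *\<^sub>R a + t *\<^sub>R b" by (auto simp: in_segment)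
      have ux: "(1 - t) * (u \<bullet> a) + t * (u \<bullet> b) = 0" using xP(2) t(3) by (simp add: perp_def inner_add_right)
      have "u \<bullet> a \<noteq> 0"
      proof
        assume "u \<bullet> a = 0"
        then have "a \<in> F \<inter> perp u" using ab by (simp add: perp_def)
        then show False using Fx xo by (auto simp: open_segment_def)
      qed
      then consider "u \<bullet> a < 0" | "u \<bullet> a > 0" by linarith
      then have "crossing u (a, b) \<or> crossing u (b, a)"
      proof cases
        case 1
        then have "(1 - t) * (u \<bullet> a) < 0" using t by (simp add: mult_pos_neg)
        then have "0 < t * (u \<bullet> b)" using ux by simp
        then show ?thesis using 1 t by (simp add: crossing_def zero_less_mult_iff)
      next
        case 2
        then have "(1 - t) * (u \<bullet> a) > 0" using t by simp
        then have "t * (u \<bullet> b) < 0" using ux by simp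
        then show ?thesis using 2 t by (simp add: crossing_def mult_less_0_iff)
      qed
      moreover have e: "(a, b) \<in> edges P" "(b, a) \<in> edges P"
        using V False F(1)[unfolded ab] F(1)[unfolded ab, unfolded closed_segment_commute[of a b]]
        by (simp_all add: edges_def)
      moreover have x: "x \<in> closed_segment a b" "x \<in> closed_segment b a"
        using xo unfolding closed_segment_commute[of b a] by (simp_all add: open_segment_def)
      ultimately show ?thesis
        using crossing_point(3)[OF _ x(1) xP(2)] crossing_point(3)[OF _ x(2) xP(2)] by (elim disjE) auto
    qed
  qed
  show "{v \<in> vertices P. u \<bullet> v = 0} \<union> crossing_point u ` {e \<in> edges P. crossing u e} \<subseteq> vertices (P \<inter> perp u)"
  proof
    fix x assume "x \<in> {v \<in> vertices P. u \<bullet> v = 0} \<union> crossing_point u ` {e \<in> edges P. crossing u e}"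
    then obtain F where F: "F face_of P" "F \<inter> perp u = {x}"
    proof (rule UnE)
      assume "x \<in> {v \<in> vertices P. u \<bullet> v = 0}"
      then show ?thesis by (intro that[of "{x}"]) (auto simp: vertex_face perp_def)
    next
      assume "x \<in> crossing_point u ` {e \<in> edges P. crossing u e}"
      then obtain a b where ab: "(a, b) \<in> edges P" "crossing u (a, b)" "x = crossing_point u (a, b)" by auto
      have "closed_segment a b \<inter> perp u = {x}"
        using crossing_point[OF ab(2)] ab(3) by (auto simp: open_segment_def)
      then show ?thesis using that ab(1) by (auto simp: edges_def)
    qed
    have "F \<inter> perp u face_of P \<inter> perp u" using face_of_slice F(1) affine_imp_convex[OF affine_perp] by blast
    then show "x \<in> vertices (P \<inter> perp u)" unfolding F(2) by (simp add: vertex_face)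
  qed
qed

text \<open>Edges with a common crossing point share a relative interior point and coincide, and the
  sign condition fixes the direction. A crossing point is inside an open segment, hence no vertex of
  \<open>P\<close>.\<close>

lemma card_vertices_slice:
  fixes P :: "'a::euclidean_space set"
  assumes P: "polytope P"
  shows "card (vertices (P \<inter> perp u)) = card {v \<in> vertices P. u \<bullet> v = 0} + card {e \<in> edges P. crossing u e}"
proof -
  have inj: "inj_on (crossing_point u) {e \<in> edges P. crossing u e}"
  proof (rule inj_onI)
    fix e f assume "e \<in> {e \<in> edges P. crossing u e}" "f \<in> {e \<in> edges P. crossing u e}"
      and eq: "crossing_point u e = crossing_point u f"
    moreover obtain a b c d where ef: "e = (a, b)" "f = (c, d)" by fastforce
    ultimately have m: "(a, b) \<in> edges P" "crossing u (a, b)" "(c, d) \<in> edges P" "crossing u (c, d)" by auto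
    have "crossing_point u e \<in> open_segment a b" "crossing_point u e \<in> open_segment c d"
      using crossing_point(1)[OF m(2)] crossing_point(1)[OF m(4)] eq unfolding ef by auto
    then have "rel_interior (closed_segment a b) \<inter> rel_interior (closed_segment c d) \<noteq> {}"
      using m by (auto simp: rel_interior_closed_segment edges_def)
    then have "closed_segment a b = closed_segment c d"
      using m(1,3) face_of_eq[of "closed_segment a b" P "closed_segment c d"] by (simp add: edges_def)
    then have "{a, b} = {c, d}" by (simp add: closed_segment_eq)
    then show "e = f" using m(2,4) unfolding ef crossing_def by (auto simp: doubleton_eq_iff)
  qed
  have disj: "{v \<in> vertices P. u \<bullet> v = 0} \<inter> crossing_point u ` {e \<in> edges P. crossing u e} = {}"
  proof -
    have "crossing_point u (a, b) \<notin> vertices P" if "(a, b) \<in> edges P" "crossing u (a, b)" for a b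
    proof
      assume x: "crossing_point u (a, b) \<in> vertices P"
      have "a \<in> P" "b \<in> P" using that(1) vertices_in by (auto simp: edges_def)
      then show False using x crossing_point(1)[OF that(2)] unfolding vertices_def extreme_point_of_def by blast
    qed
    then show ?thesis by auto
  qed
  show ?thesis
    unfolding vertices_slice[OF P]
    using card_Un_disjoint[OF _ _ disj] finite_vertices[OF P] finite_edges[OF P] card_image[OF inj] by simp
qed

text \<open>A plane through an interior point cuts \<open>P\<close> in a set of affine dimension
  two.\<close>

lemma three_le_card_vertices_slice:
  fixes P :: "(real^3) set"
  assumes P: "origin_polytope P" and u: "u \<noteq> 0"
  shows "3 \<le> card (vertices (P \<inter> perp u))"
proof -
  note pP = origin_polytopeD(1)[OF P]
  have "perp u \<inter> interior P \<noteq> {}" using origin_polytopeD(2)[OF P] by (force simp: perp_def)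
  then have "aff_dim (perp u \<inter> interior P) = aff_dim (perp u)"
    by (intro aff_dim_convex_Int_open affine_imp_convex[OF affine_perp]) auto
  also have "\<dots> = 2" unfolding perp_def using aff_dim_hyperplane[OF u, of 0] by simp
  finally have "2 \<le> aff_dim (P \<inter> perp u)"
    using aff_dim_subset[of "perp u \<inter> interior P" "P \<inter> perp u"] interior_subset[of P] by auto
  also have "\<dots> = aff_dim (vertices (P \<inter> perp u))"
    using polytope_hull_vertices[OF polytope_slice[OF pP]] aff_dim_convex_hull by metis
  also have "\<dots> \<le> int (card (vertices (P \<inter> perp u))) - 1"
    by (rule aff_dim_le_card[OF finite_vertices[OF polytope_slice[OF pP]]])
  finally show ?thesis by simp
qed

lemma iso_edges:
  assumes i: "face_lattice_iso i P Q" and P: "polytope P" and Q: "polytope Q" and e: "(x, y) \<in> edges P"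
  shows "(vertex_map i x, vertex_map i y) \<in> edges Q"
proof -
  let ?j = "vertex_map i" and ?F = "closed_segment x y"
  have xy: "x \<in> vertices P" "y \<in> vertices P" "x \<noteq> y" and F: "?F face_of P" using e by (auto simp: edges_def)
  have "?F \<inter> vertices P = {x, y}"
  proof
    show "?F \<inter> vertices P \<subseteq> {x, y}"
    proof
      fix z assume z: "z \<in> ?F \<inter> vertices P"
      have "z \<notin> open_segment x y"
        using z xy vertices_in unfolding vertices_def extreme_point_of_def by blast
      then show "z \<in> {x, y}" using z by (auto simp: open_segment_def)
    qed
  qed (use xy in auto)
  then have "i ?F \<inter> vertices Q = {?j x, ?j y}" using vertices_iso_face[OF i P Q F] by simp
  then have "i ?F = closed_segment (?j x) (?j y)"
    using face_hull_vertices[OF Q iso_face[OF i F]] by (simp add: segment_convex_hull)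
  then have "closed_segment (?j x) (?j y) face_of Q" using iso_face[OF i F] by simp
  moreover have "?j x \<noteq> ?j y"
    using bij_vertex_map[OF i P Q] xy by (auto simp: bij_betw_def inj_on_def)
  ultimately show ?thesis using vertex_map(2)[OF i Q] xy by (auto simp: edges_def)
qed

subsection \<open>Doubly capped octahedra\<close>

text \<open>The constant 5 is tuned to caps at \<open>2 *\<^sub>R s\<close>: the product with
  \<open>s\<close> is at most 5 on the octahedron and 6 at the cap, while no other sign vector has a
  product above 2 with the cap.\<close>

definition octahedron_vertices :: "(real^3) set" where
  "octahedron_vertices = {axis i r | i r. \<bar>r\<bar> = 5}"

definition signvec :: "real^3 \<Rightarrow> bool" where
  "signvec s \<longleftrightarrow> (\<forall>i. \<bar>s$i\<bar> = 1)"

definition capped_vertices :: "real^3 \<Rightarrow> real^3 \<Rightarrow> (real^3) set" where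
  "capped_vertices s t = octahedron_vertices \<union> {2 *\<^sub>R s, 2 *\<^sub>R t}"

text \<open>The point \<open>2 s\<close> lies just beyond the facet of the octahedron in the orthant of \<open>s\<close>.\<close>

definition capped :: "real^3 \<Rightarrow> real^3 \<Rightarrow> (real^3) set" where
  "capped s t = convex hull (capped_vertices s t)"

definition octahedron_edges :: "((real^3) \<times> (real^3)) set" where
  "octahedron_edges = {(x, y). x \<in> octahedron_vertices \<and> y \<in> octahedron_vertices \<and> y \<noteq> x \<and> y \<noteq> - x}"

text \<open>Both directions are listed, to match \<open>edges\<close>.\<close>

definition cap_edges :: "real^3 \<Rightarrow> ((real^3) \<times> (real^3)) set" where
  "cap_edges s = (\<Union>i. {(2 *\<^sub>R s, axis i (5 * s$i)), (axis i (5 * s$i), 2 *\<^sub>R s)})"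

section \<open>Sign vectors and the vertices of a capped octahedron\<close>

lemma signvec_cases: "signvec s \<Longrightarrow> s$i = 1 \<or> s$i = -1"
  unfolding signvec_def by (metis abs_eq_iff abs_1 abs_minus_cancel)

lemma signvec_uminus [simp]: "signvec (- s) \<longleftrightarrow> signvec s"
  by (simp add: signvec_def)

lemma signvec_self: "signvec s \<Longrightarrow> s \<bullet> s = 3"
  using signvec_cases[of s 1] signvec_cases[of s 2] signvec_cases[of s 3] by (auto simp: inner3)

lemma signvec_inner_le:
  assumes "signvec s" "signvec t" "s \<noteq> t"
  shows "s \<bullet> t \<le> 1"
  using assms(3) signvec_cases[OF assms(1), of 1] signvec_cases[OF assms(1), of 2] signvec_cases[OF assms(1), of 3]
    signvec_cases[OF assms(2), of 1] signvec_cases[OF assms(2), of 2] signvec_cases[OF assms(2), of 3]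
  by (auto simp: inner3 vec3_eq)

lemma axis_neq_twice_signvec: "signvec s \<Longrightarrow> axis i r \<noteq> 2 *\<^sub>R s"
proof
  assume s: "signvec s" and e: "axis i r = 2 *\<^sub>R s"
  have "(1::3) \<noteq> 2" by simp
  then have "\<exists>j::3. j \<noteq> i" by metis
  then obtain j where "j \<noteq> i" by blast
  then have "(axis i r)$j = 0" by (simp add: axis_def)
  then have "s$j = 0" unfolding e by simp
  then show False using signvec_cases[OF s, of j] by simp
qed

lemma uminus_axis: "- axis i r = (axis i (- r) :: real^3)"
  by (simp add: vec_eq_iff axis_def)

lemma finite_octahedron_vertices: "finite octahedron_vertices"
proof -
  have "octahedron_vertices = (\<lambda>(i, r). axis i r) ` (UNIV \<times> {5, -5})"
    unfolding octahedron_vertices_def by (auto simp: image_iff abs_eq_iff')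
  moreover have "finite ((\<lambda>(i, r). axis i r :: real^3) ` (UNIV \<times> {5, -5}))"
    by (intro finite_imageI finite_cartesian_product) auto
  ultimately show ?thesis by metis
qed

lemma finite_capped_vertices: "finite (capped_vertices s t)"
  by (simp add: capped_vertices_def finite_octahedron_vertices)

lemma polytope_capped: "polytope (capped s t)"
  unfolding capped_def by (rule polytope_convex_hull[OF finite_capped_vertices])

lemma capped_commute: "capped s t = capped t s"
  by (simp add: capped_def capped_vertices_def insert_commute)

lemma axis_in_octahedron_vertices [simp]: "axis i r \<in> octahedron_vertices \<longleftrightarrow> \<bar>r\<bar> = 5"
  unfolding octahedron_vertices_def by (auto simp: axis_eq_axis)

lemma octahedron_inner_le:
  assumes "signvec s" "x \<in> octahedron_vertices"
  shows "s \<bullet> x \<le> 5"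
proof -
  obtain i r where "x = axis i r" "\<bar>r\<bar> = 5" using assms(2) by (auto simp: octahedron_vertices_def)
  then show ?thesis using signvec_cases[OF assms(1), of i] by (auto simp: inner_axis)
qed

lemma octahedron_inner:
  assumes "x \<in> octahedron_vertices" "y \<in> octahedron_vertices"
  shows "x \<bullet> y = (if y = x then 25 else if y = - x then -25 else 0)"
proof -
  obtain i r where x: "x = axis i r" "\<bar>r\<bar> = 5" using assms(1) by (auto simp: octahedron_vertices_def)
  obtain j q where y: "y = axis j q" "\<bar>q\<bar> = 5" using assms(2) by (auto simp: octahedron_vertices_def)
  have "r = 5 \<or> r = -5" "q = 5 \<or> q = -5" using x y by auto
  then show ?thesis unfolding x y uminus_axis by (auto simp: inner_axis_axis axis_eq_axis)
qed

lemma vertices_capped: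
  assumes s: "signvec s" "signvec t" "s \<noteq> t"
  shows "vertices (capped s t) = capped_vertices s t"
  unfolding capped_def
proof (rule vertices_hull_eq[OF finite_capped_vertices])
  fix v assume v: "v \<in> capped_vertices s t"
  have cap: "\<forall>w\<in>capped_vertices s' t'. w \<noteq> 2 *\<^sub>R s' \<longrightarrow> s' \<bullet> w < s' \<bullet> (2 *\<^sub>R s')"
    if "signvec s'" "signvec t'" "s' \<noteq> t'" for s' t'
    using octahedron_inner_le[OF that(1)] signvec_inner_le[OF that] signvec_self[OF that(1)]
    by (fastforce simp: capped_vertices_def)
  show "\<exists>c. \<forall>w\<in>capped_vertices s t. w \<noteq> v \<longrightarrow> c \<bullet> w < c \<bullet> v"
  proof (cases "v \<in> octahedron_vertices")
    case True
    have "v \<bullet> w < v \<bullet> v" if "w \<in> capped_vertices s t" "w \<noteq> v" for w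
      using octahedron_inner[OF True, of w] octahedron_inner[OF True True] that
        octahedron_inner_le[OF s(1) True] octahedron_inner_le[OF s(2) True]
      by (auto simp: capped_vertices_def inner_commute split: if_splits)
    then show ?thesis by blast
  next
    case False
    then have "v = 2 *\<^sub>R s \<or> v = 2 *\<^sub>R t" using v by (auto simp: capped_vertices_def)
    then show ?thesis
    proof
      assume "v = 2 *\<^sub>R s" then show ?thesis using cap[OF s] by blast
    next
      have "capped_vertices s t = capped_vertices t s" by (auto simp: capped_vertices_def)
      moreover assume "v = 2 *\<^sub>R t"
      ultimately show ?thesis using cap[OF s(2,1)] s(3) by metis
    qed
  qed
qed

text \<open>The open ball of radius 5 in the l1 norm is the interior of the octahedron. It serves as
  the test for segments that are not edges.\<close>

lemma l1_ball_in_capped: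
  fixes x :: "real^3"
  assumes "\<bar>x$1\<bar> + \<bar>x$2\<bar> + \<bar>x$3\<bar> < 5"
  shows "x \<in> interior (capped s t)"
proof -
  let ?U = "{x :: real^3. \<bar>x$1\<bar> + \<bar>x$2\<bar> + \<bar>x$3\<bar> < 5}"
  have V: "v \<in> capped s t" if "v \<in> octahedron_vertices" for v
    unfolding capped_def by (rule hull_inc) (use that in \<open>simp add: capped_vertices_def\<close>)
  have c: "convex (capped s t)" by (simp add: capped_def)
  have "(1/2) *\<^sub>R axis 1 5 + (1/2) *\<^sub>R axis 1 (-5) \<in> capped s t"
    by (rule convexD[OF c]) (auto intro: V)
  moreover have "(1/2) *\<^sub>R axis 1 5 + (1/2) *\<^sub>R axis 1 (-5) = (0 :: real^3)"
    by (simp add: vec_eq_iff axis_def)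
  ultimately have z: "0 \<in> capped s t" by metis
  have "?U \<subseteq> capped s t"
  proof
    fix x :: "real^3" assume x: "x \<in> ?U"
    let ?m = "\<bar>x$1\<bar> + \<bar>x$2\<bar> + \<bar>x$3\<bar>"
    show "x \<in> capped s t"
    proof (cases "?m = 0")
      case True
      then have "\<bar>x$1\<bar> = 0 \<and> \<bar>x$2\<bar> = 0 \<and> \<bar>x$3\<bar> = 0" by linarith
      then have "x = 0" by (simp add: vec3_eq)
      then show ?thesis using z by simp
    next
      case False
      then have m: "0 < ?m" "?m < 5" using x by auto
      have cancel: "M / 5 * (a / M) = a / 5" if "0 < M" for M a :: real using that by simp
      \<comment> \<open>The octahedron vertices of an orthant containing \<open>x\<close>; the
        weights proportional to the coordinates give a point of the facet, which is then shrunk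
        towards the origin.\<close>
      let ?p = "\<lambda>i. axis i (if 0 \<le> x$i then 5 else - 5) :: real^3"
      have "(\<Sum>i\<in>UNIV. (\<bar>x$i\<bar> / ?m) *\<^sub>R ?p i) \<in> capped s t"
      proof (rule convex_sum[OF _ c])
        show "(\<Sum>i\<in>UNIV. \<bar>x$i\<bar> / ?m) = 1" using m by (simp add: sum_3 add_divide_distrib[symmetric])
      qed (use m in \<open>auto intro: V\<close>)
      then have "(?m / 5) *\<^sub>R (\<Sum>i\<in>UNIV. (\<bar>x$i\<bar> / ?m) *\<^sub>R ?p i) + (1 - ?m / 5) *\<^sub>R 0 \<in> capped s t"
        by (intro convexD[OF c _ z]) (use m in auto)
      moreover have "(?m / 5) *\<^sub>R (\<Sum>i\<in>UNIV. (\<bar>x$i\<bar> / ?m) *\<^sub>R ?p i) = (\<Sum>i\<in>UNIV. (\<bar>x$i\<bar> / 5) *\<^sub>R ?p i)"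
        by (simp only: scaleR_sum_right scaleR_scaleR cancel[OF m(1)])
      moreover have "(\<Sum>i\<in>UNIV. (\<bar>x$i\<bar> / 5) *\<^sub>R ?p i) = x"
        by (simp add: sum_3 vec3_eq axis_def)
      ultimately show ?thesis by simp
    qed
  qed
  moreover have "open ?U" by (intro open_Collect_less continuous_intros)
  ultimately show ?thesis using assms by (intro interiorI[of ?U]) auto
qed

lemma origin_polytope_capped: "origin_polytope (capped s t)"
  by (rule origin_polytopeI[OF polytope_capped l1_ball_in_capped]) simp

section \<open>The edge graph of a capped octahedron\<close>

lemma octahedron_edge_in_edges:
  assumes s: "signvec s" "signvec t" "s \<noteq> t" and e: "(x, y) \<in> octahedron_edges"
  shows "(x, y) \<in> edges (capped s t)"
proof -
  have xy: "x \<in> octahedron_vertices" "y \<in> octahedron_vertices" "y \<noteq> x" "y \<noteq> - x"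
    using e by (auto simp: octahedron_edges_def)
  have x0: "x \<bullet> y = 0" "y \<bullet> x = 0" "x \<bullet> x = 25" "y \<bullet> y = 25"
    using octahedron_inner xy by (auto simp: inner_commute)
  have "convex hull {x, y} face_of convex hull (capped_vertices s t)"
  \<comment> \<open>The functional \<open>x + y\<close> is 25 at both ends and at most 20 at the
    caps, so the caps are too low to hide an edge of the octahedron.\<close>
  proof (rule exposed_hull_face[where c = "x + y" and m = 25])
    show "(x + y) \<bullet> w < 25" if w: "w \<in> capped_vertices s t - {x, y}" for w
    proof (cases "w \<in> octahedron_vertices")
      case True
      then show ?thesis using w octahedron_inner[OF xy(1) True] octahedron_inner[OF xy(2) True]
        by (simp add: inner_add_left)
    next
      case False
      then have "w = 2 *\<^sub>R s \<or> w = 2 *\<^sub>R t" using w by (auto simp: capped_vertices_def)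
      moreover have "(x + y) \<bullet> (2 *\<^sub>R r) = 2 * (r \<bullet> x) + 2 * (r \<bullet> y)" for r
        by (simp add: inner_commute[of _ r] inner_add_right)
      ultimately show ?thesis
        using octahedron_inner_le[OF s(1) xy(1)] octahedron_inner_le[OF s(1) xy(2)]
          octahedron_inner_le[OF s(2) xy(1)] octahedron_inner_le[OF s(2) xy(2)]
        by (elim disjE) simp_all
    qed
  qed (use xy x0 in \<open>auto simp: inner_add_left finite_octahedron_vertices capped_vertices_def\<close>)
  then show ?thesis
    using xy by (auto simp: edges_def vertices_capped[OF s] capped_def[symmetric] segment_convex_hull)
      (auto simp: capped_vertices_def)
qed

lemma edges_sym: "(x, y) \<in> edges P \<longleftrightarrow> (y, x) \<in> edges P"
  by (simp add: edges_def) (metis closed_segment_commute)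

lemma cap_edge_in_edges:
  assumes s: "signvec s" "signvec t" "s \<noteq> t"
  shows "(2 *\<^sub>R s, axis i (5 * s$i)) \<in> edges (capped s t)"
proof -
  let ?x = "2 *\<^sub>R s" and ?y = "axis i (5 * s$i)"
  \<comment> \<open>The facet normal \<open>s\<close>, tilted towards axis \<open>i\<close>. The
    ratio 3 : 1 makes the cap and the octahedron vertex tie at 20, while the other vertices of the
    facet have 15.\<close>
  let ?c = "3 *\<^sub>R s + axis i (s$i)"
  have si: "s$i * s$i = 1" "\<bar>s$i\<bar> = 1" using signvec_cases[OF s(1), of i] by auto
  have yV: "?y \<in> octahedron_vertices" using si(2) by (simp add: abs_mult)
  have ne: "?x \<noteq> ?y" using axis_neq_twice_signvec[OF s(1)] by metis
  have "convex hull {?x, ?y} face_of convex hull (capped_vertices s t)"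
  proof (rule exposed_hull_face[where c = ?c and m = 20])
    show "?c \<bullet> v = 20" if v: "v \<in> {?x, ?y}" for v
      using v si signvec_self[OF s(1)]
      by (auto simp: inner_add_left inner_axis inner_axis' inner_axis_axis algebra_simps)
    show "?c \<bullet> w < 20" if w: "w \<in> capped_vertices s t - {?x, ?y}" for w
    proof (cases "w \<in> octahedron_vertices")
      case True
      then obtain j q where jq: "w = axis j q" "\<bar>q\<bar> = 5" by (auto simp: octahedron_vertices_def)
      show ?thesis
      proof (cases "j = i")
        case True
        then have "q \<noteq> 5 * s$i" using w jq by auto
        then have "q = - (5 * s$i)" using jq(2) signvec_cases[OF s(1), of i] by auto
        then show ?thesis using True jq si by (simp add: inner_add_left inner_axis inner_axis_axis)
      next
        case False
        then have "?c \<bullet> w = 3 * (s \<bullet> w)" using jq by (simp add: inner_add_left inner_axis_axis)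
        then show ?thesis using octahedron_inner_le[OF s(1) True] by simp
      qed
    next
      case False
      then have "w = 2 *\<^sub>R t" using w by (auto simp: capped_vertices_def)
      then have "?c \<bullet> w = 6 * (s \<bullet> t) + 2 * (s$i * t$i)" by (simp add: inner_add_left inner_axis')
      moreover have "s$i * t$i \<le> 1" using signvec_cases[OF s(1), of i] signvec_cases[OF s(2), of i] by auto
      ultimately show ?thesis using signvec_inner_le[OF s] by linarith
    qed
  qed (use yV in \<open>auto simp: finite_octahedron_vertices capped_vertices_def\<close>)
  then show ?thesis
    using ne yV by (auto simp: edges_def vertices_capped[OF s] capped_def[symmetric] segment_convex_hull)
      (auto simp: capped_vertices_def)
qed

text \<open>For dimension reasons a segment is a proper face, and proper faces miss the
  interior.\<close>

lemma not_edge_if_l1_ball: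
  assumes z: "z \<in> closed_segment x y" "\<bar>z$1\<bar> + \<bar>z$2\<bar> + \<bar>z$3\<bar> < (5 :: real)"
  shows "(x, y) \<notin> edges (capped s t)"
proof
  assume e: "(x, y) \<in> edges (capped s t)"
  have "closed_segment x y \<noteq> capped s t"
  proof
    assume eq: "closed_segment x y = capped s t"
    have "aff_dim (closed_segment x y) \<le> 1"
      using collinear_closed_segment[of x y] by (simp add: collinear_aff_dim)
    then show False using origin_polytope_capped[of s t] unfolding eq origin_polytope_def by simp
  qed
  then show False
    using e z l1_ball_in_capped[OF z(2), of s t] face_of_disjoint_interior[of "closed_segment x y" "capped s t"]
    by (auto simp: edges_def)
qed

lemma not_edge_antipodal: "(x, - x) \<notin> edges (capped s t)"
  by (rule not_edge_if_l1_ball[of 0]) (auto simp: in_segment intro!: exI[of _ "1/2"])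

lemma not_edge_caps:
  assumes s: "signvec s" "signvec t" "s \<noteq> t"
  shows "(2 *\<^sub>R s, 2 *\<^sub>R t) \<notin> edges (capped s' t')"
proof (rule not_edge_if_l1_ball)
  \<comment> \<open>The midpoint has a zero coordinate where the signs differ, and the other two are
    at most 2 in absolute value.\<close>
  show "s + t \<in> closed_segment (2 *\<^sub>R s) (2 *\<^sub>R t)"
    by (auto simp: in_segment intro!: exI[of _ "1/2"])
  show "\<bar>(s + t)$1\<bar> + \<bar>(s + t)$2\<bar> + \<bar>(s + t)$3\<bar> < 5"
    using s(3) signvec_cases[OF s(1), of 1] signvec_cases[OF s(1), of 2] signvec_cases[OF s(1), of 3]
      signvec_cases[OF s(2), of 1] signvec_cases[OF s(2), of 2] signvec_cases[OF s(2), of 3]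
    by (auto simp: vec3_eq)
qed

lemma not_edge_cap_opposite:
  assumes s: "signvec s"
  shows "(2 *\<^sub>R s, axis i (- (5 * s$i))) \<notin> edges (capped s' t')"
proof (rule not_edge_if_l1_ball)
  \<comment> \<open>The weight 2/7 makes coordinate \<open>i\<close> vanish; the other two then have
    absolute value 10/7.\<close>
  let ?z = "(1 - 2/7) *\<^sub>R (2 *\<^sub>R s) + (2/7) *\<^sub>R axis i (- (5 * s$i))"
  show "?z \<in> closed_segment (2 *\<^sub>R s) (axis i (- (5 * s$i)))"
    unfolding in_segment by (intro exI[of _ "2/7"]) simp
  have "\<bar>?z$j\<bar> \<le> 10/7" for j
    using signvec_cases[OF s, of i] signvec_cases[OF s, of j] by (auto simp: axis_def)
  from this[of 1] this[of 2] this[of 3] show "\<bar>?z$1\<bar> + \<bar>?z$2\<bar> + \<bar>?z$3\<bar> < 5" by linarith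
qed

text \<open>The pairs that remain are antipodal octahedron vertices, the two caps, and a cap with a
  vertex of the opposite facet. Each of these segments passes through the interior.\<close>

lemma edges_capped:
  assumes s: "signvec s" "signvec t" "s \<noteq> t"
  shows "edges (capped s t) = octahedron_edges \<union> cap_edges s \<union> cap_edges t"
proof
  have "cap_edges s \<subseteq> edges (capped s t)"
    unfolding cap_edges_def using cap_edge_in_edges[OF s] edges_sym by blast
  moreover have "cap_edges t \<subseteq> edges (capped s t)"
    unfolding cap_edges_def using cap_edge_in_edges[OF s(2,1)] s(3) edges_sym capped_commute[of s t] by auto
  ultimately show "octahedron_edges \<union> cap_edges s \<union> cap_edges t \<subseteq> edges (capped s t)"
    using octahedron_edge_in_edges[OF s] by auto
  have cap: "(2 *\<^sub>R r, y) \<in> cap_edges r"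
    if r: "signvec r" "r = s \<or> r = t" and e: "(2 *\<^sub>R r, y) \<in> edges (capped s t)" for r y
  proof -
    have y: "y \<in> capped_vertices s t" "y \<noteq> 2 *\<^sub>R r" using e by (auto simp: edges_def vertices_capped[OF s])
    show ?thesis
    proof (cases "y \<in> octahedron_vertices")
      case True
      then obtain i q where q: "y = axis i q" "\<bar>q\<bar> = 5" by (auto simp: octahedron_vertices_def)
      have "q = 5 * r$i \<or> q = - (5 * r$i)" using q(2) signvec_cases[OF r(1), of i] by auto
      then have "q = 5 * r$i" using e not_edge_cap_opposite[OF r(1)] q(1) by auto
      then show ?thesis using q(1) by (auto simp: cap_edges_def)
    next
      case False
      then have "(r = s \<and> y = 2 *\<^sub>R t) \<or> (r = t \<and> y = 2 *\<^sub>R s)" using y r by (auto simp: capped_vertices_def)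
      then have False using e not_edge_caps[OF s] not_edge_caps[OF s(2,1)] s(3) by auto
      then show ?thesis ..
    qed
  qed
  have flip: "(x, y) \<in> cap_edges r \<longleftrightarrow> (y, x) \<in> cap_edges r" for x y r by (auto simp: cap_edges_def)
  show "edges (capped s t) \<subseteq> octahedron_edges \<union> cap_edges s \<union> cap_edges t"
  proof
    fix e assume "e \<in> edges (capped s t)"
    moreover obtain x y where exy: "e = (x, y)" by fastforce
    ultimately have e: "(x, y) \<in> edges (capped s t)" "(y, x) \<in> edges (capped s t)" using edges_sym by auto
    have V: "x \<in> capped_vertices s t" "y \<in> capped_vertices s t" "x \<noteq> y"
      using e by (auto simp: edges_def vertices_capped[OF s])
    consider "x \<in> octahedron_vertices" "y \<in> octahedron_vertices"
      | r where "r = s \<or> r = t" "x = 2 *\<^sub>R r" | r where "r = s \<or> r = t" "y = 2 *\<^sub>R r"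
      using V by (auto simp: capped_vertices_def)
    then show "e \<in> octahedron_edges \<union> cap_edges s \<union> cap_edges t"
    proof cases
      case 1
      then show ?thesis using V(3) not_edge_antipodal e exy by (auto simp: octahedron_edges_def)
    next
      case (2 r)
      then have "(x, y) \<in> cap_edges r" using cap[of r y] e s by auto
      then show ?thesis using 2(1) exy by auto
    next
      case (3 r)
      then have "(y, x) \<in> cap_edges r" using cap[of r x] e s by auto
      then show ?thesis using 3(1) exy flip by auto
    qed
  qed
qed

text \<open>Passing from a cap to the opposite cap replaces every edge by its antipode, which crosses the
  same central planes.\<close>

lemma card_crossing_cap_edges_uminus:
  "card {e \<in> cap_edges (- s). crossing u e} = card {e \<in> cap_edges s. crossing u e}"
proof -
  let ?f = "\<lambda>(x, y). (- y, - x) :: (real^3) \<times> (real^3)"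
  have "{e \<in> cap_edges (- s). crossing u e} = ?f ` {e \<in> cap_edges s. crossing u e}"
  proof -
    have 1: "?f e \<in> cap_edges (- r)" if "e \<in> cap_edges r" for e r
      using that by (auto simp: cap_edges_def uminus_axis)
    have 2: "crossing u (?f e) \<longleftrightarrow> crossing u e" for e
      by (cases e) (auto simp: crossing_def)
    have 3: "?f (?f e) = e" for e by (cases e) simp
    show ?thesis
    proof
      show "?f ` {e \<in> cap_edges s. crossing u e} \<subseteq> {e \<in> cap_edges (- s). crossing u e}"
        using 1 2 by blast
      show "{e \<in> cap_edges (- s). crossing u e} \<subseteq> ?f ` {e \<in> cap_edges s. crossing u e}"
      proof
        fix e assume "e \<in> {e \<in> cap_edges (- s). crossing u e}"
        then have "?f e \<in> {e \<in> cap_edges s. crossing u e}" using 1[of e "- s"] 2[of e] by simp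
        then have "?f (?f e) \<in> ?f ` {e \<in> cap_edges s. crossing u e}" by (rule imageI)
        then show "e \<in> ?f ` {e \<in> cap_edges s. crossing u e}" by (simp only: 3)
      qed
    qed
  qed
  moreover have "inj_on ?f {e \<in> cap_edges s. crossing u e}" by (auto simp: inj_on_def)
  ultimately show ?thesis by (simp add: card_image)
qed

text \<open>The count is split so that only two summands involve \<open>s\<close>, and both are
  unchanged when \<open>s\<close> is replaced by its negative.\<close>

lemma card_slice_capped:
  assumes s: "signvec s" "signvec t" "s \<noteq> t"
  shows "card (vertices (capped s t \<inter> perp u)) =
    card {v \<in> octahedron_vertices. u \<bullet> v = 0} + of_bool (u \<bullet> s = 0) + of_bool (u \<bullet> t = 0) +
    card {e \<in> octahedron_edges. crossing u e} + card {e \<in> cap_edges s. crossing u e} +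
    card {e \<in> cap_edges t. crossing u e}"
proof -
  have nO: "2 *\<^sub>R r \<notin> octahedron_vertices" if "signvec r" for r
  proof
    assume "2 *\<^sub>R r \<in> octahedron_vertices"
    then obtain i q where "axis i q = 2 *\<^sub>R r" by (auto simp: octahedron_vertices_def)
    then show False using axis_neq_twice_signvec[OF that] by blast
  qed
  have "{v \<in> capped_vertices s t. u \<bullet> v = 0} =
      {v \<in> octahedron_vertices. u \<bullet> v = 0} \<union>
      ((if u \<bullet> s = 0 then {2 *\<^sub>R s} else {}) \<union> (if u \<bullet> t = 0 then {2 *\<^sub>R t} else {}))"
    by (auto simp: capped_vertices_def)
  also have "card \<dots> = card {v \<in> octahedron_vertices. u \<bullet> v = 0} +
      card ((if u \<bullet> s = 0 then {2 *\<^sub>R s} else {}) \<union> (if u \<bullet> t = 0 then {2 *\<^sub>R t} else {}))"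
    by (rule card_Un_disjoint) (use nO s finite_octahedron_vertices in auto)
  also have "card ((if u \<bullet> s = 0 then {2 *\<^sub>R s} else {}) \<union> (if u \<bullet> t = 0 then {2 *\<^sub>R t} else {})) =
      of_bool (u \<bullet> s = 0) + of_bool (u \<bullet> t = 0)"
    using s(3) by auto
  finally have V: "card {v \<in> vertices (capped s t). u \<bullet> v = 0} =
      card {v \<in> octahedron_vertices. u \<bullet> v = 0} + of_bool (u \<bullet> s = 0) + of_bool (u \<bullet> t = 0)"
    by (simp add: vertices_capped[OF s])
  have fin: "finite octahedron_edges" "finite (cap_edges s)" "finite (cap_edges t)"
    using finite_edges[OF polytope_capped[of s t]] unfolding edges_capped[OF s] by auto
  have st: "2 *\<^sub>R s \<noteq> 2 *\<^sub>R t" using s(3) by simp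
  have d1: "octahedron_edges \<inter> (cap_edges s \<union> cap_edges t) = {}"
    using nO s(1,2) by (auto simp: octahedron_edges_def cap_edges_def)
  have d2: "cap_edges s \<inter> cap_edges t = {}"
    using st axis_neq_twice_signvec[OF s(1)] axis_neq_twice_signvec[OF s(2)] unfolding cap_edges_def by fastforce
  have "{e \<in> edges (capped s t). crossing u e} = {e \<in> octahedron_edges. crossing u e} \<union>
      ({e \<in> cap_edges s. crossing u e} \<union> {e \<in> cap_edges t. crossing u e})"
    unfolding edges_capped[OF s] by blast
  also have "card \<dots> = card {e \<in> octahedron_edges. crossing u e} +
      card ({e \<in> cap_edges s. crossing u e} \<union> {e \<in> cap_edges t. crossing u e})"
    by (rule card_Un_disjoint) (use fin d1 in auto)
  also have "card ({e \<in> cap_edges s. crossing u e} \<union> {e \<in> cap_edges t. crossing u e}) =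
      card {e \<in> cap_edges s. crossing u e} + card {e \<in> cap_edges t. crossing u e}"
    by (rule card_Un_disjoint) (use fin d2 in auto)
  finally show ?thesis using V card_vertices_slice[OF polytope_capped[of s t], of u] by simp
qed

lemma pointwise_slice_equiv_capped:
  assumes s: "signvec s" "signvec t" "s \<noteq> t" "- s \<noteq> t"
  shows "pointwise_slice_equiv (capped s t) (capped (- s) t)"
  unfolding pointwise_slice_equiv_def
proof
  fix u :: "real^3" assume "u \<in> sphere 0 1"
  then have u: "u \<noteq> 0" by auto
  have "card (vertices (capped s t \<inter> perp u)) = card (vertices (capped (- s) t \<inter> perp u))"
    using card_slice_capped[OF s(1-3)] card_slice_capped[of "- s" t, OF _ s(2,4)] s(1)
    by (simp add: card_crossing_cap_edges_uminus)
  then show "capped s t \<inter> perp u \<simeq> capped (- s) t \<inter> perp u"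
    using three_le_card_vertices_slice[OF origin_polytope_capped u]
    by (intro polygon_equiv[OF u _ polytope_slice[OF polytope_capped] _ polytope_slice[OF polytope_capped] refl]) auto
qed

text \<open>In the first polytope both vertices \<open>5 e\<^sub>1\<close> and \<open>5 e\<^sub>2\<close> are adjacent to all but one of the
  other vertices; in the second one only \<open>- 5 e\<^sub>3\<close> is.\<close>

lemma capped_not_equiv:
  "\<not> capped (vector [1,1,1]) (vector [1,1,-1]) \<simeq> capped (- vector [1,1,1]) (vector [1,1,-1])"
proof
  let ?s = "vector [1,1,1] :: real^3" and ?t = "vector [1,1,-1] :: real^3"
  let ?P = "capped ?s ?t" and ?Q = "capped (- ?s) ?t"
  have s: "signvec ?s" "signvec ?t" "?s \<noteq> ?t" and s': "signvec (- ?s)" "signvec ?t" "- ?s \<noteq> ?t"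
    by (auto simp: signvec_def forall_3 vec3_eq)
  assume "?P \<simeq> ?Q"
  then obtain i where i: "face_lattice_iso i ?P ?Q" unfolding comb_equiv_def by blast
  let ?j = "vertex_map i"
  have bij: "bij_betw ?j (vertices ?P) (vertices ?Q)"
    by (rule bij_vertex_map[OF i polytope_capped polytope_capped])
  \<comment> \<open>Both caps have positive first and second coordinates, so \<open>x\<close> is
    adjacent to both of them and only its antipode is left.\<close>
  have P1: "y = - x" if x: "x = axis 1 5 \<or> x = axis 2 5" and y: "y \<in> vertices ?P" "y \<noteq> x" "(x, y) \<notin> edges ?P" for x y
  proof (cases "y \<in> octahedron_vertices")
    case True
    moreover have "x \<in> octahedron_vertices" using x by auto
    ultimately show ?thesis using y octahedron_edge_in_edges[OF s, of x y] by (auto simp: octahedron_edges_def)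
  next
    case False
    then have "y = 2 *\<^sub>R ?s \<or> y = 2 *\<^sub>R ?t" using y(1) by (auto simp: vertices_capped[OF s] capped_vertices_def)
    moreover have "(2 *\<^sub>R ?s, x) \<in> edges ?P" "(2 *\<^sub>R ?t, x) \<in> edges ?P"
      using x cap_edge_in_edges[OF s, of 1] cap_edge_in_edges[OF s, of 2]
        cap_edge_in_edges[OF s(2,1), of 1] cap_edge_in_edges[OF s(2,1), of 2] s(3) capped_commute[of ?s ?t] by auto
    ultimately show ?thesis using y(3) edges_sym by blast
  qed
  \<comment> \<open>A cap misses the vertices of the opposite facet; an octahedron vertex misses its
    antipode and any cap on the far side. Only -5 e_3 has both caps on its own side.\<close>
  have Q1: "\<exists>y z. y \<in> vertices ?Q \<and> z \<in> vertices ?Q \<and> y \<noteq> x \<and> z \<noteq> x \<and> y \<noteq> z \<and> (x, y) \<notin> edges ?Q \<and> (x, z) \<notin> edges ?Q"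
    if x: "x \<in> vertices ?Q" "x \<noteq> axis 3 (- 5)" for x
  proof -
    have neg: "(2 *\<^sub>R (- ?s), axis k 5) \<notin> edges ?Q" for k
      using not_edge_cap_opposite[OF s'(1), of k] exhaust_3[of k] by auto
    have pos: "(2 *\<^sub>R ?t, axis 1 (- 5)) \<notin> edges ?Q" "(2 *\<^sub>R ?t, axis 2 (- 5)) \<notin> edges ?Q"
      using not_edge_cap_opposite[OF s'(2), of 1] not_edge_cap_opposite[OF s'(2), of 2] by auto
    have VQ: "axis k 5 \<in> vertices ?Q" "axis k (-5) \<in> vertices ?Q" "2 *\<^sub>R (- ?s) \<in> vertices ?Q" "2 *\<^sub>R ?t \<in> vertices ?Q" for k
      by (auto simp: vertices_capped[OF s'] capped_vertices_def)
    have ne: "axis k r \<noteq> 2 *\<^sub>R (- ?s)" "axis k r \<noteq> 2 *\<^sub>R ?t" for k r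
      using axis_neq_twice_signvec[OF s'(1)] axis_neq_twice_signvec[OF s'(2)] by blast+
    have anti: "(axis k 5, axis k (- 5)) \<notin> edges ?Q" "(axis k (- 5), axis k 5) \<notin> edges ?Q" for k
      using not_edge_antipodal[of "axis k 5"] not_edge_antipodal[of "axis k (- 5)"] by (auto simp: uminus_axis)
    have ax: "axis k (5::real) \<noteq> axis k (- 5)" "axis (1::3) r \<noteq> axis 2 r" if "r \<noteq> 0" for k :: 3 and r :: real
      using that by (auto simp: axis_eq_axis)
    have oct: "(\<exists>k. x = axis k 5) \<or> x = axis 1 (- 5) \<or> x = axis 2 (- 5)" if xO: "x \<in> octahedron_vertices"
    proof -
      obtain k r where kr: "x = axis k r" "\<bar>r\<bar> = 5" using xO by (auto simp: octahedron_vertices_def)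
      then have "r = 5 \<or> r = - 5" by auto
      then show ?thesis using kr(1) x(2) exhaust_3[of k] by auto
    qed
    have "x \<in> octahedron_vertices \<or> x = 2 *\<^sub>R (- ?s) \<or> x = 2 *\<^sub>R ?t"
      using x(1) by (auto simp: vertices_capped[OF s'] capped_vertices_def)
    with oct consider "x = 2 *\<^sub>R (- ?s)" | "x = 2 *\<^sub>R ?t" | k where "x = axis k 5" | "x = axis 1 (- 5)" | "x = axis 2 (- 5)"
      by metis
    then show ?thesis
    proof cases
      case 1
      then show ?thesis using neg[of 1] neg[of 2] VQ ne(1) ax(2)[of 5] by (intro exI[of _ "axis 1 5"] exI[of _ "axis 2 5"]) simp
    next
      case 2
      then show ?thesis using pos VQ ne(2) ax(2)[of "-5"] by (intro exI[of _ "axis 1 (-5)"] exI[of _ "axis 2 (-5)"]) simp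
    next
      case (3 k)
      have "(x, 2 *\<^sub>R (- ?s)) \<notin> edges ?Q" "(x, axis k (- 5)) \<notin> edges ?Q" using neg[of k] anti(1)[of k] edges_sym 3 by blast+
      moreover have "x \<noteq> axis k (- 5)" "x \<noteq> 2 *\<^sub>R (- ?s)" using ax(1)[of 1 k] ne(1) 3 by auto
      ultimately show ?thesis using VQ(2)[of k] VQ(3) ne(1)[of k "- 5"] by metis
    next
      case 4
      have "(x, 2 *\<^sub>R ?t) \<notin> edges ?Q" "(x, axis 1 5) \<notin> edges ?Q" using pos(1) anti(2)[of 1] edges_sym 4 by blast+
      moreover have "x \<noteq> axis 1 5" "x \<noteq> 2 *\<^sub>R ?t" using ax(1)[of 1 1] ne(2) 4 by auto
      ultimately show ?thesis using VQ(1)[of 1] VQ(4) ne(2)[of 1 5] by metis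
    next
      case 5
      have "(x, 2 *\<^sub>R ?t) \<notin> edges ?Q" "(x, axis 2 5) \<notin> edges ?Q" using pos(2) anti(2)[of 2] edges_sym 5 by blast+
      moreover have "x \<noteq> axis 2 5" "x \<noteq> 2 *\<^sub>R ?t" using ax(1)[of 1 2] ne(2) 5 by auto
      ultimately show ?thesis using VQ(1)[of 2] VQ(4) ne(2)[of 2 5] by metis
    qed
  qed
  have image: "?j x = axis 3 (- 5)" if x: "x = axis 1 5 \<or> x = axis 2 5" for x
  proof (rule ccontr)
    have xV: "x \<in> vertices ?P" using x by (auto simp: vertices_capped[OF s] capped_vertices_def)
    assume "?j x \<noteq> axis 3 (- 5)"
    moreover have "?j x \<in> vertices ?Q" using bij xV by (auto simp: bij_betw_def)
    ultimately obtain y z where yz: "y \<in> vertices ?Q" "z \<in> vertices ?Q" "y \<noteq> ?j x" "z \<noteq> ?j x" "y \<noteq> z"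
      "(?j x, y) \<notin> edges ?Q" "(?j x, z) \<notin> edges ?Q" using Q1 by blast
    \<comment> \<open>Edges map to edges, so a nonneighbour of \<open>?j x\<close> comes from a
      nonneighbour of \<open>x\<close>, and \<open>x\<close> has only one.\<close>
    have "w = ?j (- x)" if w: "w \<in> vertices ?Q" "w \<noteq> ?j x" "(?j x, w) \<notin> edges ?Q" for w
    proof -
      obtain w' where w': "w' \<in> vertices ?P" "w = ?j w'" using bij w(1) by (auto simp: bij_betw_def)
      then have "w' \<noteq> x" "(x, w') \<notin> edges ?P"
        using w iso_edges[OF i polytope_capped polytope_capped] by auto
      then have "w' = - x" using P1[OF x w'(1)] by blast
      then show ?thesis using w'(2) by simp
    qed
    then show False using yz by metis
  qed
  have "?j (axis 1 5) = ?j (axis 2 5)" using image by simp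
  moreover have "axis 1 5 \<in> vertices ?P" "axis 2 5 \<in> vertices ?P"
    by (auto simp: vertices_capped[OF s] capped_vertices_def)
  ultimately have "axis 1 5 = (axis 2 5 :: real^3)" using bij by (auto simp: bij_betw_def inj_on_def)
  then show False by (simp add: axis_eq_axis)
qed

lemma example_pointwise_not_equiv:
  "\<exists>P Q :: (real^3) set. origin_polytope P \<and> origin_polytope Q \<and> pointwise_slice_equiv P Q \<and> \<not> P \<simeq> Q"
proof -
  have "pointwise_slice_equiv (capped (vector [1,1,1]) (vector [1,1,-1])) (capped (- vector [1,1,1]) (vector [1,1,-1]))"
    by (rule pointwise_slice_equiv_capped) (auto simp: signvec_def forall_3 vec3_eq)
  then show ?thesis using capped_not_equiv origin_polytope_capped by blast
qed

section \<open>Assembly of the implications and the separating pairs\<close>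

theorem theorem5p7:
  "(CARD('n::finite) \<ge> 3 \<longrightarrow>
     (\<forall>P Q :: (real^'n) set. origin_polytope P \<and> origin_polytope Q \<longrightarrow>
        (equiv_inducing_signed_arrangement P Q \<longrightarrow> equiv_inducing_OM P Q) \<and>
        (equiv_inducing_signed_arrangement P Q \<longrightarrow> pointwise_slice_equiv P Q) \<and>
        (equiv_inducing_OM P Q \<longrightarrow> comb_equiv P Q) \<and>
        (equiv_inducing_OM P Q \<longrightarrow> setwise_slice_equiv P Q) \<and>
        (pointwise_slice_equiv P Q \<longrightarrow> setwise_slice_equiv P Q) \<and>
        (pointwise_slice_equiv P Q \<longrightarrow> same_arrangement P Q))) \<and>
   not_implies_3d equiv_inducing_OM equiv_inducing_signed_arrangement \<and>
   not_implies_3d pointwise_slice_equiv equiv_inducing_signed_arrangement \<and>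
   not_implies_3d comb_equiv equiv_inducing_OM \<and>
   not_implies_3d setwise_slice_equiv equiv_inducing_OM \<and>
   not_implies_3d setwise_slice_equiv pointwise_slice_equiv \<and>
   not_implies_3d same_arrangement pointwise_slice_equiv \<and>
   not_implies_3d equiv_inducing_OM pointwise_slice_equiv \<and>
   not_implies_3d pointwise_slice_equiv equiv_inducing_OM \<and>
   not_implies_3d equiv_inducing_OM same_arrangement \<and>
   not_implies_3d same_arrangement equiv_inducing_OM \<and>
   not_implies_3d pointwise_slice_equiv comb_equiv \<and>
   not_implies_3d comb_equiv pointwise_slice_equiv \<and>
   not_implies_3d comb_equiv setwise_slice_equiv \<and>
   not_implies_3d setwise_slice_equiv comb_equiv \<and>
   not_implies_3d comb_equiv same_arrangement \<and>
   not_implies_3d same_arrangement comb_equiv \<and>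
   not_implies_3d setwise_slice_equiv same_arrangement \<and>
   not_implies_3d same_arrangement setwise_slice_equiv"
proof -
  \<comment> \<open>A type variable of its own lets this fact serve both dimension \<open>'n\<close>
    and dimension three.\<close>
  have main: "(equiv_inducing_signed_arrangement P Q \<longrightarrow> equiv_inducing_OM P Q) \<and>
      (equiv_inducing_signed_arrangement P Q \<longrightarrow> pointwise_slice_equiv P Q) \<and>
      (equiv_inducing_OM P Q \<longrightarrow> comb_equiv P Q) \<and>
      (equiv_inducing_OM P Q \<longrightarrow> setwise_slice_equiv P Q) \<and>
      (pointwise_slice_equiv P Q \<longrightarrow> setwise_slice_equiv P Q) \<and>
      (pointwise_slice_equiv P Q \<longrightarrow> same_arrangement P Q)"
    if d: "CARD('k::finite) \<ge> 3" and PQ: "origin_polytope P" "origin_polytope Q" for P Q :: "(real^'k) set"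
  proof -
    have "DIM(real^'k) \<ge> 3" using d by simp
    then show ?thesis
      using signed_arrangement_imp_OM signed_arrangement_imp_pointwise OM_imp_comb_equiv
        OM_imp_setwise[OF PQ] pointwise_imp_setwise pointwise_imp_same_arrangement[OF PQ] origin_polytopeD(1) PQ
      by blast
  qed
  have imp: "equiv_inducing_signed_arrangement P Q \<Longrightarrow> pointwise_slice_equiv P Q"
      "equiv_inducing_OM P Q \<Longrightarrow> comb_equiv P Q" "equiv_inducing_OM P Q \<Longrightarrow> setwise_slice_equiv P Q"
      "pointwise_slice_equiv P Q \<Longrightarrow> setwise_slice_equiv P Q" "pointwise_slice_equiv P Q \<Longrightarrow> same_arrangement P Q"
      "equiv_inducing_signed_arrangement P Q \<Longrightarrow> equiv_inducing_OM P Q"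
    if "origin_polytope P" "origin_polytope Q" for P Q :: "(real^3) set"
    using main[OF _ that] by simp_all
  \<comment> \<open>The four pairs have (C) without (D), (B) without (F), (D) without (E) and (F)
    without (E); \<open>p1\<close> to \<open>p4\<close> collect what \<open>imp\<close> adds to
    each.\<close>
  obtain P1 Q1 :: "(real^3) set" where 1: "origin_polytope P1" "origin_polytope Q1" "pointwise_slice_equiv P1 Q1" "\<not> comb_equiv P1 Q1"
    using example_pointwise_not_equiv by blast
  obtain P2 Q2 :: "(real^3) set" where 2: "origin_polytope P2" "origin_polytope Q2" "equiv_inducing_OM P2 Q2" "\<not> same_arrangement P2 Q2"
    using example_OM_not_arrangement by blast
  obtain P3 Q3 :: "(real^3) set" where 3: "origin_polytope P3" "origin_polytope Q3" "comb_equiv P3 Q3" "\<not> setwise_slice_equiv P3 Q3"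
    using example_equiv_not_setwise by blast
  obtain P4 Q4 :: "(real^3) set" where 4: "origin_polytope P4" "origin_polytope Q4" "same_arrangement P4 Q4" "\<not> setwise_slice_equiv P4 Q4"
    using example_arrangement_not_setwise by blast
  note i1 = imp[OF 1(1,2)] and i2 = imp[OF 2(1,2)] and i3 = imp[OF 3(1,2)] and i4 = imp[OF 4(1,2)]
  have n1: "X P1 Q1 \<Longrightarrow> \<not> Y P1 Q1 \<Longrightarrow> not_implies_3d X Y" and n2: "X P2 Q2 \<Longrightarrow> \<not> Y P2 Q2 \<Longrightarrow> not_implies_3d X Y"
    and n3: "X P3 Q3 \<Longrightarrow> \<not> Y P3 Q3 \<Longrightarrow> not_implies_3d X Y" and n4: "X P4 Q4 \<Longrightarrow> \<not> Y P4 Q4 \<Longrightarrow> not_implies_3d X Y" for X Y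
    unfolding not_implies_3d_def using 1(1,2) 2(1,2) 3(1,2) 4(1,2) by blast+
  have p1: "setwise_slice_equiv P1 Q1" "same_arrangement P1 Q1" "\<not> equiv_inducing_OM P1 Q1" "\<not> equiv_inducing_signed_arrangement P1 Q1"
    using 1(3,4) i1 by blast+
  have p2: "setwise_slice_equiv P2 Q2" "comb_equiv P2 Q2" "\<not> pointwise_slice_equiv P2 Q2" "\<not> equiv_inducing_signed_arrangement P2 Q2"
    using 2(3,4) i2 by blast+
  have p3: "\<not> equiv_inducing_OM P3 Q3" "\<not> pointwise_slice_equiv P3 Q3" using 3(3,4) i3 by blast+
  have p4: "\<not> equiv_inducing_OM P4 Q4" "\<not> pointwise_slice_equiv P4 Q4" using 4(3,4) i4 by blast+
  show ?thesis
  proof (intro conjI)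
    show "CARD('n::finite) \<ge> 3 \<longrightarrow>
     (\<forall>P Q :: (real^'n) set. origin_polytope P \<and> origin_polytope Q \<longrightarrow>
        (equiv_inducing_signed_arrangement P Q \<longrightarrow> equiv_inducing_OM P Q) \<and>
        (equiv_inducing_signed_arrangement P Q \<longrightarrow> pointwise_slice_equiv P Q) \<and>
        (equiv_inducing_OM P Q \<longrightarrow> comb_equiv P Q) \<and>
        (equiv_inducing_OM P Q \<longrightarrow> setwise_slice_equiv P Q) \<and>
        (pointwise_slice_equiv P Q \<longrightarrow> setwise_slice_equiv P Q) \<and>
        (pointwise_slice_equiv P Q \<longrightarrow> same_arrangement P Q))"
      using main by blast
  qed (rule n1 n2 n3 n4; fact 1(3,4) 2(3,4) 3(3,4) 4(3,4) p1 p2 p3 p4)+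
qed

end
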